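(* Let $\delta\in(0,1)$. Assume that each of the pairs $(\Phi_0,\Phi)$ and $(\Psi_0,\Psi)$ is admissible (with respect to $\delta$). For any $j\in\mathbb N$, define $\Phi_j(\lambda):=\Phi(\delta^{j\beta_0/2}\lambda)$ and $\Psi_j(\lambda):=\Psi(\delta^{j\beta_0/2}\lambda)$, $\lambda\in[0,\infty)$. Then, for any $m\in\mathbb Z_+$ and $\sigma>d$, there exists a constant $C_{\sigma,m}\in(1,\infty)$ such that, for all $j,k\in\mathbb N$ and $x,y\in M$, $$\big|(\Phi_j(\sqrt L)\Psi_k(\sqrt L))(x,y)\big|\le C_{\sigma,m}\,\delta^{|k-j|(m\beta_0-d)}D_{\delta^{\min\{k,j\}},\sigma}(x,y).$$
   Context: Setting. $(M,\rho)$ is a locally compact complete metric space, $B(x,r):=\{y\in M:\rho(x,y)<r\}$, and $\mu$ is a positive regular Borel measure on $M$; write $|E|:=\mu(E)$. Assume: (doubling) there is $K>0$ with $|B(x,2r)|\le K|B(x,r)|$ for all $x\in M$, $r>0$; set $d:=\log_2K>0$; (reverse doubling) there is $K_*>1$ with $|B(x,2r)|\ge K_*|B(x,r)|$ for all $x\in M$ and $0<r\le\operatorname{diam}(M)/3$; (non-collapsing) $\inf_{x\in M}|B(x,1)|\ge c_0>0$. $L$ is a nonnegative self-adjoint operator on $L^2(M)$ with dense domain; functions of $L$ (and of $\sqrt L$) are defined by the spectral calculus $f(L)=\int_0^\infty f(\lambda)\,dE_\lambda$. The heat semigroup consists of integral operators $e^{-tL}f(x)=\int_Mp_t(x,y)f(y)\,d\mu(y)$,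 and there are constants $C^*,c^*,\alpha_0\in(0,\infty)$, $\beta_0\in[2,\infty)$ such that: (UE) for $t\in(0,1]$, $x,y\in M$: $|p_t(x,y)|\le C^*\dfrac{\exp(-c^*[\rho(x,y)/t^{1/\beta_0}]^{\beta_0/(\beta_0-1)})}{\sqrt{|B(x,t^{1/\beta_0})||B(y,t^{1/\beta_0})|}}$; (HE) for $t\in(0,1]$ and $\rho(y,y')\le t^{1/\beta_0}$: $|p_t(x,y)-p_t(x,y')|\le C^*\big[\frac{\rho(y,y')}{t^{1/\beta_0}}\big]^{\alpha_0}\dfrac{\exp(-c^*[\rho(x,y)/t^{1/\beta_0}]^{\beta_0/(\beta_0-1)})}{\sqrt{|B(x,t^{1/\beta_0})||B(y,t^{1/\beta_0})|}}$; (SC) $\int_Mp_t(x,y)\,d\mu(y)=1$ for all $t>0$, $x\in M$. $\mathbb N=\{1,2,\dots\}$, $\mathbb Z_+=\{0\}\cup\mathbb N$. Admissible pairs. A pair $(\Phi_0,\Phi)$ of functions in $C^\infty([0,\infty))$ is admissible with respect to $\delta\in(0,1)$ if, for some $c>0$: $\operatorname{supp}\Phi_0\subset[0,\delta^{-\beta_0/2}]$, $\Phi_0^{(2\nu+1)}(0)=0$ for all $\nu\in\mathbb Z_+$, $|\Phi_0|\ge c$ on $[0,\delta^{-3\beta_0/8}]$; and $\operatorname{supp}\Phi\subset[\delta^{\beta_0/2},\delta^{-\beta_0/2}]$, $|\Phi|\ge c$ on $[\delta^{3\beta_0/8},\delta^{-3\beta_0/8}]$. Kernels. For $r,\sigma\in(0,\infty)$,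 $D_{r,\sigma}(x,y):=\dfrac1{\sqrt{|B(x,r)||B(y,r)|}}\dfrac1{[1+r^{-1}\rho(x,y)]^\sigma}$. For an integral operator $T$, $T(x,y)$ denotes its kernel. The constant may depend on the functions $\Phi,\Psi$, on $\delta$, and on the constants of the setting. *)

theory Defs
  imports "HOL-Analysis.Analysis"
begin

section \<open>Regular Borel measures\<close>

definition regular_borel_measure :: "'a::topological_space measure \<Rightarrow> bool" where
  "regular_borel_measure \<mu> \<longleftrightarrow>
     sets \<mu> = sets borel \<and>
     (\<forall>C. compact C \<longrightarrow> emeasure \<mu> C < \<infinity>) \<and>
     (\<forall>A\<in>sets borel. emeasure \<mu> A = (INF U\<in>{U. open U \<and> A \<subseteq> U}. emeasure \<mu> U)) \<and>
     (\<forall>U. open U \<longrightarrow> emeasure \<mu> U = (SUP C\<in>{C. compact C \<and> C \<subseteq> U}. emeasure \<mu> C))"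


section \<open>Operators on the complex Hilbert space \<open>L\<^sup>2\<close>\<close>

text \<open>Elements of \<open>L\<^sup>2\<close> are represented by square-integrable functions; almost everywhere
  equality is made explicit wherever classes are meant.\<close>

definition L2 :: "'a measure \<Rightarrow> ('a \<Rightarrow> complex) set" where
  "L2 \<mu> = {f \<in> borel_measurable \<mu>. integrable \<mu> (\<lambda>x. (cmod (f x))\<^sup>2)}"

definition l2_norm :: "'a measure \<Rightarrow> ('a \<Rightarrow> complex) \<Rightarrow> real" where
  "l2_norm \<mu> f = sqrt (\<integral>x. (cmod (f x))\<^sup>2 \<partial>\<mu>)"

definition l2_inner :: "'a measure \<Rightarrow> ('a \<Rightarrow> complex) \<Rightarrow> ('a \<Rightarrow> complex) \<Rightarrow> complex" where
  "l2_inner \<mu> f g = (\<integral>x. f x * cnj (g x) \<partial>\<mu>)"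

definition l2_dense :: "'a measure \<Rightarrow> ('a \<Rightarrow> complex) set \<Rightarrow> bool" where
  "l2_dense \<mu> D \<longleftrightarrow> (\<forall>f\<in>L2 \<mu>. \<forall>e>0. \<exists>g\<in>D. l2_norm \<mu> (\<lambda>x. f x - g x) < e)"

text \<open>A possibly unbounded operator with domain \<open>D\<close>; its values outside \<open>D\<close> are irrelevant.\<close>

definition linear_operator ::
  "'a measure \<Rightarrow> ('a \<Rightarrow> complex) set \<Rightarrow> (('a \<Rightarrow> complex) \<Rightarrow> ('a \<Rightarrow> complex)) \<Rightarrow> bool" where
  "linear_operator \<mu> D T \<longleftrightarrow>
     D \<subseteq> L2 \<mu> \<and> (\<lambda>x. 0) \<in> D \<and>
     (\<forall>f\<in>D. \<forall>g\<in>D. \<forall>a b. (\<lambda>x. a * f x + b * g x) \<in> D) \<and>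
     (\<forall>f\<in>D. \<forall>g\<in>L2 \<mu>. (AE x in \<mu>. f x = g x) \<longrightarrow> g \<in> D \<and> (AE x in \<mu>. T f x = T g x)) \<and>
     (\<forall>f\<in>D. T f \<in> L2 \<mu>) \<and>
     (\<forall>f\<in>D. \<forall>g\<in>D. \<forall>a b.
        AE x in \<mu>. T (\<lambda>x. a * f x + b * g x) x = a * T f x + b * T g x)"

text \<open>The equivalence below says that \<open>T\<close> and its adjoint have the same graph.\<close>

definition self_adjoint_operator ::
  "'a measure \<Rightarrow> ('a \<Rightarrow> complex) set \<Rightarrow> (('a \<Rightarrow> complex) \<Rightarrow> ('a \<Rightarrow> complex)) \<Rightarrow> bool" where
  "self_adjoint_operator \<mu> D T \<longleftrightarrow>
     linear_operator \<mu> D T \<and> l2_dense \<mu> D \<and>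
     (\<forall>g\<in>L2 \<mu>. \<forall>h\<in>L2 \<mu>.
        (\<forall>f\<in>D. l2_inner \<mu> (T f) g = l2_inner \<mu> f h) \<longleftrightarrow>
        g \<in> D \<and> (AE x in \<mu>. T g x = h x))"

definition nonnegative_operator ::
  "'a measure \<Rightarrow> ('a \<Rightarrow> complex) set \<Rightarrow> (('a \<Rightarrow> complex) \<Rightarrow> ('a \<Rightarrow> complex)) \<Rightarrow> bool" where
  "nonnegative_operator \<mu> D T \<longleftrightarrow> (\<forall>f\<in>D. 0 \<le> Re (l2_inner \<mu> (T f) f))"

definition has_kernel ::
  "'a measure \<Rightarrow> (('a \<Rightarrow> complex) \<Rightarrow> ('a \<Rightarrow> complex)) \<Rightarrow> ('a \<Rightarrow> 'a \<Rightarrow> complex) \<Rightarrow> bool" where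
  "has_kernel \<mu> T k \<longleftrightarrow>
     (\<lambda>(x, y). k x y) \<in> borel_measurable (\<mu> \<Otimes>\<^sub>M \<mu>) \<and>
     (\<forall>f\<in>L2 \<mu>. AE x in \<mu>. integrable \<mu> (\<lambda>y. k x y * f y) \<and>
                            T f x = (\<integral>y. k x y * f y \<partial>\<mu>))"


section \<open>Spectral calculus on \<open>[0, \<infinity>)\<close>\<close>

abbreviation half_line :: "real measure" where
  "half_line \<equiv> restrict_space borel {0..}"

definition projection_valued_measure ::
  "'a measure \<Rightarrow> (real set \<Rightarrow> ('a \<Rightarrow> complex) \<Rightarrow> ('a \<Rightarrow> complex)) \<Rightarrow> bool" where
  "projection_valued_measure \<mu> E \<longleftrightarrow>
     (\<forall>A\<in>sets half_line. linear_operator \<mu> (L2 \<mu>) (E A)) \<and>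
     (\<forall>A\<in>sets half_line. \<forall>f\<in>L2 \<mu>. \<forall>g\<in>L2 \<mu>.
        l2_inner \<mu> (E A f) g = l2_inner \<mu> f (E A g)) \<and>
     (\<forall>A\<in>sets half_line. \<forall>B\<in>sets half_line. \<forall>f\<in>L2 \<mu>.
        AE x in \<mu>. E (A \<inter> B) f x = E A (E B f) x) \<and>
     (\<forall>f\<in>L2 \<mu>. AE x in \<mu>. E {0..} f x = f x) \<and>
     (\<forall>A. range A \<subseteq> sets half_line \<longrightarrow> disjoint_family A \<longrightarrow>
        (\<forall>f\<in>L2 \<mu>. \<forall>g\<in>L2 \<mu>.
          (\<lambda>n::nat. l2_inner \<mu> (E (A n) f) g) sums l2_inner \<mu> (E (\<Union>n. A n) f) g))"

text \<open>The measure \<open>d\<langle>E\<^sub>\<lambda> f, f\<rangle>\<close>; being carried by \<open>half_line\<close>, integrals against it are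
  integrals over \<open>[0, \<infinity>)\<close>.\<close>

definition spectral_scalar_measure ::
  "'a measure \<Rightarrow> (real set \<Rightarrow> ('a \<Rightarrow> complex) \<Rightarrow> ('a \<Rightarrow> complex)) \<Rightarrow> ('a \<Rightarrow> complex) \<Rightarrow> real measure" where
  "spectral_scalar_measure \<mu> E f =
     measure_of {0..} (sets half_line) (\<lambda>A. ennreal (Re (l2_inner \<mu> (E A f) f)))"

definition spectral_domain ::
  "'a measure \<Rightarrow> (real set \<Rightarrow> ('a \<Rightarrow> complex) \<Rightarrow> ('a \<Rightarrow> complex)) \<Rightarrow> (real \<Rightarrow> complex)
    \<Rightarrow> ('a \<Rightarrow> complex) set" where
  "spectral_domain \<mu> E \<phi> =
     {f \<in> L2 \<mu>. (\<integral>\<^sup>+u. ennreal ((cmod (\<phi> u))\<^sup>2) \<partial>spectral_scalar_measure \<mu> E f) < \<infinity>}"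

text \<open>\<open>T = \<integral> \<phi> dE\<close>: the linear operator on the above domain with
  \<open>\<langle>T f, f\<rangle> = \<integral> \<phi> d\<langle>E\<^sub>\<lambda> f, f\<rangle>\<close>. By polarization and density of the domain, this determines
  \<open>T f\<close> almost everywhere for each \<open>f\<close> in the domain.\<close>

definition has_spectral_integral ::
  "'a measure \<Rightarrow> (real set \<Rightarrow> ('a \<Rightarrow> complex) \<Rightarrow> ('a \<Rightarrow> complex)) \<Rightarrow> (real \<Rightarrow> complex)
    \<Rightarrow> (('a \<Rightarrow> complex) \<Rightarrow> ('a \<Rightarrow> complex)) \<Rightarrow> bool" where
  "has_spectral_integral \<mu> E \<phi> T \<longleftrightarrow>
     linear_operator \<mu> (spectral_domain \<mu> E \<phi>) T \<and>
     (\<forall>f\<in>spectral_domain \<mu> E \<phi>.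
        l2_inner \<mu> (T f) f = (\<integral>u. \<phi> u \<partial>spectral_scalar_measure \<mu> E f))"

definition spectral_integral ::
  "'a measure \<Rightarrow> (real set \<Rightarrow> ('a \<Rightarrow> complex) \<Rightarrow> ('a \<Rightarrow> complex)) \<Rightarrow> (real \<Rightarrow> complex)
    \<Rightarrow> ('a \<Rightarrow> complex) \<Rightarrow> ('a \<Rightarrow> complex)" where
  "spectral_integral \<mu> E \<phi> = (SOME T. has_spectral_integral \<mu> E \<phi> T)"

text \<open>\<open>E\<close> is the spectral measure of the operator \<open>T\<close> with domain \<open>D\<close>, i.e.
  \<open>T = \<integral> \<lambda> dE\<^sub>\<lambda>\<close> including equality of domains.\<close>

definition spectral_measure_of ::
  "'a measure \<Rightarrow> (real set \<Rightarrow> ('a \<Rightarrow> complex) \<Rightarrow> ('a \<Rightarrow> complex)) \<Rightarrow> ('a \<Rightarrow> complex) set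
    \<Rightarrow> (('a \<Rightarrow> complex) \<Rightarrow> ('a \<Rightarrow> complex)) \<Rightarrow> bool" where
  "spectral_measure_of \<mu> E D T \<longleftrightarrow>
     projection_valued_measure \<mu> E \<and>
     D = spectral_domain \<mu> E complex_of_real \<and>
     has_spectral_integral \<mu> E complex_of_real T"

text \<open>With \<open>E\<close> the spectral measure of \<open>L\<close>, this is \<open>\<phi>(\<surd>L) = \<integral> \<phi>(\<surd>\<lambda>) dE\<^sub>\<lambda>\<close>.\<close>

definition fun_of_sqrt ::
  "'a measure \<Rightarrow> (real set \<Rightarrow> ('a \<Rightarrow> complex) \<Rightarrow> ('a \<Rightarrow> complex)) \<Rightarrow> (real \<Rightarrow> complex)
    \<Rightarrow> ('a \<Rightarrow> complex) \<Rightarrow> ('a \<Rightarrow> complex)" where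
  "fun_of_sqrt \<mu> E \<phi> = spectral_integral \<mu> E (\<lambda>u. \<phi> (sqrt u))"


section \<open>The setting\<close>

definition heat_bound ::
  "'a::metric_space measure \<Rightarrow> real \<Rightarrow> real \<Rightarrow> real \<Rightarrow> 'a \<Rightarrow> 'a \<Rightarrow> real" where
  "heat_bound \<mu> c \<beta>\<^sub>0 t x y =
     exp (- c * (dist x y / t powr (1 / \<beta>\<^sub>0)) powr (\<beta>\<^sub>0 / (\<beta>\<^sub>0 - 1))) /
     sqrt (measure \<mu> (ball x (t powr (1 / \<beta>\<^sub>0))) * measure \<mu> (ball y (t powr (1 / \<beta>\<^sub>0))))"

text \<open>In \<open>reverse_doubling\<close> the side condition \<open>r \<le> diam(M)/3\<close> is void for unbounded \<open>M\<close>,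
  where \<open>diameter UNIV\<close> has no meaning. Finiteness and positivity of the measures of balls
  follow from regularity, \<open>doubling\<close> and \<open>non_collapsing\<close>.\<close>

locale heat_setting =
  fixes \<mu> :: "'a::complete_space measure"
    and K K\<^sub>s c\<^sub>0 :: real
    and D :: "('a \<Rightarrow> complex) set"
    and L :: "('a \<Rightarrow> complex) \<Rightarrow> ('a \<Rightarrow> complex)"
    and E :: "real set \<Rightarrow> ('a \<Rightarrow> complex) \<Rightarrow> ('a \<Rightarrow> complex)"
    and p :: "real \<Rightarrow> 'a \<Rightarrow> 'a \<Rightarrow> complex"
    and C c \<alpha>\<^sub>0 \<beta>\<^sub>0 :: real
  assumes locally_compact: "locally compact (UNIV :: 'a set)"
    and regular: "regular_borel_measure \<mu>"
    and K_pos: "K > 0"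
    and dim_pos: "log 2 K > 0"
    and doubling: "r > 0 \<Longrightarrow> emeasure \<mu> (ball x (2 * r)) \<le> ennreal K * emeasure \<mu> (ball x r)"
    and K\<^sub>s_gt_1: "K\<^sub>s > 1"
    and reverse_doubling:
      "0 < r \<Longrightarrow> (bounded (UNIV :: 'a set) \<longrightarrow> r \<le> diameter (UNIV :: 'a set) / 3) \<Longrightarrow>
         emeasure \<mu> (ball x (2 * r)) \<ge> ennreal K\<^sub>s * emeasure \<mu> (ball x r)"
    and c\<^sub>0_pos: "c\<^sub>0 > 0"
    and non_collapsing: "(INF x. emeasure \<mu> (ball x 1)) \<ge> ennreal c\<^sub>0"
    and self_adjoint: "self_adjoint_operator \<mu> D L"
    and nonnegative: "nonnegative_operator \<mu> D L"
    and spectral_measure: "spectral_measure_of \<mu> E D L"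
    and C_pos: "C > 0" and c_pos: "c > 0" and \<alpha>\<^sub>0_pos: "\<alpha>\<^sub>0 > 0" and \<beta>\<^sub>0_ge_2: "\<beta>\<^sub>0 \<ge> 2"
    and heat_kernel:
      "t > 0 \<Longrightarrow> has_kernel \<mu> (spectral_integral \<mu> E (\<lambda>u. complex_of_real (exp (- t * u)))) (p t)"
    and UE: "0 < t \<Longrightarrow> t \<le> 1 \<Longrightarrow> cmod (p t x y) \<le> C * heat_bound \<mu> c \<beta>\<^sub>0 t x y"
    and HE: "0 < t \<Longrightarrow> t \<le> 1 \<Longrightarrow> dist y y' \<le> t powr (1 / \<beta>\<^sub>0) \<Longrightarrow>
      cmod (p t x y - p t x y') \<le>
        C * (dist y y' / t powr (1 / \<beta>\<^sub>0)) powr \<alpha>\<^sub>0 * heat_bound \<mu> c \<beta>\<^sub>0 t x y"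
    and SC: "t > 0 \<Longrightarrow> (\<integral>y. p t x y \<partial>\<mu>) = 1"


section \<open>Admissible pairs and the kernels \<open>D\<close>\<close>

text \<open>Iterated derivatives on \<open>[0, \<infinity>)\<close>, one-sided at \<open>0\<close>; only values at arguments
  \<open>x \<ge> 0\<close> are meaningful.\<close>

definition half_deriv :: "nat \<Rightarrow> (real \<Rightarrow> complex) \<Rightarrow> real \<Rightarrow> complex" where
  "half_deriv n = ((\<lambda>f x. vector_derivative f (at x within {0..})) ^^ n)"

definition half_smooth :: "(real \<Rightarrow> complex) \<Rightarrow> bool" where
  "half_smooth f \<longleftrightarrow> (\<forall>n. \<forall>x\<ge>0. half_deriv n f differentiable (at x within {0..}))"

definition half_supp :: "(real \<Rightarrow> complex) \<Rightarrow> real set" where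
  "half_supp f = closure {x. x \<ge> 0 \<and> f x \<noteq> 0}"

definition admissible ::
  "real \<Rightarrow> real \<Rightarrow> (real \<Rightarrow> complex) \<Rightarrow> (real \<Rightarrow> complex) \<Rightarrow> bool" where
  "admissible \<beta>\<^sub>0 \<delta> \<Phi>\<^sub>0 \<Phi> \<longleftrightarrow>
     half_smooth \<Phi>\<^sub>0 \<and> half_smooth \<Phi> \<and>
     (\<exists>c>0.
        half_supp \<Phi>\<^sub>0 \<subseteq> {0 .. \<delta> powr (- \<beta>\<^sub>0 / 2)} \<and>
        (\<forall>\<nu>. half_deriv (2 * \<nu> + 1) \<Phi>\<^sub>0 0 = 0) \<and>
        (\<forall>u\<in>{0 .. \<delta> powr (- 3 * \<beta>\<^sub>0 / 8)}. c \<le> cmod (\<Phi>\<^sub>0 u)) \<and>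
        half_supp \<Phi> \<subseteq> {\<delta> powr (\<beta>\<^sub>0 / 2) .. \<delta> powr (- \<beta>\<^sub>0 / 2)} \<and>
        (\<forall>u\<in>{\<delta> powr (3 * \<beta>\<^sub>0 / 8) .. \<delta> powr (- 3 * \<beta>\<^sub>0 / 8)}. c \<le> cmod (\<Phi> u)))"

definition dilate :: "real \<Rightarrow> real \<Rightarrow> (real \<Rightarrow> complex) \<Rightarrow> nat \<Rightarrow> real \<Rightarrow> complex" where
  "dilate \<beta>\<^sub>0 \<delta> \<Phi> j u = \<Phi> (\<delta> powr (real j * \<beta>\<^sub>0 / 2) * u)"

definition D_kernel ::
  "'a::metric_space measure \<Rightarrow> real \<Rightarrow> real \<Rightarrow> 'a \<Rightarrow> 'a \<Rightarrow> real" where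
  "D_kernel \<mu> r \<sigma> x y =
     1 / sqrt (measure \<mu> (ball x r) * measure \<mu> (ball y r)) * (1 / (1 + dist x y / r) powr \<sigma>)"

end

theory Submission
  imports Defs
begin

text \<open>
  Only neighbouring scales matter. The factors \<open>\<Phi>\<^sub>j\<close> and \<open>\<Psi>\<^sub>k\<close> live on intervals around \<open>\<delta> powr (-j \<beta>\<^sub>0/2)\<close>
  and \<open>\<delta> powr (-k \<beta>\<^sub>0/2)\<close> which for \<open>|j - k| \<ge> 2\<close> share at most an end point, where both functions
  vanish; the product of the symbols, and with it the operator, is then zero
  (\<open>dilate_product_zero\<close>). For \<open>|j - k| \<le> 1\<close> the power of \<open>\<delta>\<close> in the claim is bounded below. With
  \<open>r = \<delta> ^ min k j\<close> and \<open>t = r powr \<beta>\<^sub>0\<close> the operator is \<open>G (t L)\<close>, where \<open>G\<close> is one of three smooth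
  functions with compact support in \<open>(0, \<infinity>)\<close>. So everything reduces to a kernel bound for
  \<open>G (t L)\<close> that is uniform in \<open>t \<in> (0, 1]\<close> (\<open>smooth_multiplier_kernel\<close>).

  Put \<open>A = exp (-t L)\<close> and \<open>H s = G (- ln s) / s\<^sup>2\<close>, again a smooth function, so that
  \<open>G (t L) = A H(A) A\<close>. The columns \<open>p\<^sub>t(\<cdot>, y)\<close> of the heat kernel are square integrable and depend
  continuously on \<open>y\<close> by the Hoelder estimate. Therefore \<open>\<langle>H(A) p\<^sub>t(\<cdot>, y), p\<^sub>t(\<cdot>, x)\<rangle>\<close> is a continuous
  kernel of \<open>G (t L)\<close> (\<open>sandwiched_kernel_integral\<close>, \<open>continuous_sandwiched_kernel\<close>); the symmetry of
  \<open>A\<close>, which holds for the heat kernel only up to null sets, enters through \<open>A_reproducing\<close>.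

  For the decay, \<open>H\<close> is expanded on \<open>[0, 1]\<close>, which contains the spectrum of \<open>A\<close>, into Chebyshev
  polynomials with coefficients that decrease faster than any power (\<open>chebyshev_expansion\<close>). The
  \<open>k\<close>-th term of the kernel, divided by the volume factor, obeys two bounds: it is at most a constant, since the polynomials are
  bounded by one, and it is at most \<open>exp (\<lambda> k - \<eta> \<rho>(x,y)/r)\<close>, since composing exponentially
  localized kernels on a doubling space costs one constant per factor
  (\<open>nn_integral_kernel_weight\<close>). The minimum of the two is \<open>O((1 + k)\<^sup>n (1 + \<rho>(x,y)/r)\<^sup>-\<^sup>n)\<close> for every \<open>n\<close>
  (\<open>min_exp_growth_decay\<close>), and the sum over \<open>k\<close> converges.

  The multiplicative functional calculus for bounded functions of a projection-valued measure is
  built along the way. All its identities are checked on quadratic forms, which determine an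
  operator by polarization; existence follows from completeness of \<open>L\<^sup>2\<close>.
\<close>

section \<open>The space of square-integrable functions\<close>

lemma L2_borel [measurable_dest]: "f \<in> L2 \<mu> \<Longrightarrow> f \<in> borel_measurable \<mu>"
  by (simp add: L2_def)

lemma borel_measurable_cnj [measurable]:
  "f \<in> borel_measurable M \<Longrightarrow> (\<lambda>x. cnj (f x)) \<in> borel_measurable M"
  using borel_measurable_continuous_on[OF continuous_on_cnj[OF continuous_on_id], of f M] by simp

lemma L2_square_integrable: "f \<in> L2 \<mu> \<Longrightarrow> integrable \<mu> (\<lambda>x. (cmod (f x))\<^sup>2)"
  by (simp add: L2_def)

lemma L2_bound:
  assumes f: "f \<in> L2 \<mu>" and g: "g \<in> borel_measurable \<mu>"
    and le: "AE x in \<mu>. cmod (g x) \<le> cmod (f x)"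
  shows "g \<in> L2 \<mu>"
proof -
  have "AE x in \<mu>. norm ((cmod (g x))\<^sup>2) \<le> norm ((cmod (f x))\<^sup>2)"
    using le by eventually_elim (simp add: power_mono)
  then show ?thesis
    unfolding L2_def using g
    by (auto intro!: Bochner_Integration.integrable_bound[OF L2_square_integrable[OF f]])
qed

lemma L2_mult_integrable:
  assumes f: "f \<in> L2 \<mu>" and g: "g \<in> L2 \<mu>"
  shows "integrable \<mu> (\<lambda>x. f x * cnj (g x))"
proof (rule Bochner_Integration.integrable_bound)
  show "integrable \<mu> (\<lambda>x. (cmod (f x))\<^sup>2 + (cmod (g x))\<^sup>2)"
    using f g by (simp add: L2_square_integrable)
  show "(\<lambda>x. f x * cnj (g x)) \<in> borel_measurable \<mu>"
    using L2_borel[OF f] L2_borel[OF g] by simp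
  have "a * b \<le> a\<^sup>2 + b\<^sup>2" if "0 \<le> a" "0 \<le> b" for a b :: real
    using sum_squares_bound[of a b] mult_nonneg_nonneg[OF that] by linarith
  then show "AE x in \<mu>. norm (f x * cnj (g x)) \<le> norm ((cmod (f x))\<^sup>2 + (cmod (g x))\<^sup>2)"
    by (simp add: norm_mult)
qed

lemma L2_lincomb:
  assumes f: "f \<in> L2 \<mu>" and g: "g \<in> L2 \<mu>"
  shows "(\<lambda>x. a * f x + b * g x) \<in> L2 \<mu>"
  unfolding L2_def
proof (intro CollectI conjI)
  show [measurable]: "(\<lambda>x. a * f x + b * g x) \<in> borel_measurable \<mu>"
    using L2_borel[OF f] L2_borel[OF g] by measurable
  show "integrable \<mu> (\<lambda>x. (cmod (a * f x + b * g x))\<^sup>2)"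
  proof (rule Bochner_Integration.integrable_bound)
    show "integrable \<mu> (\<lambda>x. 2 * (cmod a)\<^sup>2 * (cmod (f x))\<^sup>2 + 2 * (cmod b)\<^sup>2 * (cmod (g x))\<^sup>2)"
      using f g by (simp add: L2_square_integrable)
    show "AE x in \<mu>. norm ((cmod (a * f x + b * g x))\<^sup>2)
        \<le> norm (2 * (cmod a)\<^sup>2 * (cmod (f x))\<^sup>2 + 2 * (cmod b)\<^sup>2 * (cmod (g x))\<^sup>2)"
    proof (rule AE_I2)
      fix x
      have "(cmod (a * f x + b * g x))\<^sup>2 \<le> (cmod a * cmod (f x) + cmod b * cmod (g x))\<^sup>2"
        by (rule power_mono) (auto intro: order_trans[OF norm_triangle_ineq] simp: norm_mult)
      also have "\<dots> \<le> 2 * (cmod a * cmod (f x))\<^sup>2 + 2 * (cmod b * cmod (g x))\<^sup>2"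
        using sum_squares_bound[of "cmod a * cmod (f x)" "cmod b * cmod (g x)"]
        by (simp add: power2_sum)
      finally show "norm ((cmod (a * f x + b * g x))\<^sup>2)
        \<le> norm (2 * (cmod a)\<^sup>2 * (cmod (f x))\<^sup>2 + 2 * (cmod b)\<^sup>2 * (cmod (g x))\<^sup>2)"
        by (simp add: power_mult_distrib)
    qed
  qed simp
qed

lemma L2_zero [simp]: "(\<lambda>x. 0) \<in> L2 \<mu>"
  by (simp add: L2_def)

lemma L2_scale: "f \<in> L2 \<mu> \<Longrightarrow> (\<lambda>x. a * f x) \<in> L2 \<mu>"
  using L2_lincomb[of f \<mu> f a 0] by simp

lemma L2_add: "f \<in> L2 \<mu> \<Longrightarrow> g \<in> L2 \<mu> \<Longrightarrow> (\<lambda>x. f x + g x) \<in> L2 \<mu>"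
  using L2_lincomb[of f \<mu> g 1 1] by simp

lemma L2_diff: "f \<in> L2 \<mu> \<Longrightarrow> g \<in> L2 \<mu> \<Longrightarrow> (\<lambda>x. f x - g x) \<in> L2 \<mu>"
  using L2_lincomb[of f \<mu> g 1 "-1"] by simp

lemma l2_inner_lincomb_left:
  assumes "f \<in> L2 \<mu>" "g \<in> L2 \<mu>" "h \<in> L2 \<mu>"
  shows "l2_inner \<mu> (\<lambda>x. a * f x + b * g x) h = a * l2_inner \<mu> f h + b * l2_inner \<mu> g h"
  using L2_mult_integrable[of f \<mu> h] L2_mult_integrable[of g \<mu> h] assms
  by (simp add: l2_inner_def ring_distribs mult.assoc)

lemma cnj_l2_inner: "cnj (l2_inner \<mu> f g) = l2_inner \<mu> g f"
  unfolding l2_inner_def Bochner_Integration.integral_cnj[symmetric] complex_cnj_mult complex_cnj_cnj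
  by (simp only: mult.commute)

lemma l2_inner_lincomb_right:
  assumes "f \<in> L2 \<mu>" "g \<in> L2 \<mu>" "h \<in> L2 \<mu>"
  shows "l2_inner \<mu> h (\<lambda>x. a * f x + b * g x)
    = cnj a * l2_inner \<mu> h f + cnj b * l2_inner \<mu> h g"
  using arg_cong[OF l2_inner_lincomb_left[OF assms, of a b], of cnj]
  by (simp add: cnj_l2_inner)

lemma l2_inner_diff_left:
  assumes "f \<in> L2 \<mu>" "g \<in> L2 \<mu>" "h \<in> L2 \<mu>"
  shows "l2_inner \<mu> (\<lambda>x. f x - g x) h = l2_inner \<mu> f h - l2_inner \<mu> g h"
  using l2_inner_lincomb_left[OF assms, of 1 "-1"] by simp

lemma l2_inner_diff_right:
  assumes "f \<in> L2 \<mu>" "g \<in> L2 \<mu>" "h \<in> L2 \<mu>"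
  shows "l2_inner \<mu> h (\<lambda>x. f x - g x) = l2_inner \<mu> h f - l2_inner \<mu> h g"
  using l2_inner_lincomb_right[OF assms, of 1 "-1"] by simp

lemma l2_inner_cong:
  assumes "AE x in \<mu>. f x = f' x" "AE x in \<mu>. g x = g' x"
    "f \<in> L2 \<mu>" "g \<in> L2 \<mu>" "f' \<in> L2 \<mu>" "g' \<in> L2 \<mu>"
  shows "l2_inner \<mu> f g = l2_inner \<mu> f' g'"
  unfolding l2_inner_def
proof (rule integral_cong_AE)
  show "(\<lambda>x. f x * cnj (g x)) \<in> borel_measurable \<mu>" "(\<lambda>x. f' x * cnj (g' x)) \<in> borel_measurable \<mu>"
    using assms(3-6)[THEN L2_borel] by simp_all
  show "AE x in \<mu>. f x * cnj (g x) = f' x * cnj (g' x)"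
    using assms(1,2) by eventually_elim simp
qed

lemma l2_norm_nonneg [simp]: "0 \<le> l2_norm \<mu> f"
  by (simp add: l2_norm_def)

lemma l2_norm_square: "(l2_norm \<mu> f)\<^sup>2 = (\<integral>x. (cmod (f x))\<^sup>2 \<partial>\<mu>)"
  by (simp add: l2_norm_def)

lemma l2_inner_self: "l2_inner \<mu> f f = complex_of_real ((l2_norm \<mu> f)\<^sup>2)"
  by (simp add: l2_norm_square l2_inner_def complex_norm_square[symmetric] del: of_real_power)

lemma l2_norm_eq_0_iff:
  assumes "f \<in> L2 \<mu>"
  shows "l2_norm \<mu> f = 0 \<longleftrightarrow> (AE x in \<mu>. f x = 0)"
  using integral_nonneg_eq_0_iff_AE[OF L2_square_integrable[OF assms]]
  by (simp add: l2_norm_def)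

lemma l2_norm_lincomb_square:
  assumes "f \<in> L2 \<mu>" "g \<in> L2 \<mu>"
  shows "(l2_norm \<mu> (\<lambda>x. a * f x + b * g x))\<^sup>2
    = (cmod a)\<^sup>2 * (l2_norm \<mu> f)\<^sup>2 + 2 * Re (a * cnj b * l2_inner \<mu> f g)
      + (cmod b)\<^sup>2 * (l2_norm \<mu> g)\<^sup>2"
proof -
  let ?h = "\<lambda>x. a * f x + b * g x"
  have h: "?h \<in> L2 \<mu>" using assms by (rule L2_lincomb)
  have "l2_inner \<mu> ?h ?h = a * (cnj a * l2_inner \<mu> f f + cnj b * l2_inner \<mu> f g)
      + b * (cnj a * l2_inner \<mu> g f + cnj b * l2_inner \<mu> g g)"
    by (simp add: l2_inner_lincomb_left[OF assms h] l2_inner_lincomb_right[OF assms] assms)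
  also have "\<dots> = (a * cnj a) * l2_inner \<mu> f f
      + (a * cnj b * l2_inner \<mu> f g + cnj (a * cnj b * l2_inner \<mu> f g)) + (b * cnj b) * l2_inner \<mu> g g"
    by (simp add: cnj_l2_inner algebra_simps)
  finally show ?thesis
    unfolding l2_inner_self complex_norm_square[symmetric] complex_add_cnj
    by (metis (mono_tags, lifting) of_real_add of_real_eq_iff of_real_mult)
qed

lemma l2_norm_scale: "l2_norm \<mu> (\<lambda>x. a * f x) = cmod a * l2_norm \<mu> f"
  by (simp add: l2_norm_def norm_mult power_mult_distrib real_sqrt_mult)

lemma l2_norm_minus_commute: "l2_norm \<mu> (\<lambda>x. f x - g x) = l2_norm \<mu> (\<lambda>x. g x - f x)"
  by (simp add: l2_norm_def norm_minus_commute)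

lemma l2_Cauchy_Schwarz:
  assumes f: "f \<in> L2 \<mu>" and g: "g \<in> L2 \<mu>"
  shows "cmod (l2_inner \<mu> f g) \<le> l2_norm \<mu> f * l2_norm \<mu> g"
proof (cases "l2_norm \<mu> g = 0")
  case True
  then have "AE x in \<mu>. g x = 0" using l2_norm_eq_0_iff[OF g] by simp
  then have "l2_inner \<mu> f g = l2_inner \<mu> f (\<lambda>x. 0)"
    using f g by (intro l2_inner_cong) auto
  then show ?thesis by (simp add: l2_inner_def)
next
  case False
  define z B where "z = l2_inner \<mu> f g" and "B = (l2_norm \<mu> g)\<^sup>2"
  have B: "B > 0" using False by (simp add: B_def)
  have "0 \<le> (l2_norm \<mu> (\<lambda>x. of_real B * f x + (- z) * g x))\<^sup>2" by simp
  also have "\<dots> = B\<^sup>2 * (l2_norm \<mu> f)\<^sup>2 + 2 * Re (of_real B * cnj (- z) * z) + (cmod z)\<^sup>2 * B"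
    by (simp only: l2_norm_lincomb_square[OF f g] z_def[symmetric] B_def[symmetric]
        norm_of_real norm_minus_cancel power2_abs)
  also have "of_real B * cnj (- z) * z = complex_of_real (- B * (cmod z)\<^sup>2)"
    by (simp only: of_real_mult of_real_minus complex_norm_square complex_cnj_minus mult_minus_left mult_minus_right mult.assoc mult.commute[of z])
  also have "B\<^sup>2 * (l2_norm \<mu> f)\<^sup>2 + 2 * Re (complex_of_real (- B * (cmod z)\<^sup>2)) + (cmod z)\<^sup>2 * B
     = B * (B * (l2_norm \<mu> f)\<^sup>2 - (cmod z)\<^sup>2)"
    unfolding Re_complex_of_real by (simp add: power2_eq_square algebra_simps)
  finally have "(cmod z)\<^sup>2 \<le> (l2_norm \<mu> f * l2_norm \<mu> g)\<^sup>2"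
    using B by (simp add: zero_le_mult_iff B_def power_mult_distrib mult.commute)
  then show ?thesis unfolding z_def by (rule power2_le_imp_le) simp
qed

lemma l2_norm_triangle:
  assumes f: "f \<in> L2 \<mu>" and g: "g \<in> L2 \<mu>"
  shows "l2_norm \<mu> (\<lambda>x. f x + g x) \<le> l2_norm \<mu> f + l2_norm \<mu> g"
proof (rule power2_le_imp_le)
  have "Re (l2_inner \<mu> f g) \<le> l2_norm \<mu> f * l2_norm \<mu> g"
    using l2_Cauchy_Schwarz[OF f g] complex_Re_le_cmod order_trans by blast
  then show "(l2_norm \<mu> (\<lambda>x. f x + g x))\<^sup>2 \<le> (l2_norm \<mu> f + l2_norm \<mu> g)\<^sup>2"
    using l2_norm_lincomb_square[OF f g, of 1 1] by (simp add: power2_sum)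
qed simp

lemma l2_norm_triangle_diff:
  assumes "f \<in> L2 \<mu>" "g \<in> L2 \<mu>" "h \<in> L2 \<mu>"
  shows "l2_norm \<mu> (\<lambda>x. f x - h x) \<le> l2_norm \<mu> (\<lambda>x. f x - g x) + l2_norm \<mu> (\<lambda>x. g x - h x)"
  using l2_norm_triangle[OF L2_diff[OF assms(1,2)] L2_diff[OF assms(2,3)]] by simp

lemma nn_integral_cmod_square:
  assumes "f \<in> L2 \<mu>"
  shows "(\<integral>\<^sup>+x. ennreal ((cmod (f x))\<^sup>2) \<partial>\<mu>) = ennreal ((l2_norm \<mu> f)\<^sup>2)"
  unfolding l2_norm_square by (rule nn_integral_eq_integral) (auto simp: L2_square_integrable assms)

lemma L2_of_nn_integral:
  assumes "f \<in> borel_measurable \<mu>" "(\<integral>\<^sup>+x. ennreal ((cmod (f x))\<^sup>2) \<partial>\<mu>) \<le> ennreal (b\<^sup>2)" "0 \<le> b"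
  shows "f \<in> L2 \<mu>" "l2_norm \<mu> f \<le> b"
proof -
  show f: "f \<in> L2 \<mu>"
    unfolding L2_def using assms(1,2)
    by (auto intro!: integrableI_bounded simp: le_less_trans[OF _ ennreal_less_top])
  have "(l2_norm \<mu> f)\<^sup>2 \<le> b\<^sup>2"
    using assms(2) unfolding nn_integral_cmod_square[OF f] by (simp add: ennreal_le_iff)
  then show "l2_norm \<mu> f \<le> b" using assms(3) by (rule power2_le_imp_le)
qed

lemma l2_eq_AE_of_inner:
  assumes "f \<in> L2 \<mu>" "g \<in> L2 \<mu>" "\<And>h. h \<in> L2 \<mu> \<Longrightarrow> l2_inner \<mu> f h = l2_inner \<mu> g h"
  shows "AE x in \<mu>. f x = g x"
proof -
  have d: "(\<lambda>x. f x - g x) \<in> L2 \<mu>" using assms(1,2) by (rule L2_diff)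
  have "l2_inner \<mu> (\<lambda>x. f x - g x) (\<lambda>x. f x - g x) = 0"
    by (subst l2_inner_diff_left) (use assms d in auto)
  then have "AE x in \<mu>. f x - g x = 0"
    using l2_norm_eq_0_iff[OF d] by (simp add: l2_inner_self)
  then show ?thesis by simp
qed

text \<open>Riesz--Fischer for sequences with geometrically small increments. Since
  \<open>\<Sum> 2\<^sup>n |F\<^sub>n\<^sub>+\<^sub>1 - F\<^sub>n|\<^sup>2\<close> has a finite integral, almost everywhere the increments are eventually
  at most \<open>2 powr (-n/2)\<close>; hence the sequence converges pointwise almost everywhere, and Fatou's
  lemma upgrades this to convergence in norm.\<close>

lemma L2_complete:
  fixes F :: "nat \<Rightarrow> 'a \<Rightarrow> complex" and c :: real
  assumes F: "\<And>n. F n \<in> L2 \<mu>"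
    and inc: "\<And>n. l2_norm \<mu> (\<lambda>x. F (Suc n) x - F n x) \<le> c * (1/2) ^ n" and c: "0 \<le> c"
  shows "\<exists>h\<in>L2 \<mu>. (\<lambda>n. l2_norm \<mu> (\<lambda>x. F n x - h x)) \<longlonglongrightarrow> 0"
proof -
  have [measurable]: "F n \<in> borel_measurable \<mu>" for n using F L2_borel by blast
  have D: "(\<lambda>x. F m x - F n x) \<in> L2 \<mu>" for m n using F by (intro L2_diff)
  have cauchy: "l2_norm \<mu> (\<lambda>x. F (n + m) x - F n x) \<le> 2 * c * (1/2) ^ n - 2 * c * (1/2) ^ (n + m)" for n m
  proof (induction m)
    case 0
    show ?case by (simp add: l2_norm_def)
  next
    case (Suc m)
    have "2 * c * (1/2) ^ (n + Suc m) = c * (1/2) ^ (n + m)" by simp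
    moreover have "l2_norm \<mu> (\<lambda>x. F (n + Suc m) x - F (n + m) x) \<le> c * (1/2) ^ (n + m)"
      using inc[of "n + m"] by simp
    ultimately show ?case
      using l2_norm_triangle_diff[OF F[of "n + Suc m"] F[of "n + m"] F[of n]] Suc by linarith
  qed
  define h where "h x = lim (\<lambda>n. F n x)" for x
  have h [measurable]: "h \<in> borel_measurable \<mu>" unfolding h_def by measurable
  have "(\<integral>\<^sup>+x. (\<Sum>n. ennreal (2 ^ n * (cmod (F (Suc n) x - F n x))\<^sup>2)) \<partial>\<mu>)
      = (\<Sum>n. ennreal (2 ^ n) * (\<integral>\<^sup>+x. ennreal ((cmod (F (Suc n) x - F n x))\<^sup>2) \<partial>\<mu>))"
    by (subst nn_integral_suminf) (auto simp: ennreal_mult' nn_integral_cmult)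
  also have "\<dots> \<le> (\<Sum>n. ennreal (c\<^sup>2 * (1/2) ^ n))"
  proof (intro suminf_le summableI)
    fix n
    have "(l2_norm \<mu> (\<lambda>x. F (Suc n) x - F n x))\<^sup>2 \<le> (c * (1/2) ^ n)\<^sup>2"
      by (rule power_mono[OF inc]) simp
    then have "2 ^ n * (l2_norm \<mu> (\<lambda>x. F (Suc n) x - F n x))\<^sup>2 \<le> 2 ^ n * (c * (1/2) ^ n)\<^sup>2"
      by (intro mult_left_mono) auto
    also have "\<dots> = c\<^sup>2 * (1/2) ^ n" by (simp add: power2_eq_square power_divide)
    finally show "ennreal (2 ^ n) * (\<integral>\<^sup>+x. ennreal ((cmod (F (Suc n) x - F n x))\<^sup>2) \<partial>\<mu>) \<le> ennreal (c\<^sup>2 * (1/2) ^ n)"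
      unfolding nn_integral_cmod_square[OF D]
      by (subst ennreal_mult'[symmetric]) (auto intro!: ennreal_leI)
  qed
  also have "\<dots> = ennreal (\<Sum>n. c\<^sup>2 * (1/2) ^ n)"
    by (rule suminf_ennreal2) (auto intro!: summable_mult summable_geometric)
  finally have "(\<integral>\<^sup>+x. (\<Sum>n. ennreal (2 ^ n * (cmod (F (Suc n) x - F n x))\<^sup>2)) \<partial>\<mu>) < \<infinity>"
    by (simp add: le_less_trans)
  then have "AE x in \<mu>. (\<Sum>n. ennreal (2 ^ n * (cmod (F (Suc n) x - F n x))\<^sup>2)) \<noteq> \<infinity>"
    by (intro nn_integral_PInf_AE) auto
  then have lim: "AE x in \<mu>. (\<lambda>n. F n x) \<longlonglongrightarrow> h x"
  proof eventually_elim
    case (elim x)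
    let ?d = "\<lambda>n. cmod (F (Suc n) x - F n x)"
    have "summable (\<lambda>n. 2 ^ n * (?d n)\<^sup>2)"
      using elim by (intro summable_suminf_not_top) auto
    then have "(\<lambda>n. 2 ^ n * (?d n)\<^sup>2) \<longlonglongrightarrow> 0" by (rule summable_LIMSEQ_zero)
    then have "eventually (\<lambda>n. 2 ^ n * (?d n)\<^sup>2 < 1) sequentially"
      by (rule order_tendstoD) simp
    then have "eventually (\<lambda>n. norm (?d n) \<le> (sqrt (1/2)) ^ n) sequentially"
    proof eventually_elim
      case (elim n)
      have "(?d n)\<^sup>2 \<le> (1/2) ^ n" using elim by (simp add: field_simps power_divide)
      also have "\<dots> = ((sqrt (1/2)) ^ n)\<^sup>2" by (simp add: power2_eq_square flip: power_mult_distrib)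
      finally have "?d n \<le> sqrt (1/2) ^ n" by (rule power2_le_imp_le) simp
      then show ?case by simp
    qed
    then have "summable ?d"
      by (rule summable_comparison_test_ev) (rule summable_geometric, simp)
    then have "summable (\<lambda>n. F (Suc n) x - F n x)" by (rule summable_norm_cancel)
    then obtain s where "(\<lambda>n. \<Sum>k<n. F (Suc k) x - F k x) \<longlonglongrightarrow> s"
      by (auto simp: summable_def sums_def)
    then have "(\<lambda>n. (F n x - F 0 x) + F 0 x) \<longlonglongrightarrow> s + F 0 x"
      unfolding sum_lessThan_telescope[of "\<lambda>k. F k x"] by (intro tendsto_intros)
    then have "convergent (\<lambda>n. F n x)" by (auto simp: convergent_def)
    then show ?case unfolding h_def by (simp add: convergent_LIMSEQ_iff)
  qed
  have est: "(\<lambda>x. F n x - h x) \<in> L2 \<mu> \<and> l2_norm \<mu> (\<lambda>x. F n x - h x) \<le> 2 * c * (1/2) ^ n" for n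
  proof -
    have "(\<integral>\<^sup>+x. ennreal ((cmod (F n x - h x))\<^sup>2) \<partial>\<mu>)
        \<le> (\<integral>\<^sup>+x. liminf (\<lambda>m. ennreal ((cmod (F n x - F m x))\<^sup>2)) \<partial>\<mu>)"
    proof (rule nn_integral_mono_AE, use lim in eventually_elim)
      case (elim x)
      have "(\<lambda>m. ennreal ((cmod (F n x - F m x))\<^sup>2)) \<longlonglongrightarrow> ennreal ((cmod (F n x - h x))\<^sup>2)"
        using elim by (intro tendsto_intros)
      from lim_imp_Liminf[OF trivial_limit_sequentially this] show ?case by (simp only: order_refl)
    qed
    also have "\<dots> \<le> liminf (\<lambda>m. \<integral>\<^sup>+x. ennreal ((cmod (F n x - F m x))\<^sup>2) \<partial>\<mu>)"
      by (rule nn_integral_liminf) measurable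
    also have "\<dots> \<le> ennreal ((2 * c * (1/2) ^ n)\<^sup>2)"
    proof (rule Liminf_le)
      show "eventually (\<lambda>m. (\<integral>\<^sup>+x. ennreal ((cmod (F n x - F m x))\<^sup>2) \<partial>\<mu>) \<le> ennreal ((2 * c * (1/2) ^ n)\<^sup>2)) sequentially"
      proof (rule eventually_sequentiallyI[of n])
        fix m assume "n \<le> m"
        then obtain k where k: "m = n + k" using le_Suc_ex by blast
        have "l2_norm \<mu> (\<lambda>x. F n x - F m x) \<le> 2 * c * (1/2) ^ n"
          using cauchy[of n k] c by (subst l2_norm_minus_commute) (simp add: k order_trans)
        then show "(\<integral>\<^sup>+x. ennreal ((cmod (F n x - F m x))\<^sup>2) \<partial>\<mu>) \<le> ennreal ((2 * c * (1/2) ^ n)\<^sup>2)"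
          unfolding nn_integral_cmod_square[OF D] by (intro ennreal_leI power_mono) auto
      qed
    qed simp
    finally have le: "(\<integral>\<^sup>+x. ennreal ((cmod (F n x - h x))\<^sup>2) \<partial>\<mu>) \<le> ennreal ((2 * c * (1/2) ^ n)\<^sup>2)" .
    have "(\<lambda>x. F n x - h x) \<in> borel_measurable \<mu>" "0 \<le> 2 * c * (1/2) ^ n" using c by simp_all
    from L2_of_nn_integral[OF this(1) le this(2)] show ?thesis ..
  qed
  have "h \<in> L2 \<mu>"
    using L2_diff[OF F est[THEN conjunct1], of 0 0] by simp
  moreover have "(\<lambda>n. l2_norm \<mu> (\<lambda>x. F n x - h x)) \<longlonglongrightarrow> 0"
  proof (rule tendsto_sandwich[OF _ _ tendsto_const])
    show "(\<lambda>n. 2 * c * (1/2) ^ n :: real) \<longlonglongrightarrow> 0"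
      by (rule tendsto_mult_right_zero) (simp add: LIMSEQ_power_zero)
    show "eventually (\<lambda>n. l2_norm \<mu> (\<lambda>x. F n x - h x) \<le> 2 * c * (1/2) ^ n) sequentially"
      using est by (intro always_eventually allI) blast
  qed simp
  ultimately show ?thesis by blast
qed

section \<open>Sesquilinear forms and everywhere defined operators\<close>

definition sesquilinear ::
  "'a measure \<Rightarrow> (('a \<Rightarrow> complex) \<Rightarrow> ('a \<Rightarrow> complex) \<Rightarrow> complex) \<Rightarrow> bool" where
  "sesquilinear \<mu> b \<longleftrightarrow> (\<forall>f\<in>L2 \<mu>. \<forall>g\<in>L2 \<mu>. \<forall>h\<in>L2 \<mu>. \<forall>\<alpha> \<gamma>.
     b (\<lambda>x. \<alpha> * f x + \<gamma> * g x) h = \<alpha> * b f h + \<gamma> * b g h \<and>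
     b h (\<lambda>x. \<alpha> * f x + \<gamma> * g x) = cnj \<alpha> * b h f + cnj \<gamma> * b h g)"

text \<open>The four values of the quadratic form at \<open>f + \<omega> g\<close>, \<open>\<omega>\<^sup>4 = 1\<close>, are weighted so that only the
  coefficient of \<open>cnj \<omega>\<close> survives.\<close>

lemma polarization:
  assumes b: "sesquilinear \<mu> b" and f: "f \<in> L2 \<mu>" and g: "g \<in> L2 \<mu>"
  defines "q \<equiv> \<lambda>\<omega>. b (\<lambda>x. f x + \<omega> * g x) (\<lambda>x. f x + \<omega> * g x)"
  shows "4 * b f g = q 1 - q (- 1) + \<i> * q \<i> - \<i> * q (- \<i>)"
proof -
  have "q \<omega> = b f f + \<omega> * b g f + cnj \<omega> * b f g + \<omega> * cnj \<omega> * b g g" for \<omega>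
  proof -
    have h: "(\<lambda>x. 1 * f x + \<omega> * g x) \<in> L2 \<mu>" using f g by (rule L2_lincomb)
    have "q \<omega> = b (\<lambda>x. 1 * f x + \<omega> * g x) (\<lambda>x. 1 * f x + \<omega> * g x)" by (simp add: q_def)
    also have "\<dots> = 1 * b f (\<lambda>x. 1 * f x + \<omega> * g x) + \<omega> * b g (\<lambda>x. 1 * f x + \<omega> * g x)"
      using b f g h unfolding sesquilinear_def by blast
    also have "b f (\<lambda>x. 1 * f x + \<omega> * g x) = cnj 1 * b f f + cnj \<omega> * b f g"
      using b f g unfolding sesquilinear_def by blast
    also have "b g (\<lambda>x. 1 * f x + \<omega> * g x) = cnj 1 * b g f + cnj \<omega> * b g g"
      using b f g unfolding sesquilinear_def by blast
    finally show ?thesis by (simp add: algebra_simps)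
  qed
  then show ?thesis by (simp add: algebra_simps)
qed

lemma sesquilinear_eqI:
  assumes b: "sesquilinear \<mu> b" and b': "sesquilinear \<mu> b'"
    and diag: "\<And>f. f \<in> L2 \<mu> \<Longrightarrow> b f f = b' f f"
    and f: "f \<in> L2 \<mu>" and g: "g \<in> L2 \<mu>"
  shows "b f g = b' f g"
proof -
  have h: "(\<lambda>x. f x + \<omega> * g x) \<in> L2 \<mu>" for \<omega> using L2_lincomb[OF f g, of 1 \<omega>] by simp
  have "4 * b f g = 4 * b' f g"
    unfolding polarization[OF b f g] polarization[OF b' f g] by (simp only: diag[OF h])
  then show ?thesis by simp
qed

text \<open>A bound on the quadratic form passes to the sesquilinear form through polarization; the four
  squared norms add up by the parallelogram law.\<close>

lemma sesquilinear_bound: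
  assumes b: "sesquilinear \<mu> b"
    and diag: "\<And>f. f \<in> L2 \<mu> \<Longrightarrow> cmod (b f f) \<le> B * (l2_norm \<mu> f)\<^sup>2"
    and f: "f \<in> L2 \<mu>" and g: "g \<in> L2 \<mu>"
  shows "cmod (b f g) \<le> B * ((l2_norm \<mu> f)\<^sup>2 + (l2_norm \<mu> g)\<^sup>2)"
proof -
  let ?h = "\<lambda>\<omega> x. f x + \<omega> * g x"
  let ?q = "\<lambda>\<omega>. b (?h \<omega>) (?h \<omega>)"
  have h: "?h \<omega> \<in> L2 \<mu>" for \<omega> using L2_lincomb[OF f g, of 1 \<omega>] by simp
  have N: "(l2_norm \<mu> (?h \<omega>))\<^sup>2
      = (l2_norm \<mu> f)\<^sup>2 + 2 * Re (cnj \<omega> * l2_inner \<mu> f g) + (cmod \<omega>)\<^sup>2 * (l2_norm \<mu> g)\<^sup>2" for \<omega>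
    using l2_norm_lincomb_square[OF f g, of 1 \<omega>] by simp
  have "4 * cmod (b f g) = cmod (4 * b f g)" by (simp add: norm_mult)
  also have "\<dots> = cmod ((?q 1 - ?q (- 1)) + (\<i> * ?q \<i> - \<i> * ?q (- \<i>)))"
    unfolding polarization[OF b f g] by (simp only: add_diff_eq)
  also have "\<dots> \<le> (cmod (?q 1) + cmod (?q (- 1))) + (cmod (\<i> * ?q \<i>) + cmod (\<i> * ?q (- \<i>)))"
    by (intro order_trans[OF norm_triangle_ineq] add_mono norm_triangle_ineq4)
  also have "\<dots> = (cmod (?q 1) + cmod (?q (- 1))) + (cmod (?q \<i>) + cmod (?q (- \<i>)))"
    by (simp only: norm_mult norm_ii mult_1_left)
  also have "\<dots> \<le> (B * (l2_norm \<mu> (?h 1))\<^sup>2 + B * (l2_norm \<mu> (?h (- 1)))\<^sup>2)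
      + (B * (l2_norm \<mu> (?h \<i>))\<^sup>2 + B * (l2_norm \<mu> (?h (- \<i>)))\<^sup>2)"
    by (intro add_mono diag h)
  also have "\<dots> = 4 * (B * ((l2_norm \<mu> f)\<^sup>2 + (l2_norm \<mu> g)\<^sup>2))"
    unfolding N by (simp add: algebra_simps)
  finally show ?thesis by simp
qed

abbreviation L2_operator ::
  "'a measure \<Rightarrow> (('a \<Rightarrow> complex) \<Rightarrow> ('a \<Rightarrow> complex)) \<Rightarrow> bool" where
  "L2_operator \<mu> T \<equiv> linear_operator \<mu> (L2 \<mu>) T"

lemma L2_operator_range: "L2_operator \<mu> T \<Longrightarrow> f \<in> L2 \<mu> \<Longrightarrow> T f \<in> L2 \<mu>"
  by (simp add: linear_operator_def)

lemma L2_operator_cong: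
  "L2_operator \<mu> T \<Longrightarrow> f \<in> L2 \<mu> \<Longrightarrow> g \<in> L2 \<mu> \<Longrightarrow> AE x in \<mu>. f x = g x \<Longrightarrow> AE x in \<mu>. T f x = T g x"
  by (auto simp: linear_operator_def)

lemma L2_operator_lincomb:
  "L2_operator \<mu> T \<Longrightarrow> f \<in> L2 \<mu> \<Longrightarrow> g \<in> L2 \<mu> \<Longrightarrow>
    AE x in \<mu>. T (\<lambda>x. a * f x + b * g x) x = a * T f x + b * T g x"
  by (auto simp: linear_operator_def)

lemma L2_operatorI:
  assumes "\<And>f. f \<in> L2 \<mu> \<Longrightarrow> T f \<in> L2 \<mu>"
    and "\<And>f g. f \<in> L2 \<mu> \<Longrightarrow> g \<in> L2 \<mu> \<Longrightarrow> AE x in \<mu>. f x = g x \<Longrightarrow> AE x in \<mu>. T f x = T g x"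
    and "\<And>f g a b. f \<in> L2 \<mu> \<Longrightarrow> g \<in> L2 \<mu> \<Longrightarrow>
      AE x in \<mu>. T (\<lambda>x. a * f x + b * g x) x = a * T f x + b * T g x"
  shows "L2_operator \<mu> T"
  unfolding linear_operator_def using assms by (auto intro: L2_lincomb)

lemma L2_operator_inner_lincomb:
  assumes T: "L2_operator \<mu> T" and f: "f \<in> L2 \<mu>" and g: "g \<in> L2 \<mu>" and h: "h \<in> L2 \<mu>"
  shows "l2_inner \<mu> (T (\<lambda>x. a * f x + b * g x)) h = a * l2_inner \<mu> (T f) h + b * l2_inner \<mu> (T g) h"
proof -
  note TL = L2_operator_range[OF T]
  have "l2_inner \<mu> (T (\<lambda>x. a * f x + b * g x)) h = l2_inner \<mu> (\<lambda>x. a * T f x + b * T g x) h"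
    using T f g h by (intro l2_inner_cong L2_operator_lincomb TL L2_lincomb) auto
  then show ?thesis using l2_inner_lincomb_left[OF TL[OF f] TL[OF g] h] by simp
qed

lemma L2_operator_inner_cong:
  assumes T: "L2_operator \<mu> T" and "f \<in> L2 \<mu>" "g \<in> L2 \<mu>" "h \<in> L2 \<mu>" "AE x in \<mu>. f x = g x"
  shows "l2_inner \<mu> (T f) h = l2_inner \<mu> (T g) h"
  using assms by (intro l2_inner_cong L2_operator_cong[OF T] L2_operator_range[OF T]) auto

lemma L2_operator_combination:
  assumes S: "L2_operator \<mu> S" and T: "L2_operator \<mu> T"
  shows "L2_operator \<mu> (\<lambda>f x. a * S f x + b * T f x)"
proof (rule L2_operatorI)
  fix f g assume fg: "f \<in> L2 \<mu>" "g \<in> L2 \<mu>"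
  show "(\<lambda>x. a * S f x + b * T f x) \<in> L2 \<mu>"
    by (rule L2_lincomb[OF L2_operator_range[OF S fg(1)] L2_operator_range[OF T fg(1)]])
  show "AE x in \<mu>. a * S f x + b * T f x = a * S g x + b * T g x" if "AE x in \<mu>. f x = g x"
    using L2_operator_cong[OF S fg that] L2_operator_cong[OF T fg that] by eventually_elim simp
  show "AE x in \<mu>. a * S (\<lambda>x. a' * f x + b' * g x) x + b * T (\<lambda>x. a' * f x + b' * g x) x
      = a' * (a * S f x + b * T f x) + b' * (a * S g x + b * T g x)" for a' b'
    using L2_operator_lincomb[OF S fg, of a' b'] L2_operator_lincomb[OF T fg, of a' b']
    by eventually_elim (simp add: algebra_simps)
qed

lemma L2_operator_comp:
  assumes S: "L2_operator \<mu> S" and T: "L2_operator \<mu> T"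
  shows "L2_operator \<mu> (\<lambda>f. S (T f))"
proof (rule L2_operatorI)
  note SL = L2_operator_range[OF S] and TL = L2_operator_range[OF T]
  fix f g assume fg: "f \<in> L2 \<mu>" "g \<in> L2 \<mu>"
  show "S (T f) \<in> L2 \<mu>" using fg by (intro SL TL)
  show "AE x in \<mu>. S (T f) x = S (T g) x" if "AE x in \<mu>. f x = g x"
    by (rule L2_operator_cong[OF S TL[OF fg(1)] TL[OF fg(2)] L2_operator_cong[OF T fg that]])
  show "AE x in \<mu>. S (T (\<lambda>x. a * f x + b * g x)) x = a * S (T f) x + b * S (T g) x" for a b
  proof -
    have "AE x in \<mu>. S (T (\<lambda>x. a * f x + b * g x)) x = S (\<lambda>x. a * T f x + b * T g x) x"
      by (intro L2_operator_cong[OF S] TL L2_lincomb fg L2_operator_lincomb[OF T])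
    with L2_operator_lincomb[OF S TL[OF fg(1)] TL[OF fg(2)], of a b]
    show ?thesis by eventually_elim simp
  qed
qed

lemma L2_operator_sesquilinear:
  assumes "L2_operator \<mu> T"
  shows "sesquilinear \<mu> (\<lambda>f g. l2_inner \<mu> (T f) g)"
  unfolding sesquilinear_def
  using assms by (auto simp: L2_operator_inner_lincomb l2_inner_lincomb_right L2_operator_range)

lemma L2_operator_sesquilinear':
  assumes "L2_operator \<mu> T"
  shows "sesquilinear \<mu> (\<lambda>f g. l2_inner \<mu> f (T g))"
  unfolding sesquilinear_def
proof (intro ballI allI conjI)
  fix f g h a c assume L: "f \<in> L2 \<mu>" "g \<in> L2 \<mu>" "h \<in> L2 \<mu>"
  show "l2_inner \<mu> (\<lambda>x. a * f x + c * g x) (T h) = a * l2_inner \<mu> f (T h) + c * l2_inner \<mu> g (T h)"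
    using L assms by (simp add: l2_inner_lincomb_left L2_operator_range)
  show "l2_inner \<mu> h (T (\<lambda>x. a * f x + c * g x))
      = cnj a * l2_inner \<mu> h (T f) + cnj c * l2_inner \<mu> h (T g)"
    using arg_cong[OF L2_operator_inner_lincomb[OF assms L, of a c], of cnj] by (simp add: cnj_l2_inner)
qed

text \<open>An operator on a complex Hilbert space is determined by its quadratic form. Every identity of
  the functional calculus below is obtained by comparing quadratic forms.\<close>

lemma L2_operator_eq_AE:
  assumes S: "L2_operator \<mu> S" and T: "L2_operator \<mu> T"
    and diag: "\<And>f. f \<in> L2 \<mu> \<Longrightarrow> l2_inner \<mu> (S f) f = l2_inner \<mu> (T f) f"
    and f: "f \<in> L2 \<mu>"
  shows "AE x in \<mu>. S f x = T f x"
proof (rule l2_eq_AE_of_inner)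
  show "S f \<in> L2 \<mu>" "T f \<in> L2 \<mu>" using S T f by (auto intro: L2_operator_range)
  show "l2_inner \<mu> (S f) h = l2_inner \<mu> (T f) h" if "h \<in> L2 \<mu>" for h
    using sesquilinear_eqI[OF L2_operator_sesquilinear[OF S] L2_operator_sesquilinear[OF T] diag f that] .
qed

text \<open>The operator norm is at most twice the numerical radius: test the polarized bound
  \<open>|\<langle>Tf, g\<rangle>| \<le> B (|f|\<^sup>2 + |g|\<^sup>2)\<close> with \<open>g = Tf / (2B)\<close>.\<close>

lemma L2_operator_norm_bound:
  assumes T: "L2_operator \<mu> T" and B: "0 \<le> B"
    and diag: "\<And>f. f \<in> L2 \<mu> \<Longrightarrow> cmod (l2_inner \<mu> (T f) f) \<le> B * (l2_norm \<mu> f)\<^sup>2"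
    and f: "f \<in> L2 \<mu>"
  shows "l2_norm \<mu> (T f) \<le> 2 * B * l2_norm \<mu> f"
proof -
  have Tf: "T f \<in> L2 \<mu>" using T f by (rule L2_operator_range)
  have bound: "cmod (l2_inner \<mu> (T f) g) \<le> B * ((l2_norm \<mu> f)\<^sup>2 + (l2_norm \<mu> g)\<^sup>2)"
    if "g \<in> L2 \<mu>" for g
    using diag by (rule sesquilinear_bound[OF L2_operator_sesquilinear[OF T] _ f that])
  show ?thesis
  proof (cases "B = 0")
    case True
    then show ?thesis using bound[OF Tf] by (simp add: l2_inner_self)
  next
    case False
    then have "B > 0" using B by simp
    define l where "l = 1 / (2 * B)"
    let ?N = "(l2_norm \<mu> (T f))\<^sup>2" and ?F = "(l2_norm \<mu> f)\<^sup>2"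
    have "l2_inner \<mu> (T f) (\<lambda>x. of_real l * T f x) = of_real (l * ?N)"
      using l2_inner_lincomb_right[OF Tf Tf Tf, of "of_real l" 0] by (simp add: l2_inner_self)
    moreover have "l2_norm \<mu> (\<lambda>x. of_real l * T f x) = l * l2_norm \<mu> (T f)"
      unfolding l2_norm_scale using \<open>B > 0\<close> by (simp add: l_def norm_divide norm_mult)
    ultimately have "\<bar>l * ?N\<bar> \<le> B * (?F + l\<^sup>2 * ?N)"
      using bound[OF L2_scale[OF Tf, of "of_real l"]] by (simp only: norm_of_real power_mult_distrib)
    then have "l * ?N \<le> B * (?F + l\<^sup>2 * ?N)" by linarith
    also have "\<dots> = B * ?F + l * ?N / 2"
      using \<open>B > 0\<close> by (simp add: l_def field_simps power2_eq_square)
    finally have "l * ?N \<le> 2 * B * ?F" by linarith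
    then have "?N \<le> (2 * B * l2_norm \<mu> f)\<^sup>2"
      using \<open>B > 0\<close> by (simp add: l_def field_simps power2_eq_square)
    then show ?thesis by (rule power2_le_imp_le) (use B in simp)
  qed
qed

section \<open>Bounded functions of a spectral measure\<close>

locale spectral_family =
  fixes \<mu> :: "'a measure" and E :: "real set \<Rightarrow> ('a \<Rightarrow> complex) \<Rightarrow> ('a \<Rightarrow> complex)"
  assumes pvm: "projection_valued_measure \<mu> E"
begin

abbreviation \<nu> :: "('a \<Rightarrow> complex) \<Rightarrow> real measure" where
  "\<nu> \<equiv> spectral_scalar_measure \<mu> E"

lemma E_operator: "A \<in> sets half_line \<Longrightarrow> L2_operator \<mu> (E A)"
  using pvm by (simp add: projection_valued_measure_def)

lemma E_L2: "A \<in> sets half_line \<Longrightarrow> f \<in> L2 \<mu> \<Longrightarrow> E A f \<in> L2 \<mu>"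
  using E_operator by (rule L2_operator_range)

lemma E_symmetric:
  "A \<in> sets half_line \<Longrightarrow> f \<in> L2 \<mu> \<Longrightarrow> g \<in> L2 \<mu> \<Longrightarrow> l2_inner \<mu> (E A f) g = l2_inner \<mu> f (E A g)"
  using pvm unfolding projection_valued_measure_def by blast

lemma E_Int:
  "A \<in> sets half_line \<Longrightarrow> B \<in> sets half_line \<Longrightarrow> f \<in> L2 \<mu> \<Longrightarrow> AE x in \<mu>. E (A \<inter> B) f x = E A (E B f) x"
  using pvm unfolding projection_valued_measure_def by blast

lemma E_top: "f \<in> L2 \<mu> \<Longrightarrow> AE x in \<mu>. E {0..} f x = f x"
  using pvm unfolding projection_valued_measure_def by blast

lemma E_sums:
  "range A \<subseteq> sets half_line \<Longrightarrow> disjoint_family A \<Longrightarrow> f \<in> L2 \<mu> \<Longrightarrow> g \<in> L2 \<mu> \<Longrightarrow>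
    (\<lambda>n::nat. l2_inner \<mu> (E (A n) f) g) sums l2_inner \<mu> (E (\<Union>n. A n) f) g"
  using pvm unfolding projection_valued_measure_def by blast

lemma E_inner:
  assumes "A \<in> sets half_line" "B \<in> sets half_line" "f \<in> L2 \<mu>" "g \<in> L2 \<mu>"
  shows "l2_inner \<mu> (E A f) (E B g) = l2_inner \<mu> (E (A \<inter> B) f) g"
proof -
  have "l2_inner \<mu> (E (A \<inter> B) f) g = l2_inner \<mu> (E B (E A f)) g"
    using assms E_Int[of B A f] by (intro l2_inner_cong) (auto simp: Int_commute E_L2)
  then show ?thesis using assms by (simp add: E_symmetric E_L2)
qed

lemma E_diag:
  "A \<in> sets half_line \<Longrightarrow> f \<in> L2 \<mu> \<Longrightarrow> l2_inner \<mu> (E A f) f = of_real ((l2_norm \<mu> (E A f))\<^sup>2)"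
  using E_inner[of A A f f] by (simp add: l2_inner_self)

lemma E_empty: "f \<in> L2 \<mu> \<Longrightarrow> g \<in> L2 \<mu> \<Longrightarrow> l2_inner \<mu> (E {} f) g = 0"
  using E_sums[of "\<lambda>_. {}" f g]
  by (simp add: disjoint_family_on_def sums_iff summable_const_iff)

lemma E_disjoint:
  "A \<in> sets half_line \<Longrightarrow> B \<in> sets half_line \<Longrightarrow> A \<inter> B = {} \<Longrightarrow> f \<in> L2 \<mu> \<Longrightarrow> g \<in> L2 \<mu> \<Longrightarrow>
    l2_inner \<mu> (E A f) (E B g) = 0"
  by (simp add: E_inner E_empty)

lemma sets_half_line_algebra: "sigma_algebra {0..} (sets half_line)"
  using sets.sigma_algebra_axioms[of half_line] by (simp add: space_restrict_space)

lemma space_\<nu> [simp]: "space (\<nu> f) = {0..}"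
  unfolding spectral_scalar_measure_def
  by (rule space_measure_of) (use sets.space_closed[of half_line] in \<open>simp add: space_restrict_space\<close>)

lemma sets_\<nu> [simp, measurable_cong]: "sets (\<nu> f) = sets half_line"
  unfolding spectral_scalar_measure_def
  by (rule sigma_algebra.sets_measure_of_eq[OF sets_half_line_algebra])

text \<open>Weak countable additivity of \<open>E\<close> and \<open>\<langle>E A f, f\<rangle> = |E A f|\<^sup>2 \<ge> 0\<close> make the set function behind
  \<open>spectral_scalar_measure\<close> a genuine measure.\<close>

lemma emeasure_\<nu>:
  assumes f: "f \<in> L2 \<mu>" and A: "A \<in> sets half_line"
  shows "emeasure (\<nu> f) A = ennreal ((l2_norm \<mu> (E A f))\<^sup>2)"
proof -
  let ?m = "\<lambda>A. ennreal (Re (l2_inner \<mu> (E A f) f))"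
  have "countably_additive (sets half_line) ?m"
  proof (rule countably_additiveI)
    fix B :: "nat \<Rightarrow> real set" assume B: "range B \<subseteq> sets half_line" "disjoint_family B"
    have "(\<lambda>n. Re (l2_inner \<mu> (E (B n) f) f)) sums Re (l2_inner \<mu> (E (\<Union>n. B n) f) f)"
      using E_sums[OF B f f] by (rule sums_Re)
    moreover have "0 \<le> Re (l2_inner \<mu> (E (B n) f) f)" for n
      using B f by (subst E_diag) auto
    ultimately show "(\<Sum>n. ?m (B n)) = ?m (\<Union> (range B))"
      by (intro suminf_ennreal_eq)
  qed
  moreover have "positive (sets half_line) ?m"
    using f by (simp add: positive_def E_empty)
  ultimately have "emeasure (\<nu> f) A = ?m A"
    unfolding spectral_scalar_measure_def
    using A by (intro emeasure_measure_of_sigma sets_half_line_algebra)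
  then show ?thesis using f A by (simp add: E_diag)
qed

lemma emeasure_\<nu>_space: "f \<in> L2 \<mu> \<Longrightarrow> emeasure (\<nu> f) {0..} = ennreal ((l2_norm \<mu> f)\<^sup>2)"
proof -
  assume f: "f \<in> L2 \<mu>"
  have top: "{0..} \<in> sets half_line" by (simp add: sets_restrict_space_iff)
  have "l2_inner \<mu> (E {0..} f) f = l2_inner \<mu> f f"
    using f top by (intro l2_inner_cong E_top E_L2) auto
  then have "(l2_norm \<mu> (E {0..} f))\<^sup>2 = (l2_norm \<mu> f)\<^sup>2"
    using f top by (simp add: E_diag l2_inner_self flip: of_real_power)
  then show ?thesis using f top by (simp add: emeasure_\<nu>)
qed

lemma finite_measure_\<nu>: "f \<in> L2 \<mu> \<Longrightarrow> finite_measure (\<nu> f)"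
  by (rule finite_measureI) (simp add: emeasure_\<nu>_space)

lemma measure_\<nu>_space: "f \<in> L2 \<mu> \<Longrightarrow> measure (\<nu> f) {0..} = (l2_norm \<mu> f)\<^sup>2"
  by (simp add: measure_def emeasure_\<nu>_space)

definition bounded_symbol :: "(real \<Rightarrow> complex) \<Rightarrow> bool" where
  "bounded_symbol \<phi> \<longleftrightarrow> \<phi> \<in> borel_measurable half_line \<and> (\<exists>b. \<forall>u\<ge>0. cmod (\<phi> u) \<le> b)"

lemma bounded_symbol_integrable:
  assumes "bounded_symbol \<phi>" "f \<in> L2 \<mu>"
  shows "integrable (\<nu> f) \<phi>"
proof -
  interpret finite_measure "\<nu> f" using assms(2) by (rule finite_measure_\<nu>)
  from assms(1) obtain b where b: "\<forall>u\<ge>0. cmod (\<phi> u) \<le> b" and [measurable]: "\<phi> \<in> borel_measurable half_line"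
    by (auto simp: bounded_symbol_def)
  show ?thesis
  proof (rule integrable_const_bound[of _ b])
    show "AE u in \<nu> f. norm (\<phi> u) \<le> b" using b by (intro AE_I2) simp
  qed measurable
qed

lemma bounded_symbol_lincomb:
  assumes "bounded_symbol \<phi>" "bounded_symbol \<psi>"
  shows "bounded_symbol (\<lambda>u. a * \<phi> u + b * \<psi> u)"
proof -
  from assms obtain c d where c: "\<forall>u\<ge>0. cmod (\<phi> u) \<le> c" "\<forall>u\<ge>0. cmod (\<psi> u) \<le> d"
    and [measurable]: "\<phi> \<in> borel_measurable half_line" "\<psi> \<in> borel_measurable half_line"
    by (auto simp: bounded_symbol_def)
  have "cmod (a * \<phi> u + b * \<psi> u) \<le> cmod a * c + cmod b * d" if "u \<ge> 0" for u
    using c that by (intro order_trans[OF norm_triangle_ineq]) (auto simp: norm_mult intro!: add_mono mult_left_mono)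
  then show ?thesis unfolding bounded_symbol_def by (intro conjI exI allI impI) auto
qed

lemma bounded_symbol_mult:
  assumes "bounded_symbol \<phi>" "bounded_symbol \<psi>"
  shows "bounded_symbol (\<lambda>u. \<phi> u * \<psi> u)"
proof -
  from assms obtain c d where c: "\<forall>u\<ge>0. cmod (\<phi> u) \<le> c" "\<forall>u\<ge>0. cmod (\<psi> u) \<le> d"
    and [measurable]: "\<phi> \<in> borel_measurable half_line" "\<psi> \<in> borel_measurable half_line"
    by (auto simp: bounded_symbol_def)
  have "cmod (\<phi> u * \<psi> u) \<le> c * d" if "u \<ge> 0" for u
    using c that unfolding norm_mult by (intro mult_mono) (auto intro: order_trans[OF norm_ge_zero])
  then show ?thesis unfolding bounded_symbol_def by (intro conjI exI allI impI) auto
qed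

lemma bounded_symbol_cnj: "bounded_symbol \<phi> \<Longrightarrow> bounded_symbol (\<lambda>u. cnj (\<phi> u))"
  by (auto simp: bounded_symbol_def)

lemma bounded_symbol_const: "bounded_symbol (\<lambda>u. a)"
  by (auto simp: bounded_symbol_def)

lemma bounded_symbol_indicator:
  "A \<in> sets half_line \<Longrightarrow> bounded_symbol (\<lambda>u. of_real (indicator A u))"
  unfolding bounded_symbol_def by (intro conjI exI[of _ 1]) (auto simp: indicator_def)

text \<open>\<open>T = \<integral> \<phi> dE\<close> for symbols \<open>\<phi>\<close> that are bounded, where the spectral domain is the whole space; see
  \<open>represents_spectral_integral\<close>. Stating it as a relation allows one to identify an operator given
  by some other expression.\<close>

definition represents :: "(real \<Rightarrow> complex) \<Rightarrow> (('a \<Rightarrow> complex) \<Rightarrow> ('a \<Rightarrow> complex)) \<Rightarrow> bool" where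
  "represents \<phi> T \<longleftrightarrow> L2_operator \<mu> T \<and> (\<forall>f\<in>L2 \<mu>. l2_inner \<mu> (T f) f = (\<integral>u. \<phi> u \<partial>\<nu> f))"

lemma represents_operator: "represents \<phi> T \<Longrightarrow> L2_operator \<mu> T"
  by (simp add: represents_def)

lemma represents_L2: "represents \<phi> T \<Longrightarrow> f \<in> L2 \<mu> \<Longrightarrow> T f \<in> L2 \<mu>"
  using represents_operator by (rule L2_operator_range)

lemma represents_diag: "represents \<phi> T \<Longrightarrow> f \<in> L2 \<mu> \<Longrightarrow> l2_inner \<mu> (T f) f = (\<integral>u. \<phi> u \<partial>\<nu> f)"
  by (simp add: represents_def)

lemma represents_unique:
  assumes "represents \<phi> S" "represents \<psi> T" "\<And>u. 0 \<le> u \<Longrightarrow> \<phi> u = \<psi> u" "f \<in> L2 \<mu>"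
  shows "AE x in \<mu>. S f x = T f x"
proof (rule L2_operator_eq_AE[OF represents_operator[OF assms(1)] represents_operator[OF assms(2)] _ assms(4)])
  fix f assume f: "f \<in> L2 \<mu>"
  have "(\<integral>u. \<phi> u \<partial>\<nu> f) = (\<integral>u. \<psi> u \<partial>\<nu> f)"
    by (rule Bochner_Integration.integral_cong) (auto simp: assms(3))
  then show "l2_inner \<mu> (S f) f = l2_inner \<mu> (T f) f"
    using assms(1,2) f by (simp add: represents_diag)
qed

lemma represents_cong:
  assumes "represents \<phi> S" "\<And>u. 0 \<le> u \<Longrightarrow> \<phi> u = \<psi> u"
  shows "represents \<psi> S"
proof -
  have "(\<integral>u. \<phi> u \<partial>\<nu> f) = (\<integral>u. \<psi> u \<partial>\<nu> f)" for f
    by (rule Bochner_Integration.integral_cong) (auto simp: assms(2))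
  then show ?thesis using assms(1) by (simp add: represents_def)
qed

lemma represents_lincomb:
  assumes S: "represents \<phi> S" and T: "represents \<psi> T" and "bounded_symbol \<phi>" "bounded_symbol \<psi>"
  shows "represents (\<lambda>u. a * \<phi> u + b * \<psi> u) (\<lambda>f x. a * S f x + b * T f x)"
  unfolding represents_def
proof (intro conjI ballI)
  show "L2_operator \<mu> (\<lambda>f x. a * S f x + b * T f x)"
    using S T by (intro L2_operator_combination represents_operator)
  fix f assume f: "f \<in> L2 \<mu>"
  have "l2_inner \<mu> (\<lambda>x. a * S f x + b * T f x) f = a * l2_inner \<mu> (S f) f + b * l2_inner \<mu> (T f) f"
    by (rule l2_inner_lincomb_left[OF represents_L2[OF S f] represents_L2[OF T f] f])
  also have "\<dots> = (\<integral>u. a * \<phi> u + b * \<psi> u \<partial>\<nu> f)"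
    using S T f assms(3,4) by (simp add: represents_diag bounded_symbol_integrable)
  finally show "l2_inner \<mu> (\<lambda>x. a * S f x + b * T f x) f = (\<integral>u. a * \<phi> u + b * \<psi> u \<partial>\<nu> f)" .
qed

lemma represents_zero: "represents (\<lambda>u. 0) (\<lambda>f x. 0)"
  unfolding represents_def by (auto intro!: L2_operatorI simp: l2_inner_def)

lemma represents_indicator:
  assumes A: "A \<in> sets half_line"
  shows "represents (\<lambda>u. of_real (indicator A u)) (E A)"
  unfolding represents_def
proof (intro conjI ballI)
  fix f assume f: "f \<in> L2 \<mu>"
  have "A \<subseteq> {0..}" using sets.sets_into_space[OF A] by (simp add: space_restrict_space)
  then have "(\<integral>u. of_real (indicator A u) \<partial>\<nu> f) = complex_of_real (measure (\<nu> f) A)"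
    by (simp add: Int_absorb2)
  then show "l2_inner \<mu> (E A f) f = (\<integral>u. of_real (indicator A u) \<partial>\<nu> f)"
    using f A by (simp add: E_diag measure_def emeasure_\<nu>)
qed (use E_operator[OF A] in simp)

lemma represents_numerical_bound:
  assumes T: "represents \<phi> T" and \<phi>: "bounded_symbol \<phi>"
    and b: "\<And>u. 0 \<le> u \<Longrightarrow> cmod (\<phi> u) \<le> b" and f: "f \<in> L2 \<mu>"
  shows "cmod (l2_inner \<mu> (T f) f) \<le> b * (l2_norm \<mu> f)\<^sup>2"
proof -
  interpret finite_measure "\<nu> f" using f by (rule finite_measure_\<nu>)
  have "cmod (\<integral>u. \<phi> u \<partial>\<nu> f) \<le> (\<integral>u. cmod (\<phi> u) \<partial>\<nu> f)" by (rule integral_norm_bound)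
  also have "\<dots> \<le> (\<integral>u. b \<partial>\<nu> f)"
    using b bounded_symbol_integrable[OF \<phi> f] by (intro integral_mono) auto
  finally show ?thesis using T f by (simp add: represents_diag measure_\<nu>_space mult.commute)
qed

lemma represents_norm_bound:
  assumes T: "represents \<phi> T" and \<phi>: "bounded_symbol \<phi>"
    and b: "\<And>u. 0 \<le> u \<Longrightarrow> cmod (\<phi> u) \<le> b" and f: "f \<in> L2 \<mu>"
  shows "l2_norm \<mu> (T f) \<le> 2 * b * l2_norm \<mu> f"
proof (rule L2_operator_norm_bound[OF represents_operator[OF T] _ represents_numerical_bound[OF T \<phi> b] f])
  show "0 \<le> b" using b[of 0] norm_ge_zero[of "\<phi> 0"] by linarith
qed

lemma represents_adjoint:
  assumes S: "represents \<phi> S" and T: "represents (\<lambda>u. cnj (\<phi> u)) T"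
    and f: "f \<in> L2 \<mu>" and g: "g \<in> L2 \<mu>"
  shows "l2_inner \<mu> (S f) g = l2_inner \<mu> f (T g)"
proof (rule sesquilinear_eqI[OF L2_operator_sesquilinear L2_operator_sesquilinear' _ f g])
  fix f assume f: "f \<in> L2 \<mu>"
  have "l2_inner \<mu> f (T f) = cnj (\<integral>u. cnj (\<phi> u) \<partial>\<nu> f)"
    using represents_diag[OF T f] by (metis cnj_l2_inner)
  then show "l2_inner \<mu> (S f) f = l2_inner \<mu> f (T f)"
    using represents_diag[OF S f] by simp
qed (use S T represents_operator in auto)

text \<open>Cutting the symbol down to \<open>A\<close> amounts to composing with \<open>E A\<close>. With \<open>u = E A f\<close> and
  \<open>v = E ({0..} - A) f\<close> the scalar measure of \<open>u + \<omega> v\<close> is the same for all unimodular \<open>\<omega>\<close>, so that the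
  polarization identity makes the mixed term \<open>\<langle>Su, v\<rangle>\<close> vanish.\<close>

lemma represents_comp_indicator:
  assumes S: "represents \<phi> S" and \<phi>: "bounded_symbol \<phi>" and A: "A \<in> sets half_line"
  shows "represents (\<lambda>u. \<phi> u * of_real (indicator A u)) (\<lambda>f. S (E A f))"
  unfolding represents_def
proof (intro conjI ballI)
  note S' = represents_operator[OF S]
  show "L2_operator \<mu> (\<lambda>f. S (E A f))"
    by (rule L2_operator_comp[OF S' E_operator[OF A]])
  fix f assume f: "f \<in> L2 \<mu>"
  define A' where "A' = {0..} - A"
  define u v where "u = E A f" and "v = E A' f"
  have A': "A' \<in> sets half_line"
    using sets.Diff[OF sets.top A] by (simp add: A'_def space_restrict_space)
  have AA': "A \<inter> A' = {}" "A \<union> A' = {0..}"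
    using sets.sets_into_space[OF A] by (auto simp: A'_def space_restrict_space)
  have u: "u \<in> L2 \<mu>" and v: "v \<in> L2 \<mu>" using f A A' by (auto simp: u_def v_def E_L2)
  have w: "(\<lambda>x. u x + \<omega> * v x) \<in> L2 \<mu>" for \<omega> using L2_lincomb[OF u v, of 1 \<omega>] by simp
  have "\<nu> (\<lambda>x. u x + \<omega> * v x) = \<nu> (\<lambda>x. u x + 1 * v x)" if "cmod \<omega> = 1" for \<omega>
  proof (rule measure_eqI)
    fix B assume "B \<in> sets (\<nu> (\<lambda>x. u x + \<omega> * v x))"
    then have B: "B \<in> sets half_line" by simp
    have Bu: "E B u \<in> L2 \<mu>" and Bv: "E B v \<in> L2 \<mu>" using B u v by (auto intro: E_L2)
    have uv: "l2_inner \<mu> (E B u) v = 0" "l2_inner \<mu> (E B v) u = 0"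
    proof -
      have "l2_inner \<mu> (E B u) v = l2_inner \<mu> (E (B \<inter> A) f) v"
        unfolding u_def using E_Int[OF B A f] B A f v
        by (intro l2_inner_cong) (auto intro: E_L2)
      also have "\<dots> = 0"
        unfolding v_def using AA' by (intro E_disjoint[OF sets.Int[OF B A] A' _ f f]) blast
      finally show "l2_inner \<mu> (E B u) v = 0" .
      have "l2_inner \<mu> (E B v) u = l2_inner \<mu> (E (B \<inter> A') f) u"
        unfolding v_def using E_Int[OF B A' f] B A' f u
        by (intro l2_inner_cong) (auto intro: E_L2)
      also have "\<dots> = 0"
        unfolding u_def using AA' by (intro E_disjoint[OF sets.Int[OF B A'] A _ f f]) blast
      finally show "l2_inner \<mu> (E B v) u = 0" .
    qed
    have *: "complex_of_real ((l2_norm \<mu> (E B (\<lambda>x. u x + \<omega> * v x)))\<^sup>2)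
        = l2_inner \<mu> (E B u) u + l2_inner \<mu> (E B v) v" if "cmod \<omega> = 1" for \<omega>
    proof -
      have "complex_of_real ((l2_norm \<mu> (E B (\<lambda>x. u x + \<omega> * v x)))\<^sup>2)
          = l2_inner \<mu> (E B (\<lambda>x. 1 * u x + \<omega> * v x)) (\<lambda>x. 1 * u x + \<omega> * v x)"
        using E_diag[OF B w[of \<omega>]] by simp
      also have "\<dots> = l2_inner \<mu> (E B u) u + \<omega> * cnj \<omega> * l2_inner \<mu> (E B v) v"
        using w[of \<omega>]
        by (subst L2_operator_inner_lincomb[OF E_operator[OF B] u v])
          (simp_all add: l2_inner_lincomb_right[OF u v Bu, of 1 \<omega>, simplified]
            l2_inner_lincomb_right[OF u v Bv, of 1 \<omega>, simplified] uv)
      also have "\<omega> * cnj \<omega> = 1" using that complex_norm_square[of \<omega>] by simp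
      finally show ?thesis by simp
    qed
    have "(l2_norm \<mu> (E B (\<lambda>x. u x + \<omega> * v x)))\<^sup>2 = (l2_norm \<mu> (E B (\<lambda>x. u x + 1 * v x)))\<^sup>2"
      using *[OF that] *[of 1] by (metis norm_one of_real_eq_iff)
    then show "emeasure (\<nu> (\<lambda>x. u x + \<omega> * v x)) B = emeasure (\<nu> (\<lambda>x. u x + 1 * v x)) B"
      by (simp only: emeasure_\<nu>[OF w B])
  qed simp
  then have q: "l2_inner \<mu> (S (\<lambda>x. u x + \<omega> * v x)) (\<lambda>x. u x + \<omega> * v x) = (\<integral>t. \<phi> t \<partial>\<nu> (\<lambda>x. u x + 1 * v x))"
    if "cmod \<omega> = 1" for \<omega>
    using represents_diag[OF S w] that by metis
  have "4 * l2_inner \<mu> (S u) v = 0"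
    by (simp only: polarization[OF L2_operator_sesquilinear[OF S'] u v]
        q norm_one norm_ii norm_minus_cancel) simp
  moreover have "l2_inner \<mu> (S u) f = l2_inner \<mu> (S u) (\<lambda>x. 1 * u x + 1 * v x)"
  proof (rule l2_inner_cong)
    have "l2_inner \<mu> f h = l2_inner \<mu> (\<lambda>x. 1 * u x + 1 * v x) h" if h: "h \<in> L2 \<mu>" for h
    proof -
      define P where "P n = (if n = 0 then A else if n = (1::nat) then A' else {})" for n
      have "(\<lambda>n. l2_inner \<mu> (E (P n) f) h) sums l2_inner \<mu> (E (\<Union>n. P n) f) h"
        using A A' AA' f h by (intro E_sums) (auto simp: P_def disjoint_family_on_def)
      moreover have "(\<Union>n. P n) = {0..}" using AA' by (auto simp: P_def split: if_splits)
      moreover have "(\<lambda>n. l2_inner \<mu> (E (P n) f) h) sums (\<Sum>n\<in>{0, 1}. l2_inner \<mu> (E (P n) f) h)"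
        by (rule sums_finite) (auto simp: P_def E_empty f h)
      ultimately have "l2_inner \<mu> (E {0..} f) h = l2_inner \<mu> u h + l2_inner \<mu> v h"
        by (auto simp: P_def u_def v_def dest: sums_unique2)
      moreover have "l2_inner \<mu> (E {0..} f) h = l2_inner \<mu> f h"
        using f h by (intro l2_inner_cong E_top E_L2) (auto simp: sets_restrict_space_iff)
      ultimately show ?thesis by (simp add: l2_inner_lincomb_left[OF u v h, of 1 1, simplified])
    qed
    then show "AE x in \<mu>. f x = 1 * u x + 1 * v x"
      by (intro l2_eq_AE_of_inner f L2_lincomb u v)
  qed (use u v f S in \<open>auto intro: represents_L2 L2_add\<close>)
  ultimately have "l2_inner \<mu> (S u) f = l2_inner \<mu> (S u) u"
    using l2_inner_lincomb_right[OF u v represents_L2[OF S u], of 1 1] by simp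
  also have "\<dots> = (\<integral>t. \<phi> t \<partial>\<nu> u)" by (rule represents_diag[OF S u])
  also have "\<nu> u = density (\<nu> f) (\<lambda>t. ennreal (indicator A t))"
  proof (rule measure_eqI)
    fix B assume "B \<in> sets (\<nu> u)"
    then have B: "B \<in> sets half_line" by simp
    have "(l2_norm \<mu> (E B u))\<^sup>2 = (l2_norm \<mu> (E (A \<inter> B) f))\<^sup>2"
    proof -
      have "complex_of_real ((l2_norm \<mu> (E B u))\<^sup>2) = l2_inner \<mu> (E B u) u" using E_diag[OF B u] by simp
      also have "\<dots> = l2_inner \<mu> (E (B \<inter> A) f) u"
        unfolding u_def using E_Int[OF B A f] A B f by (intro l2_inner_cong) (auto intro: E_L2)
      also have "\<dots> = l2_inner \<mu> (E (B \<inter> A \<inter> A) f) f"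
        unfolding u_def using A B f by (intro E_inner) auto
      also have "\<dots> = complex_of_real ((l2_norm \<mu> (E (A \<inter> B) f))\<^sup>2)"
        using E_diag[of "A \<inter> B" f] A B f by (simp add: Int_commute Int_assoc Int_left_commute sets.Int)
      finally show ?thesis by (simp only: of_real_eq_iff)
    qed
    then have "emeasure (\<nu> u) B = emeasure (\<nu> f) (A \<inter> B)"
      using A B f u by (simp add: emeasure_\<nu> sets.Int)
    also have "\<dots> = (\<integral>\<^sup>+t. indicator (A \<inter> B) t \<partial>\<nu> f)"
      using A B by (simp add: sets.Int)
    also have "\<dots> = (\<integral>\<^sup>+t. ennreal (indicator A t) * indicator B t \<partial>\<nu> f)"
      by (intro nn_integral_cong) (auto simp: indicator_def)
    also have "\<dots> = emeasure (density (\<nu> f) (\<lambda>t. ennreal (indicator A t))) B"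
      using A B by (subst emeasure_density) auto
    finally show "emeasure (\<nu> u) B = emeasure (density (\<nu> f) (\<lambda>t. ennreal (indicator A t))) B" .
  qed simp
  also have "(\<integral>t. \<phi> t \<partial>density (\<nu> f) (\<lambda>t. ennreal (indicator A t))) = (\<integral>t. indicator A t *\<^sub>R \<phi> t \<partial>\<nu> f)"
    using \<phi> A by (intro integral_density) (auto simp: bounded_symbol_def)
  finally show "l2_inner \<mu> (S (E A f)) f = (\<integral>t. \<phi> t * of_real (indicator A t) \<partial>\<nu> f)"
    by (simp add: u_def scaleR_conv_of_real mult.commute)
qed

text \<open>Rounding the real and imaginary parts down to multiples of a fixed step gives uniform
  approximation by finitely valued functions.\<close>

lemma uniform_simple_approximation:
  assumes \<phi>: "bounded_symbol \<phi>" and e: "0 < e"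
  obtains V A where "finite V" "\<And>v. A v \<in> sets half_line"
    "\<And>u. 0 \<le> u \<Longrightarrow> cmod (\<phi> u - (\<Sum>v\<in>V. v * of_real (indicator (A v) u))) \<le> e"
proof -
  from \<phi> obtain b where b: "\<And>u. u \<ge> 0 \<Longrightarrow> cmod (\<phi> u) \<le> b"
    and [measurable]: "\<phi> \<in> borel_measurable half_line"
    by (auto simp: bounded_symbol_def)
  define d where "d = e / 2"
  have d: "d > 0" using e by (simp add: d_def)
  define grid :: "int \<times> int \<Rightarrow> complex" where
    "grid = (\<lambda>(m, n). of_real (d * of_int m) + \<i> * of_real (d * of_int n))"
  define s where "s u = grid (\<lfloor>Re (\<phi> u) / d\<rfloor>, \<lfloor>Im (\<phi> u) / d\<rfloor>)" for u
  define V where "V = s ` {0..}"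
  define A where "A v = s -` {v} \<inter> {0..}" for v
  have s [measurable]: "s \<in> borel_measurable half_line" unfolding s_def grid_def by simp
  have close: "0 \<le> t - d * of_int \<lfloor>t / d\<rfloor>" "t - d * of_int \<lfloor>t / d\<rfloor> \<le> d" for t
  proof -
    have "d * of_int \<lfloor>t / d\<rfloor> \<le> d * (t / d)" using d by (intro mult_left_mono) auto
    then show "0 \<le> t - d * of_int \<lfloor>t / d\<rfloor>" using d by simp
    have "d * (t / d) \<le> d * (of_int \<lfloor>t / d\<rfloor> + 1)" using d by (intro mult_left_mono) linarith+
    then show "t - d * of_int \<lfloor>t / d\<rfloor> \<le> d" using d by (simp add: algebra_simps)
  qed
  have "finite V"
  proof (rule finite_subset)
    define N where "N = \<lceil>b / d\<rceil> + 1"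
    have "\<lfloor>t / d\<rfloor> \<in> {- N..N}" if "\<bar>t\<bar> \<le> b" for t
    proof -
      have "\<bar>t / d\<bar> \<le> b / d" using that d by (simp add: divide_right_mono)
      then show ?thesis unfolding N_def atLeastAtMost_iff by linarith
    qed
    then have "s u \<in> grid ` ({- N..N} \<times> {- N..N})" if "u \<ge> 0" for u
      unfolding s_def using b[OF that] abs_Re_le_cmod[of "\<phi> u"] abs_Im_le_cmod[of "\<phi> u"]
      by (intro imageI SigmaI) auto
    then show "V \<subseteq> grid ` ({- N..N} \<times> {- N..N})" by (auto simp: V_def)
  qed simp
  moreover have "A v \<in> sets half_line" for v
    using measurable_sets[OF s, of "{v}"] by (simp add: A_def space_restrict_space)
  moreover have "cmod (\<phi> u - (\<Sum>v\<in>V. v * of_real (indicator (A v) u))) \<le> e" if u: "0 \<le> u" for u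
  proof -
    have "(\<Sum>v\<in>V. v * of_real (indicator (A v) u)) = (\<Sum>v\<in>V. if v = s u then v else 0)"
      by (rule sum.cong) (use u in \<open>auto simp: A_def indicator_def\<close>)
    also have "\<dots> = s u" using \<open>finite V\<close> u by (simp add: V_def)
    finally have "cmod (\<phi> u - (\<Sum>v\<in>V. v * of_real (indicator (A v) u))) = cmod (\<phi> u - s u)" by simp
    also have "\<dots> \<le> \<bar>Re (\<phi> u - s u)\<bar> + \<bar>Im (\<phi> u - s u)\<bar>" by (rule cmod_le)
    also have "\<dots> \<le> d + d"
      using close[of "Re (\<phi> u)"] close[of "Im (\<phi> u)"]
      by (intro add_mono) (simp_all add: s_def grid_def)
    finally show ?thesis by (simp add: d_def)
  qed
  ultimately show ?thesis by (rule that)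
qed

lemma bounded_symbol_simple:
  assumes "finite V" "\<And>v. A v \<in> sets half_line"
  shows "bounded_symbol (\<lambda>u. \<Sum>v\<in>V. v * of_real (indicator (A v) u))"
  using assms(1)
proof induction
  case empty
  show ?case using bounded_symbol_const[of 0] by simp
next
  case (insert v V)
  then show ?case
    using bounded_symbol_lincomb[OF bounded_symbol_indicator[OF assms(2)[of v]] insert.IH, of v 1] by simp
qed

text \<open>For finitely valued symbols both the operator and the composition formula come from
  \<open>represents_comp_indicator\<close> by linearity.\<close>

lemma represents_simple:
  assumes S: "represents \<phi> S" and \<phi>: "bounded_symbol \<phi>"
    and "finite V" and A: "\<And>v. A v \<in> sets half_line"
  shows "\<exists>T. represents (\<lambda>u. \<Sum>v\<in>V. v * of_real (indicator (A v) u)) T \<and>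
    represents (\<lambda>u. \<phi> u * (\<Sum>v\<in>V. v * of_real (indicator (A v) u))) (\<lambda>f. S (T f))"
  using assms(3)
proof induction
  case empty
  have "L2_operator \<mu> (\<lambda>f. S (\<lambda>x. 0))"
    by (rule L2_operator_comp[OF represents_operator[OF S] represents_operator[OF represents_zero]])
  moreover have "l2_inner \<mu> (S (\<lambda>x. 0)) f = 0" if "f \<in> L2 \<mu>" for f
    using L2_operator_inner_lincomb[OF represents_operator[OF S] L2_zero L2_zero that, of 0 0] by simp
  ultimately have "represents (\<lambda>u. 0) (\<lambda>f. S (\<lambda>x. 0))" by (simp add: represents_def)
  then show ?case using represents_zero by (intro exI[of _ "\<lambda>f x. 0"]) simp
next
  case (insert v V)
  let ?s = "\<lambda>u. \<Sum>v\<in>V. v * of_real (indicator (A v) u)"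
  let ?i = "\<lambda>u. of_real (indicator (A v) u) :: complex"
  from insert obtain T where T: "represents ?s T" and ST: "represents (\<lambda>u. \<phi> u * ?s u) (\<lambda>f. S (T f))"
    by auto
  have s: "bounded_symbol ?s" using insert A by (intro bounded_symbol_simple)
  have i: "bounded_symbol ?i" using A by (rule bounded_symbol_indicator)
  let ?T = "\<lambda>f x. 1 * T f x + v * E (A v) f x"
  have T': "represents (\<lambda>u. 1 * ?s u + v * ?i u) ?T"
    by (rule represents_lincomb[OF T represents_indicator[OF A] s i])
  have "represents (\<lambda>u. \<phi> u * (1 * ?s u + v * ?i u)) (\<lambda>f. S (?T f))"
    unfolding represents_def
  proof (intro conjI ballI)
    show "L2_operator \<mu> (\<lambda>f. S (?T f))"
      by (rule L2_operator_comp[OF represents_operator[OF S] represents_operator[OF T']])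
    fix f assume f: "f \<in> L2 \<mu>"
    have "l2_inner \<mu> (S (?T f)) f = 1 * l2_inner \<mu> (S (T f)) f + v * l2_inner \<mu> (S (E (A v) f)) f"
      by (rule L2_operator_inner_lincomb[OF represents_operator[OF S] represents_L2[OF T f] E_L2[OF A f] f])
    also have "\<dots> = 1 * (\<integral>u. \<phi> u * ?s u \<partial>\<nu> f) + v * (\<integral>u. \<phi> u * ?i u \<partial>\<nu> f)"
      using represents_diag[OF ST f] represents_diag[OF represents_comp_indicator[OF S \<phi> A] f] by simp
    also have "\<dots> = (\<integral>u. \<phi> u * ?s u + v * (\<phi> u * ?i u) \<partial>\<nu> f)"
      using bounded_symbol_integrable[OF bounded_symbol_mult[OF \<phi> s] f]
        bounded_symbol_integrable[OF bounded_symbol_mult[OF \<phi> i] f] by simp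
    also have "\<dots> = (\<integral>u. \<phi> u * (1 * ?s u + v * ?i u) \<partial>\<nu> f)"
      by (simp add: algebra_simps)
    finally show "l2_inner \<mu> (S (?T f)) f = (\<integral>u. \<phi> u * (1 * ?s u + v * ?i u) \<partial>\<nu> f)" .
  qed
  with T' show ?case using insert.hyps
    by (intro exI[of _ ?T]) (simp add: add.commute)
qed

lemma simple_representation:
  assumes S: "represents \<phi> S" and \<phi>: "bounded_symbol \<phi>" and \<psi>: "bounded_symbol \<psi>" and e: "0 < e"
  obtains s T where "bounded_symbol s" "\<And>u. 0 \<le> u \<Longrightarrow> cmod (\<psi> u - s u) \<le> e"
    "represents s T" "represents (\<lambda>u. \<phi> u * s u) (\<lambda>f. S (T f))"
proof -
  obtain V A where V: "finite V" "\<And>v. A v \<in> sets half_line"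
    "\<And>u. 0 \<le> u \<Longrightarrow> cmod (\<psi> u - (\<Sum>v\<in>V. v * of_real (indicator (A v) u))) \<le> e"
    using uniform_simple_approximation[OF \<psi> e] by blast
  from represents_simple[OF S \<phi> V(1), of A, OF V(2)] obtain T where
    "represents (\<lambda>u. \<Sum>v\<in>V. v * of_real (indicator (A v) u)) T"
    "represents (\<lambda>u. \<phi> u * (\<Sum>v\<in>V. v * of_real (indicator (A v) u))) (\<lambda>f. S (T f))"
    by blast
  then show ?thesis
    by (intro that[OF bounded_symbol_simple[of V A, OF V(1,2)]]) (assumption | rule V(3))+
qed

text \<open>The homomorphism property is known when \<open>\<psi>\<close> is finitely valued. In general \<open>\<psi>\<close> is uniformly
  close to such a function, and \<open>represents_norm_bound\<close> controls the errors on both sides.\<close>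

lemma represents_mult:
  assumes S: "represents \<phi> S" and T: "represents \<psi> T"
    and \<phi>: "bounded_symbol \<phi>" and \<psi>: "bounded_symbol \<psi>"
  shows "represents (\<lambda>u. \<phi> u * \<psi> u) (\<lambda>f. S (T f))"
  unfolding represents_def
proof (intro conjI ballI)
  note S' = represents_operator[OF S] and T' = represents_operator[OF T]
  show "L2_operator \<mu> (\<lambda>f. S (T f))" by (rule L2_operator_comp[OF S' T'])
  fix f assume f: "f \<in> L2 \<mu>"
  from \<phi> obtain b0 where b0: "\<And>u. u \<ge> 0 \<Longrightarrow> cmod (\<phi> u) \<le> b0" by (auto simp: bounded_symbol_def)
  define b where "b = max b0 1"
  have b: "\<And>u. u \<ge> 0 \<Longrightarrow> cmod (\<phi> u) \<le> b" and "b > 0"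
    using b0 by (auto simp: b_def le_max_iff_disj)
  let ?F = "(l2_norm \<mu> f)\<^sup>2"
  let ?I = "\<integral>u. \<phi> u * \<psi> u \<partial>\<nu> f"
  have est: "cmod (l2_inner \<mu> (S (T f)) f - ?I) \<le> 5 * b * ?F * e" if e: "0 < e" for e
  proof -
    obtain s R where s: "bounded_symbol s" "\<And>u. 0 \<le> u \<Longrightarrow> cmod (\<psi> u - s u) \<le> e"
      "represents s R" "represents (\<lambda>u. \<phi> u * s u) (\<lambda>f. S (R f))"
      using simple_representation[OF S \<phi> \<psi> e] by blast
    note TL = represents_L2[OF T f] and RL = represents_L2[OF s(3) f]
    have diff: "bounded_symbol (\<lambda>u. \<psi> u - s u)"
      using bounded_symbol_lincomb[OF \<psi> s(1), of 1 "-1"] by simp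
    have "represents (\<lambda>u. \<psi> u - s u) (\<lambda>f x. T f x - R f x)"
      using represents_lincomb[OF T s(3) \<psi> s(1), of 1 "-1"] by simp
    from represents_norm_bound[OF this diff s(2) f]
    have d: "l2_norm \<mu> (\<lambda>x. T f x - R f x) \<le> 2 * e * l2_norm \<mu> f" .
    let ?J = "\<integral>u. \<phi> u * s u \<partial>\<nu> f"
    have "l2_inner \<mu> (S (T f)) f - ?I
      = l2_inner \<mu> (S (\<lambda>x. T f x - R f x)) f - (?I - ?J)"
      using L2_operator_inner_lincomb[OF S' TL RL f, of 1 "-1"] represents_diag[OF s(4) f] by simp
    then have "cmod (l2_inner \<mu> (S (T f)) f - ?I)
      = cmod (l2_inner \<mu> (S (\<lambda>x. T f x - R f x)) f - (?I - ?J))" by (rule arg_cong)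
    also have "\<dots> \<le> cmod (l2_inner \<mu> (S (\<lambda>x. T f x - R f x)) f) + cmod (?I - ?J)"
      by (rule norm_triangle_ineq4)
    also have "\<dots> \<le> 4 * b * e * ?F + b * e * ?F"
    proof (rule add_mono)
      note DL = L2_diff[OF TL RL]
      have "cmod (l2_inner \<mu> (S (\<lambda>x. T f x - R f x)) f) \<le> l2_norm \<mu> (S (\<lambda>x. T f x - R f x)) * l2_norm \<mu> f"
        by (rule l2_Cauchy_Schwarz[OF represents_L2[OF S DL] f])
      also have "\<dots> \<le> (2 * b * (2 * e * l2_norm \<mu> f)) * l2_norm \<mu> f"
      proof (rule mult_right_mono)
        have "l2_norm \<mu> (S (\<lambda>x. T f x - R f x)) \<le> 2 * b * l2_norm \<mu> (\<lambda>x. T f x - R f x)"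
          by (rule represents_norm_bound[OF S \<phi> b DL])
        also have "\<dots> \<le> 2 * b * (2 * e * l2_norm \<mu> f)"
          using \<open>b > 0\<close> by (intro mult_left_mono d) simp
        finally show "l2_norm \<mu> (S (\<lambda>x. T f x - R f x)) \<le> 2 * b * (2 * e * l2_norm \<mu> f)" .
      qed simp
      finally show "cmod (l2_inner \<mu> (S (\<lambda>x. T f x - R f x)) f) \<le> 4 * b * e * ?F"
        by (simp add: power2_eq_square mult_ac)
      interpret finite_measure "\<nu> f" using f by (rule finite_measure_\<nu>)
      have i: "integrable (\<nu> f) (\<lambda>u. \<phi> u * \<psi> u)" "integrable (\<nu> f) (\<lambda>u. \<phi> u * s u)"
        using \<phi> \<psi> s(1) f by (auto intro: bounded_symbol_integrable bounded_symbol_mult)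
      have "cmod (?I - ?J) = cmod (\<integral>u. \<phi> u * (\<psi> u - s u) \<partial>\<nu> f)"
        using i by (simp add: right_diff_distrib)
      also have "\<dots> \<le> (\<integral>u. cmod (\<phi> u * (\<psi> u - s u)) \<partial>\<nu> f)" by (rule integral_norm_bound)
      also have "\<dots> \<le> (\<integral>u. b * e \<partial>\<nu> f)"
      proof (rule integral_mono)
        show "integrable (\<nu> f) (\<lambda>u. cmod (\<phi> u * (\<psi> u - s u)))"
          using i by (simp add: right_diff_distrib)
        show "cmod (\<phi> u * (\<psi> u - s u)) \<le> b * e" if "u \<in> space (\<nu> f)" for u
          unfolding norm_mult using that b s(2) \<open>b > 0\<close> by (intro mult_mono) auto
      qed simp
      finally show "cmod (?I - ?J) \<le> b * e * ?F"
        by (simp add: measure_\<nu>_space[OF f] mult_ac)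
    qed
    finally show ?thesis by (simp add: algebra_simps)
  qed
  have "cmod (l2_inner \<mu> (S (T f)) f - ?I) \<le> 0"
  proof (rule field_le_epsilon)
    fix e :: real assume e: "0 < e"
    define c where "c = 5 * b * ?F"
    have "c \<ge> 0" using \<open>b > 0\<close> by (simp add: c_def)
    then have "c * (e / (c + 1)) \<le> e" using e by (simp add: field_simps)
    then show "cmod (l2_inner \<mu> (S (T f)) f - ?I) \<le> 0 + e"
      using est[of "e / (c + 1)"] e \<open>c \<ge> 0\<close> unfolding c_def[symmetric] by simp
  qed
  then show "l2_inner \<mu> (S (T f)) f = ?I" by simp
qed

lemma represents_one: "represents (\<lambda>u. 1) (\<lambda>f. f)"
  unfolding represents_def
proof (intro conjI ballI)
  show "L2_operator \<mu> (\<lambda>f. f)" by (rule L2_operatorI) auto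
  fix f assume f: "f \<in> L2 \<mu>"
  interpret finite_measure "\<nu> f" using f by (rule finite_measure_\<nu>)
  show "l2_inner \<mu> f f = (\<integral>u. 1 \<partial>\<nu> f)"
    by (simp add: l2_inner_self measure_\<nu>_space[OF f] scaleR_conv_of_real)
qed

text \<open>Operators of uniformly convergent finitely valued symbols form a Cauchy sequence on each vector;
  completeness provides the limit, and the quadratic forms converge along.\<close>

lemma represents_exists:
  assumes \<phi>: "bounded_symbol \<phi>"
  shows "\<exists>T. represents \<phi> T"
proof -
  have "\<exists>s T. bounded_symbol s \<and> (\<forall>u\<ge>0. cmod (\<phi> u - s u) \<le> (1/2) ^ n) \<and> represents s T" for n :: nat
  proof -
    have "(0::real) < (1/2) ^ n" by simp
    show ?thesis
    proof (rule simple_representation[OF represents_one bounded_symbol_const \<phi> \<open>0 < (1/2) ^ n\<close>])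
      fix s T assume s: "bounded_symbol s" "\<And>u. 0 \<le> u \<Longrightarrow> cmod (\<phi> u - s u) \<le> (1/2) ^ n" "represents s T"
      then show ?thesis by (intro exI[of _ s] exI[of _ T] conjI allI impI)
    qed
  qed
  then obtain s T where s: "\<And>n. bounded_symbol (s n)"
    and close: "\<And>n u. 0 \<le> u \<Longrightarrow> cmod (\<phi> u - s n u) \<le> (1/2) ^ n" and T: "\<And>n. represents (s n) (T n)"
    by metis
  note T' = represents_operator[OF T]
  have "\<exists>h. h \<in> L2 \<mu> \<and> (\<lambda>n. l2_norm \<mu> (\<lambda>x. T n f x - h x)) \<longlonglongrightarrow> 0" if f: "f \<in> L2 \<mu>" for f
  proof -
    have "l2_norm \<mu> (\<lambda>x. T (Suc n) f x - T n f x) \<le> (4 * l2_norm \<mu> f) * (1/2) ^ n" for n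
    proof -
      have "represents (\<lambda>u. s (Suc n) u - s n u) (\<lambda>f x. T (Suc n) f x - T n f x)"
        using represents_lincomb[OF T T s s, of 1 "Suc n" "-1" n] by simp
      moreover have "bounded_symbol (\<lambda>u. s (Suc n) u - s n u)"
        using bounded_symbol_lincomb[OF s s, of 1 "Suc n" "-1" n] by simp
      moreover have "cmod (s (Suc n) u - s n u) \<le> 2 * (1/2) ^ n" if "0 \<le> u" for u
      proof -
        have "s (Suc n) u - s n u = (\<phi> u - s n u) - (\<phi> u - s (Suc n) u)" by simp
        also have "cmod \<dots> \<le> (1/2) ^ n + (1/2) ^ Suc n"
          by (intro order_trans[OF norm_triangle_ineq4] add_mono close that)
        finally show ?thesis by (simp add: field_simps)
      qed
      ultimately show ?thesis
        using represents_norm_bound[of "\<lambda>u. s (Suc n) u - s n u" "\<lambda>f x. T (Suc n) f x - T n f x" "2 * (1/2) ^ n" f] f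
        by (simp add: mult_ac)
    qed
    then have "\<exists>h\<in>L2 \<mu>. (\<lambda>n. l2_norm \<mu> (\<lambda>x. T n f x - h x)) \<longlonglongrightarrow> 0"
      using represents_L2[OF T f] by (intro L2_complete[of "\<lambda>n. T n f" \<mu> "4 * l2_norm \<mu> f"]) auto
    then show ?thesis by blast
  qed
  note limit = someI_ex[OF this]
  define R where
    "R f = (SOME h. h \<in> L2 \<mu> \<and> (\<lambda>n. l2_norm \<mu> (\<lambda>x. T n f x - h x)) \<longlonglongrightarrow> 0)" for f
  have R: "R f \<in> L2 \<mu>" and lim: "(\<lambda>n. l2_norm \<mu> (\<lambda>x. T n f x - R f x)) \<longlonglongrightarrow> 0"
    if "f \<in> L2 \<mu>" for f
    using limit[OF that] unfolding R_def by (rule conjunct1, rule conjunct2)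
  have inner_lim: "(\<lambda>n. l2_inner \<mu> (T n f) g) \<longlonglongrightarrow> l2_inner \<mu> (R f) g"
    if f: "f \<in> L2 \<mu>" and g: "g \<in> L2 \<mu>" for f g
  proof (rule LIM_zero_cancel, rule Lim_null_comparison)
    show "(\<lambda>n. l2_norm \<mu> (\<lambda>x. T n f x - R f x) * l2_norm \<mu> g) \<longlonglongrightarrow> 0"
      by (rule tendsto_mult_left_zero[OF lim[OF f]])
    show "eventually (\<lambda>n. norm (l2_inner \<mu> (T n f) g - l2_inner \<mu> (R f) g)
        \<le> l2_norm \<mu> (\<lambda>x. T n f x - R f x) * l2_norm \<mu> g) sequentially"
    proof (intro always_eventually allI)
      fix n
      note TL = represents_L2[OF T f, of n]
      show "norm (l2_inner \<mu> (T n f) g - l2_inner \<mu> (R f) g)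
        \<le> l2_norm \<mu> (\<lambda>x. T n f x - R f x) * l2_norm \<mu> g"
        unfolding l2_inner_diff_left[OF TL R[OF f] g, symmetric]
        by (rule l2_Cauchy_Schwarz[OF L2_diff[OF TL R[OF f]] g])
    qed
  qed
  have "represents \<phi> R"
    unfolding represents_def
  proof (intro conjI ballI)
    show "L2_operator \<mu> R"
    proof (rule L2_operatorI)
      fix f g assume f: "f \<in> L2 \<mu>" and g: "g \<in> L2 \<mu>"
      show "AE x in \<mu>. R f x = R g x" if "AE x in \<mu>. f x = g x"
      proof (rule l2_eq_AE_of_inner[OF R[OF f] R[OF g]])
        fix h assume h: "h \<in> L2 \<mu>"
        have "(\<lambda>n. l2_inner \<mu> (T n f) h) \<longlonglongrightarrow> l2_inner \<mu> (R g) h"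
          unfolding L2_operator_inner_cong[OF T' f g h that] by (rule inner_lim[OF g h])
        with inner_lim[OF f h] show "l2_inner \<mu> (R f) h = l2_inner \<mu> (R g) h"
          by (rule LIMSEQ_unique)
      qed
      show "AE x in \<mu>. R (\<lambda>x. a * f x + b * g x) x = a * R f x + b * R g x" for a b
      proof (rule l2_eq_AE_of_inner[OF R[OF L2_lincomb[OF f g]] L2_lincomb[OF R[OF f] R[OF g]]])
        fix h assume h: "h \<in> L2 \<mu>"
        have "(\<lambda>n. l2_inner \<mu> (T n (\<lambda>x. a * f x + b * g x)) h)
            \<longlonglongrightarrow> a * l2_inner \<mu> (R f) h + b * l2_inner \<mu> (R g) h"
          unfolding L2_operator_inner_lincomb[OF T' f g h]
          by (intro tendsto_intros inner_lim f g h)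
        with inner_lim[OF L2_lincomb[OF f g] h]
        have "l2_inner \<mu> (R (\<lambda>x. a * f x + b * g x)) h = a * l2_inner \<mu> (R f) h + b * l2_inner \<mu> (R g) h"
          by (rule LIMSEQ_unique)
        then show "l2_inner \<mu> (R (\<lambda>x. a * f x + b * g x)) h = l2_inner \<mu> (\<lambda>x. a * R f x + b * R g x) h"
          by (simp only: l2_inner_lincomb_left[OF R[OF f] R[OF g] h])
      qed
    qed (rule R)
    fix f assume f: "f \<in> L2 \<mu>"
    interpret finite_measure "\<nu> f" using f by (rule finite_measure_\<nu>)
    have "(\<lambda>n. \<integral>u. s n u \<partial>\<nu> f) \<longlonglongrightarrow> (\<integral>u. \<phi> u \<partial>\<nu> f)"
    proof (rule LIM_zero_cancel, rule Lim_null_comparison)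
      show "(\<lambda>n. (l2_norm \<mu> f)\<^sup>2 * (1/2) ^ n) \<longlonglongrightarrow> 0"
        by (rule tendsto_mult_right_zero) (simp add: LIMSEQ_power_zero)
      show "eventually (\<lambda>n. norm ((\<integral>u. s n u \<partial>\<nu> f) - (\<integral>u. \<phi> u \<partial>\<nu> f)) \<le> (l2_norm \<mu> f)\<^sup>2 * (1/2) ^ n) sequentially"
      proof (intro always_eventually allI)
        fix n
        note i = bounded_symbol_integrable[OF s f, of n] bounded_symbol_integrable[OF \<phi> f]
        have "norm ((\<integral>u. s n u \<partial>\<nu> f) - (\<integral>u. \<phi> u \<partial>\<nu> f)) = norm (\<integral>u. s n u - \<phi> u \<partial>\<nu> f)"
          using i by simp
        also have "\<dots> \<le> (\<integral>u. norm (s n u - \<phi> u) \<partial>\<nu> f)" by (rule integral_norm_bound)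
        also have "\<dots> \<le> (\<integral>u. (1/2) ^ n \<partial>\<nu> f)"
          using i close[of _ n] by (intro integral_mono) (auto simp: norm_minus_commute)
        finally show "norm ((\<integral>u. s n u \<partial>\<nu> f) - (\<integral>u. \<phi> u \<partial>\<nu> f)) \<le> (l2_norm \<mu> f)\<^sup>2 * (1/2) ^ n"
          by (simp add: measure_\<nu>_space[OF f])
      qed
    qed
    then have "(\<lambda>n. l2_inner \<mu> (T n f) f) \<longlonglongrightarrow> (\<integral>u. \<phi> u \<partial>\<nu> f)"
      by (simp only: represents_diag[OF T f])
    with inner_lim[OF f f] show "l2_inner \<mu> (R f) f = (\<integral>u. \<phi> u \<partial>\<nu> f)" by (rule LIMSEQ_unique)
  qed
  then show ?thesis by blast
qed

lemma represents_spectral_integral: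
  assumes \<phi>: "bounded_symbol \<phi>"
  shows "represents \<phi> (spectral_integral \<mu> E \<phi>)"
proof -
  from \<phi> obtain b where b: "\<And>u. u \<ge> 0 \<Longrightarrow> cmod (\<phi> u) \<le> b"
    and [measurable]: "\<phi> \<in> borel_measurable half_line"
    by (auto simp: bounded_symbol_def)
  have "(\<integral>\<^sup>+u. ennreal ((cmod (\<phi> u))\<^sup>2) \<partial>\<nu> f) < \<infinity>" if f: "f \<in> L2 \<mu>" for f
  proof -
    have "(\<integral>\<^sup>+u. ennreal ((cmod (\<phi> u))\<^sup>2) \<partial>\<nu> f) \<le> (\<integral>\<^sup>+u. ennreal (b\<^sup>2) \<partial>\<nu> f)"
      using b by (intro nn_integral_mono ennreal_leI power_mono) auto
    also have "\<dots> = ennreal (b\<^sup>2 * (l2_norm \<mu> f)\<^sup>2)"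
      by (simp add: emeasure_\<nu>_space[OF f] ennreal_mult')
    also have "\<dots> < \<infinity>" by simp
    finally show ?thesis .
  qed
  then have "spectral_domain \<mu> E \<phi> = L2 \<mu>" by (auto simp: spectral_domain_def)
  then have "has_spectral_integral \<mu> E \<phi> T \<longleftrightarrow> represents \<phi> T" for T
    by (simp add: has_spectral_integral_def represents_def)
  then show ?thesis
    using represents_exists[OF \<phi>] unfolding spectral_integral_def by (metis someI_ex)
qed

end

section \<open>Exponentially decaying weights on a doubling space\<close>

text \<open>The constant that results from summing \<open>exp (- \<eta> \<rho>/r)\<close> over dyadic annuli against powers of the
  doubling constant. The factor \<open>exp \<eta>\<close> makes the term \<open>n = 0\<close> majorize the ball of radius \<open>r\<close>
  itself, on which the exponential can be as large as \<open>1\<close>.\<close>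

definition dyadic_exp_sum :: "real \<Rightarrow> real \<Rightarrow> real" where
  "dyadic_exp_sum K \<eta> = (\<Sum>n. K ^ (2 * n + 1) * (exp \<eta> * exp (- \<eta> * 2 ^ n / 2)))"

lemma summable_dyadic_exp:
  assumes K: "1 \<le> K" and \<eta>: "0 < (\<eta>::real)"
  shows "summable (\<lambda>n. K ^ (2 * n + 1) * (exp \<eta> * exp (- \<eta> * 2 ^ n / 2)))"
proof -
  have "(\<lambda>n. K\<^sup>2 * exp (- \<eta> / 2) ^ n) \<longlonglongrightarrow> 0"
    using \<eta> by (intro tendsto_mult_right_zero LIMSEQ_power_zero) simp
  then have "eventually (\<lambda>n. K\<^sup>2 * exp (- \<eta> / 2) ^ n < 1/2) sequentially"
    by (rule order_tendstoD) simp
  then obtain N where N: "\<And>n. n \<ge> N \<Longrightarrow> K\<^sup>2 * exp (- \<eta> / 2) ^ n < 1/2"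
    by (auto simp: eventually_sequentially)
  show ?thesis
  proof (rule summable_ratio_test[of "1/2" N])
    fix n assume "N \<le> n"
    let ?t = "\<lambda>n. K ^ (2 * n + 1) * (exp \<eta> * exp (- \<eta> * 2 ^ n / 2))"
    have "real n \<le> 2 ^ n" using of_nat_less_two_power[of n, where 'a = real] by linarith
    then have "exp (- \<eta> * 2 ^ n / 2) \<le> exp (- \<eta> / 2) ^ n"
      using \<eta> by (simp flip: exp_of_nat_mult add: mult.commute)
    then have "K\<^sup>2 * exp (- \<eta> * 2 ^ n / 2) \<le> 1/2"
      using N[OF \<open>N \<le> n\<close>] mult_left_mono[of "exp (- \<eta> * 2 ^ n / 2)" "exp (- \<eta> / 2) ^ n" "K\<^sup>2"] by auto
    then have "(K\<^sup>2 * exp (- \<eta> * 2 ^ n / 2)) * ?t n \<le> 1/2 * ?t n"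
      using K by (intro mult_right_mono) auto
    also have "(K\<^sup>2 * exp (- \<eta> * 2 ^ n / 2)) * ?t n = ?t (Suc n)"
    proof -
      have "exp (- \<eta> * 2 ^ Suc n / 2) = exp (- \<eta> * 2 ^ n / 2) * exp (- \<eta> * 2 ^ n / 2)"
        by (simp flip: exp_add)
      then show ?thesis by (simp only: power2_eq_square) (simp add: mult_ac)
    qed
    finally show "norm (?t (Suc n)) \<le> 1/2 * norm (?t n)" using K by simp
  qed simp
qed

lemma dyadic_exp_sum_pos:
  assumes K: "1 \<le> K" and \<eta>: "0 < (\<eta>::real)"
  shows "0 < dyadic_exp_sum K \<eta>"
  unfolding dyadic_exp_sum_def
  by (rule suminf_pos[OF summable_dyadic_exp[OF assms]]) (use K in auto)

locale doubling_measure =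
  fixes \<mu> :: "'a::metric_space measure" and K :: real
  assumes sets_eq_borel [measurable_cong]: "sets \<mu> = sets borel"
    and K_ge_1: "1 \<le> K"
    and finite_ball: "emeasure \<mu> (ball x r) < \<infinity>"
    and ball_pos: "0 < r \<Longrightarrow> 0 < measure \<mu> (ball x r)"
    and doubling: "0 < r \<Longrightarrow> measure \<mu> (ball x (2 * r)) \<le> K * measure \<mu> (ball x r)"
begin

lemma space_eq_UNIV [simp]: "space \<mu> = UNIV"
  using sets_eq_imp_space_eq[OF sets_eq_borel] by simp

lemma ball_sets [measurable]: "ball x r \<in> sets \<mu>"
  by (simp add: sets_eq_borel)

lemma emeasure_ball: "emeasure \<mu> (ball x r) = ennreal (measure \<mu> (ball x r))"
  using finite_ball[of x r] by (simp add: emeasure_eq_ennreal_measure less_top)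

lemma measure_ball_mono: "ball x r \<subseteq> ball y s \<Longrightarrow> measure \<mu> (ball x r) \<le> measure \<mu> (ball y s)"
  using finite_ball[of y s] by (intro measure_mono_fmeasurable) (auto simp: fmeasurable_def)

lemma doubling_power: "0 < r \<Longrightarrow> measure \<mu> (ball x (2 ^ n * r)) \<le> K ^ n * measure \<mu> (ball x r)"
proof (induction n)
  case (Suc n)
  have "measure \<mu> (ball x (2 ^ Suc n * r)) \<le> K * measure \<mu> (ball x (2 ^ n * r))"
    using doubling[of "2 ^ n * r" x] Suc.prems by (simp add: mult.assoc)
  also have "\<dots> \<le> K * (K ^ n * measure \<mu> (ball x r))"
    using Suc K_ge_1 by (intro mult_left_mono) auto
  finally show ?case by (simp add: mult_ac)
qed simp

lemma ball_comparison:
  assumes r: "0 < r" and d: "dist x z < 2 ^ n * r"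
  shows "1 / measure \<mu> (ball z r) \<le> K ^ (n + 1) / measure \<mu> (ball x r)"
proof -
  have "ball x r \<subseteq> ball z (2 ^ (n + 1) * r)"
  proof
    fix w assume "w \<in> ball x r"
    then have "dist z w < 2 ^ n * r + r" using d dist_triangle[of z w x] by (simp add: dist_commute)
    moreover have "r \<le> 2 ^ n * r" using r by simp
    ultimately show "w \<in> ball z (2 ^ (n + 1) * r)" by (simp add: algebra_simps)
  qed
  then have "measure \<mu> (ball x r) \<le> K ^ (n + 1) * measure \<mu> (ball z r)"
    using doubling_power[OF r, of z "n + 1"] measure_ball_mono order_trans by blast
  then show ?thesis using ball_pos[OF r, of x] ball_pos[OF r, of z] by (simp add: field_simps)
qed

lemma sigma_finite_doubling: "sigma_finite_measure \<mu>"
proof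
  have "range (\<lambda>n::nat. ball undefined (real n)) \<subseteq> sets \<mu>" by auto
  moreover have "(\<Union>n::nat. ball undefined (real n)) = space \<mu>"
    using reals_Archimedean2 by (auto simp: mem_ball)
  moreover have "\<forall>a\<in>range (\<lambda>n::nat. ball undefined (real n)). emeasure \<mu> a \<noteq> \<infinity>"
    using finite_ball by (auto simp: less_top)
  ultimately show "\<exists>A. countable A \<and> A \<subseteq> sets \<mu> \<and> \<Union> A = space \<mu> \<and> (\<forall>a\<in>A. emeasure \<mu> a \<noteq> \<infinity>)"
    by (intro exI[of _ "range (\<lambda>n::nat. ball undefined (real n))"]) auto
qed

text \<open>On the dyadic annulus where \<open>\<rho>(x,z)\<close> is about \<open>2\<^sup>n r\<close>, the volumes of \<open>B(z,r)\<close> and of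
  \<open>B(x,2\<^sup>n r)\<close> differ from that of \<open>B(x,r)\<close> by powers of the doubling constant, which the
  exponential absorbs. The hypothesis on \<open>g\<close> is shaped so as to cover multiples of \<open>1/|B(z,r)|\<close>,
  of \<open>1/|B(x,r)|\<close>, and of their sum.\<close>

lemma nn_integral_exp_weight:
  assumes r: "0 < r" and \<eta>: "0 < \<eta>" and c: "0 \<le> c"
    and g: "\<And>z n. dist x z < 2 ^ n * r \<Longrightarrow> g z \<le> c * (K ^ (n + 1) / measure \<mu> (ball x r))"
  shows "(\<integral>\<^sup>+z. ennreal (exp (- \<eta> * (dist x z / r)) * g z) \<partial>\<mu>) \<le> ennreal (c * dyadic_exp_sum K \<eta>)"
proof -
  let ?V = "measure \<mu> (ball x r)"
  define a where "a n = exp \<eta> * exp (- \<eta> * 2 ^ n / 2)" for n :: nat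
  have a: "a n \<ge> 0" for n by (simp add: a_def)
  note V = ball_pos[OF r, of x]
  have coeff: "0 \<le> c * (K ^ (n + 1) / ?V) * a n" for n
    using c K_ge_1 V a by simp
  have "(\<integral>\<^sup>+z. ennreal (exp (- \<eta> * (dist x z / r)) * g z) \<partial>\<mu>)
      \<le> (\<integral>\<^sup>+z. (\<Sum>n. ennreal (c * (K ^ (n + 1) / ?V) * a n) * indicator (ball x (2 ^ n * r)) z) \<partial>\<mu>)"
  proof (rule nn_integral_mono)
    fix z
    define n where "n = (LEAST n. dist x z < 2 ^ n * r)"
    have "\<exists>n. dist x z < 2 ^ n * r"
    proof -
      obtain n where "dist x z / r < 2 ^ n" using real_arch_pow[of 2 "dist x z / r"] by auto
      then show ?thesis using r by (auto simp: field_simps)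
    qed
    then have n: "dist x z < 2 ^ n * r" unfolding n_def by (rule LeastI_ex)
    have "exp (- \<eta> * (dist x z / r)) \<le> a n"
    proof (cases n)
      case 0
      have "exp (- \<eta> * (dist x z / r)) \<le> 1" using \<eta> r by simp
      also have "1 \<le> a n" using \<eta> 0 by (simp add: a_def flip: exp_add)
      finally show ?thesis .
    next
      case (Suc m)
      then have "\<not> dist x z < 2 ^ m * r" 
        using not_less_Least[of m "\<lambda>n. dist x z < 2 ^ n * r"] by (simp add: n_def)
      then have "2 ^ n / 2 \<le> dist x z / r" using Suc r by (simp add: field_simps)
      from mult_left_mono[OF this, of \<eta>]
      have "exp (- \<eta> * (dist x z / r)) \<le> exp (- \<eta> * 2 ^ n / 2)" using \<eta> by simp
      also have "\<dots> \<le> a n" using \<eta> by (simp add: a_def)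
      finally show ?thesis .
    qed
    then have "exp (- \<eta> * (dist x z / r)) * (c * (K ^ (n + 1) / ?V)) \<le> a n * (c * (K ^ (n + 1) / ?V))"
      using c K_ge_1 V by (intro mult_right_mono) auto
    moreover have "exp (- \<eta> * (dist x z / r)) * g z \<le> exp (- \<eta> * (dist x z / r)) * (c * (K ^ (n + 1) / ?V))"
      by (intro mult_left_mono g[OF n]) simp
    ultimately have "exp (- \<eta> * (dist x z / r)) * g z \<le> a n * (c * (K ^ (n + 1) / ?V))"
      by linarith
    then have "ennreal (exp (- \<eta> * (dist x z / r)) * g z)
        \<le> ennreal (c * (K ^ (n + 1) / ?V) * a n) * indicator (ball x (2 ^ n * r)) z"
      using n by (simp add: mult.commute ennreal_leI)
    also have "\<dots> \<le> (\<Sum>n. ennreal (c * (K ^ (n + 1) / ?V) * a n) * indicator (ball x (2 ^ n * r)) z)"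
      (is "?f n \<le> _")
    proof -
      have "sum F {n} = F n" for F :: "nat \<Rightarrow> ennreal" by simp
      then show ?thesis using sum_le_suminf[of ?f "{n}"] by (simp only: summableI finite.intros zero_le simp_thms)
    qed
    finally show "ennreal (exp (- \<eta> * (dist x z / r)) * g z)
        \<le> (\<Sum>n. ennreal (c * (K ^ (n + 1) / ?V) * a n) * indicator (ball x (2 ^ n * r)) z)" .
  qed
  also have "\<dots> = (\<Sum>n. ennreal (c * (K ^ (n + 1) / ?V) * a n) * emeasure \<mu> (ball x (2 ^ n * r)))"
    by (subst nn_integral_suminf) (auto simp: nn_integral_cmult_indicator)
  also have "\<dots> \<le> (\<Sum>n. ennreal (c * (K ^ (2 * n + 1) * a n)))"
  proof (intro suminf_le summableI)
    fix n
    have "c * (K ^ (n + 1) / ?V) * a n * measure \<mu> (ball x (2 ^ n * r))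
        \<le> c * (K ^ (n + 1) / ?V) * a n * (K ^ n * ?V)"
      by (intro mult_left_mono doubling_power r coeff)
    also have "\<dots> = c * (K ^ (n + 1) * K ^ n * a n)"
      using V by (simp add: field_simps)
    also have "K ^ (n + 1) * K ^ n = K ^ (2 * n + 1)" by (simp flip: power_add add: mult_2)
    finally show "ennreal (c * (K ^ (n + 1) / ?V) * a n) * emeasure \<mu> (ball x (2 ^ n * r))
        \<le> ennreal (c * (K ^ (2 * n + 1) * a n))"
      unfolding emeasure_ball ennreal_mult''[OF measure_nonneg, symmetric] by (rule ennreal_leI)
  qed
  also have "\<dots> = ennreal (\<Sum>n. c * (K ^ (2 * n + 1) * a n))"
    using summable_dyadic_exp[OF K_ge_1 \<eta>] c K_ge_1 a
    by (intro suminf_ennreal2 summable_mult) (auto simp: a_def)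
  also have "(\<Sum>n. c * (K ^ (2 * n + 1) * a n)) = c * dyadic_exp_sum K \<eta>"
    using suminf_mult[OF summable_dyadic_exp[OF K_ge_1 \<eta>], of c]
    by (simp add: a_def dyadic_exp_sum_def)
  finally show ?thesis .
qed

end

section \<open>Self-adjoint operators with an exponentially localized kernel\<close>

text \<open>This abstracts the heat operator at time \<open>r powr \<beta>\<^sub>0\<close>, seen at its own length scale \<open>r\<close>: \<open>a u\<close> stands for
  \<open>exp (- r powr \<beta>\<^sub>0 * u)\<close>, and the kernel decays exponentially in \<open>\<rho>/r\<close>. The numbers \<open>\<eta>\<close>, \<open>N\<close> and
  \<open>K\<close> will be the same for all \<open>r\<close>, so that bounds in terms of them are uniform in the scale.\<close>

locale localized_kernel = doubling_measure \<mu> K + spectral_family \<mu> E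
  for \<mu> :: "'a::metric_space measure" and K :: real and E +
  fixes a :: "real \<Rightarrow> real" and A :: "('a \<Rightarrow> complex) \<Rightarrow> ('a \<Rightarrow> complex)"
    and p :: "'a \<Rightarrow> 'a \<Rightarrow> complex" and r \<eta> N \<alpha> :: real
  assumes r_pos: "0 < r" and \<eta>_pos: "0 < \<eta>" and N_pos: "0 < N" and \<alpha>_pos: "0 < \<alpha>"
    and a_borel: "a \<in> borel_measurable half_line"
    and a_range: "\<And>u. 0 \<le> u \<Longrightarrow> 0 \<le> a u \<and> a u \<le> 1"
    and A_represents: "represents (\<lambda>u. of_real (a u)) A"
    and kernel: "has_kernel \<mu> A p"
    and kernel_bound: "\<And>x y. cmod (p x y) \<le>
      N * exp (- 2 * \<eta> * (dist x y / r)) / sqrt (measure \<mu> (ball x r) * measure \<mu> (ball y r))"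
    and kernel_holder: "\<And>x y y'. dist y y' \<le> r \<Longrightarrow> cmod (p x y - p x y') \<le>
      (dist y y' / r) powr \<alpha> *
      (N * exp (- 2 * \<eta> * (dist x y / r)) / sqrt (measure \<mu> (ball x r) * measure \<mu> (ball y r)))"
begin

abbreviation V :: "'a \<Rightarrow> real" where "V x \<equiv> measure \<mu> (ball x r)"

definition weight :: "'a \<Rightarrow> 'a \<Rightarrow> real" where
  "weight x y = exp (- \<eta> * (dist x y / r)) / sqrt (V x * V y)"

abbreviation M :: real where "M \<equiv> dyadic_exp_sum K \<eta>"

text \<open>The kernel as a function of its first variable, with the pole \<open>y\<close> fixed. This is a vector in
  \<open>L\<^sup>2\<close>, and the Hoelder estimate in the second variable says that it depends continuously on \<open>y\<close>.\<close>

definition column :: "'a \<Rightarrow> 'a \<Rightarrow> complex" where "column y z = p z y"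

lemma V_pos: "0 < V x"
  using r_pos by (rule ball_pos)

lemma M_pos: "0 < M"
  using K_ge_1 \<eta>_pos by (rule dyadic_exp_sum_pos)

lemma weight_nonneg: "0 \<le> weight x y"
  using V_pos by (simp add: weight_def)

lemma weight_commute: "weight x y = weight y x"
  by (simp add: weight_def dist_commute mult.commute)

sublocale sigma_finite_measure \<mu>
  by (rule sigma_finite_doubling)

sublocale pair_sigma_finite \<mu> \<mu>
  by unfold_locales

lemma p_measurable [measurable]: "(\<lambda>(x, y). p x y) \<in> borel_measurable (\<mu> \<Otimes>\<^sub>M \<mu>)"
  using kernel by (simp add: has_kernel_def)

lemma p_measurable' [measurable (raw)]:
  "f \<in> measurable L \<mu> \<Longrightarrow> g \<in> measurable L \<mu> \<Longrightarrow> (\<lambda>w. p (f w) (g w)) \<in> borel_measurable L"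
  using measurable_compose[OF measurable_Pair p_measurable, of f L g] by simp

lemma column_measurable [measurable]: "column y \<in> borel_measurable \<mu>"
  unfolding column_def by measurable

lemma A_kernel: "f \<in> L2 \<mu> \<Longrightarrow> AE x in \<mu>. integrable \<mu> (\<lambda>y. p x y * f y) \<and> A f x = (\<integral>y. p x y * f y \<partial>\<mu>)"
  using kernel by (simp add: has_kernel_def)

lemma kernel_bound_weight:
  "cmod (p x y) \<le> N * (exp (- \<eta> * (dist x y / r)) * weight x y)"
proof -
  have "exp (- 2 * \<eta> * (dist x y / r)) = exp (- \<eta> * (dist x y / r)) * exp (- \<eta> * (dist x y / r))"
    by (simp flip: exp_add)
  then show ?thesis using kernel_bound[of x y] by (simp add: weight_def)
qed

text \<open>The triangle inequality for \<open>\<rho>\<close> makes the weights submultiplicative up to the volume factor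
  \<open>1/V z\<close>.\<close>

lemma weight_triangle: "exp (- \<eta> * (dist x z / r)) * weight x z * weight z y \<le> exp (- \<eta> * (dist x z / r)) * (weight x y / V z)"
proof -
  have "dist x y / r \<le> dist x z / r + dist z y / r"
    using dist_triangle[of x y z] r_pos by (simp add: field_simps)
  then have "\<eta> * (dist x y / r) \<le> \<eta> * (dist x z / r + dist z y / r)"
    using \<eta>_pos by (intro mult_left_mono) auto
  then have "exp (- \<eta> * (dist x z / r)) * exp (- \<eta> * (dist z y / r)) \<le> exp (- \<eta> * (dist x y / r))"
    by (simp flip: exp_add add: distrib_left)
  moreover have "sqrt (V x * V z) * sqrt (V z * V y) = sqrt (V x * V y) * V z"
    using V_pos[of z] by (simp add: real_sqrt_mult)
  ultimately have "weight x z * weight z y \<le> weight x y / V z"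
    using V_pos unfolding weight_def times_divide_times_eq
    by (simp add: divide_right_mono)
  then show ?thesis unfolding mult.assoc by (intro mult_left_mono) auto
qed

text \<open>Half of the exponential decay of the kernel pays for the integral, the other half is kept.\<close>

lemma nn_integral_kernel_weight:
  assumes q: "\<And>w. cmod (q w) \<le> c * weight w y" and c: "0 \<le> c"
    and k: "\<And>w. cmod (k w) \<le> N * (exp (- \<eta> * (dist z w / r)) * weight z w)"
  shows "(\<integral>\<^sup>+w. ennreal (cmod (k w) * cmod (q w)) \<partial>\<mu>) \<le> ennreal (N * M * c * weight z y)"
proof -
  have "(\<integral>\<^sup>+w. ennreal (cmod (k w) * cmod (q w)) \<partial>\<mu>)
      \<le> (\<integral>\<^sup>+w. ennreal (exp (- \<eta> * (dist z w / r)) * (N * c * weight z y / V w)) \<partial>\<mu>)"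
  proof (intro nn_integral_mono ennreal_leI)
    fix w
    have "cmod (k w) * cmod (q w) \<le> (N * (exp (- \<eta> * (dist z w / r)) * weight z w)) * (c * weight w y)"
      using N_pos weight_nonneg by (intro mult_mono k q) auto
    also have "\<dots> = (N * c) * (exp (- \<eta> * (dist z w / r)) * weight z w * weight w y)" by simp
    also have "\<dots> \<le> (N * c) * (exp (- \<eta> * (dist z w / r)) * (weight z y / V w))"
      using N_pos c by (intro mult_left_mono weight_triangle) simp
    finally show "cmod (k w) * cmod (q w) \<le> exp (- \<eta> * (dist z w / r)) * (N * c * weight z y / V w)"
      by (simp add: mult_ac)
  qed
  also have "\<dots> \<le> ennreal ((N * c * weight z y) * M)"
  proof (rule nn_integral_exp_weight[OF r_pos \<eta>_pos])
    show "0 \<le> N * c * weight z y" using N_pos c weight_nonneg by simp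
    fix w n assume "dist z w < 2 ^ n * r"
    from mult_left_mono[OF ball_comparison[OF r_pos this] \<open>0 \<le> N * c * weight z y\<close>]
    show "N * c * weight z y / V w \<le> N * c * weight z y * (K ^ (n + 1) / V z)" by simp
  qed
  finally show ?thesis by (simp add: mult_ac)
qed

lemma weight_square_bound: "(N * (exp (- \<eta> * (dist z y / r)) * weight z y))\<^sup>2
    \<le> exp (- \<eta> * (dist y z / r)) * (N\<^sup>2 / V y / V z)"
proof -
  let ?e = "exp (- \<eta> * (dist y z / r))"
  have e: "?e \<le> 1" using \<eta>_pos r_pos by simp
  have "(N * (exp (- \<eta> * (dist z y / r)) * weight z y))\<^sup>2 = ?e ^ 4 * (N\<^sup>2 / V y / V z)"
    using V_pos[of y] V_pos[of z]
    by (simp add: weight_def power_mult_distrib power_divide dist_commute power4_eq_xxxx power2_eq_square mult_ac)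
  also have "?e ^ 4 \<le> ?e ^ 1" by (rule power_decreasing) (use e in auto)
  then have "?e ^ 4 * (N\<^sup>2 / V y / V z) \<le> ?e * (N\<^sup>2 / V y / V z)"
    using V_pos[of y] V_pos[of z] by (intro mult_right_mono) auto
  finally show ?thesis .
qed

lemma L2_of_kernel_bound:
  assumes [measurable]: "f \<in> borel_measurable \<mu>" and c: "0 \<le> c"
    and f: "\<And>z. cmod (f z) \<le> c * (N * (exp (- \<eta> * (dist z y / r)) * weight z y))"
  shows "f \<in> L2 \<mu>" "l2_norm \<mu> f \<le> c * (N * sqrt (M / V y))"
proof -
  have nonneg: "0 \<le> c\<^sup>2 * N\<^sup>2 / V y" using V_pos[of y] by simp
  have "(\<integral>\<^sup>+z. ennreal ((cmod (f z))\<^sup>2) \<partial>\<mu>)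
      \<le> (\<integral>\<^sup>+z. ennreal (exp (- \<eta> * (dist y z / r)) * (c\<^sup>2 * N\<^sup>2 / V y / V z)) \<partial>\<mu>)"
  proof (intro nn_integral_mono ennreal_leI)
    fix z
    have "(cmod (f z))\<^sup>2 \<le> (c * (N * (exp (- \<eta> * (dist z y / r)) * weight z y)))\<^sup>2"
      by (intro power_mono f) simp
    also have "\<dots> = c\<^sup>2 * (N * (exp (- \<eta> * (dist z y / r)) * weight z y))\<^sup>2"
      by (rule power_mult_distrib)
    also have "\<dots> \<le> c\<^sup>2 * (exp (- \<eta> * (dist y z / r)) * (N\<^sup>2 / V y / V z))"
      by (intro mult_left_mono weight_square_bound) simp
    finally show "(cmod (f z))\<^sup>2 \<le> exp (- \<eta> * (dist y z / r)) * (c\<^sup>2 * N\<^sup>2 / V y / V z)"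
      by (simp add: mult_ac)
  qed
  also have "\<dots> \<le> ennreal ((c\<^sup>2 * N\<^sup>2 / V y) * M)"
  proof (rule nn_integral_exp_weight[OF r_pos \<eta>_pos nonneg])
    fix z n assume "dist y z < 2 ^ n * r"
    from mult_left_mono[OF ball_comparison[OF r_pos this] nonneg]
    show "c\<^sup>2 * N\<^sup>2 / V y / V z \<le> c\<^sup>2 * N\<^sup>2 / V y * (K ^ (n + 1) / V y)" by simp
  qed
  also have "(c\<^sup>2 * N\<^sup>2 / V y) * M = (c * (N * sqrt (M / V y)))\<^sup>2"
    using V_pos[of y] M_pos by (simp add: power_mult_distrib)
  finally have le: "(\<integral>\<^sup>+z. ennreal ((cmod (f z))\<^sup>2) \<partial>\<mu>) \<le> ennreal ((c * (N * sqrt (M / V y)))\<^sup>2)" .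
  have "0 \<le> c * (N * sqrt (M / V y))" using c N_pos M_pos V_pos[of y] by simp
  from L2_of_nn_integral[OF assms(1) le this]
  show "f \<in> L2 \<mu>" "l2_norm \<mu> f \<le> c * (N * sqrt (M / V y))" by auto
qed

lemma column_L2: "column y \<in> L2 \<mu>" and column_norm: "l2_norm \<mu> (column y) \<le> N * sqrt (M / V y)"
  using L2_of_kernel_bound[of "column y" 1 y] kernel_bound_weight by (auto simp: column_def)

lemma column_diff_norm:
  assumes "dist y y' \<le> r"
  shows "l2_norm \<mu> (\<lambda>z. column y z - column y' z) \<le> (dist y y' / r) powr \<alpha> * (N * sqrt (M / V y))"
proof (rule L2_of_kernel_bound(2))
  fix z
  have "exp (- 2 * \<eta> * (dist z y / r)) = exp (- \<eta> * (dist z y / r)) * exp (- \<eta> * (dist z y / r))"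
    by (simp flip: exp_add)
  then show "cmod (column y z - column y' z) \<le> (dist y y' / r) powr \<alpha> * (N * (exp (- \<eta> * (dist z y / r)) * weight z y))"
    using kernel_holder[OF assms, of z] by (simp add: column_def weight_def)
qed auto

lemma column_continuous: "((\<lambda>y'. l2_norm \<mu> (\<lambda>z. column y' z - column y z)) \<longlongrightarrow> 0) (at y)"
proof (rule Lim_null_comparison)
  have "((\<lambda>y'. (dist y y' / r) powr \<alpha> * (N * sqrt (M / V y))) \<longlongrightarrow> (dist y y / r) powr \<alpha> * (N * sqrt (M / V y))) (at y)"
    using \<alpha>_pos r_pos
    by (intro tendsto_intros) auto
  then show "((\<lambda>y'. (dist y y' / r) powr \<alpha> * (N * sqrt (M / V y))) \<longlongrightarrow> 0) (at y)" by simp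
  show "eventually (\<lambda>y'. norm (l2_norm \<mu> (\<lambda>z. column y' z - column y z)) \<le> (dist y y' / r) powr \<alpha> * (N * sqrt (M / V y))) (at y)"
    unfolding eventually_at
  proof (intro exI[of _ r] conjI r_pos ballI impI)
    fix y' assume "y' \<noteq> y \<and> dist y' y < r"
    then show "norm (l2_norm \<mu> (\<lambda>z. column y' z - column y z)) \<le> (dist y y' / r) powr \<alpha> * (N * sqrt (M / V y))"
      using column_diff_norm[of y y'] by (subst l2_norm_minus_commute) (simp add: dist_commute)
  qed
qed

lemma nn_integral_kernel:
  assumes k: "\<And>w. cmod (k w) \<le> N * (exp (- \<eta> * (dist z w / r)) * weight z w)"
  shows "(\<integral>\<^sup>+w. ennreal (cmod (k w)) \<partial>\<mu>) \<le> ennreal (2 * N * M)"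
proof -
  have weight: "weight z w \<le> 1 / V z + 1 / V w" for w
  proof -
    have "weight z w \<le> 1 / sqrt (V z * V w)"
      unfolding weight_def using \<eta>_pos r_pos V_pos[of z] V_pos[of w] by (intro divide_right_mono) auto
    also have "\<dots> = sqrt (1 / V z * (1 / V w))" by (simp add: real_sqrt_divide)
    also have "\<dots> \<le> (1 / V z + 1 / V w) / 2"
      using V_pos[of z] V_pos[of w] by (intro arith_geo_mean_sqrt) auto
    also have "\<dots> \<le> 1 / V z + 1 / V w"
    proof -
      have "(s + t) / 2 \<le> s + t" if "0 \<le> s" "0 \<le> t" for s t :: real using that by simp
      then show ?thesis using V_pos[of z] V_pos[of w] by (auto simp only: zero_le_divide_1_iff less_imp_le)
    qed
    finally show ?thesis .
  qed
  have "(\<integral>\<^sup>+w. ennreal (cmod (k w)) \<partial>\<mu>)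
      \<le> (\<integral>\<^sup>+w. ennreal (exp (- \<eta> * (dist z w / r)) * (N * (1 / V z + 1 / V w))) \<partial>\<mu>)"
  proof (intro nn_integral_mono ennreal_leI)
    fix w
    have "N * (exp (- \<eta> * (dist z w / r)) * weight z w)
        \<le> N * (exp (- \<eta> * (dist z w / r)) * (1 / V z + 1 / V w))"
      using N_pos by (intro mult_left_mono weight) auto
    with k[of w] show "cmod (k w) \<le> exp (- \<eta> * (dist z w / r)) * (N * (1 / V z + 1 / V w))"
      by (simp add: mult_ac)
  qed
  also have "\<dots> \<le> ennreal (2 * N * M)"
  proof (rule nn_integral_exp_weight[OF r_pos \<eta>_pos])
    show "0 \<le> 2 * N" using N_pos by simp
    fix w n assume "dist z w < 2 ^ n * r"
    then have "1 / V w \<le> K ^ (n + 1) / V z" by (rule ball_comparison[OF r_pos])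
    moreover have "1 / V z \<le> K ^ (n + 1) / V z"
      using V_pos[of z] K_ge_1 by (intro divide_right_mono one_le_power) auto
    ultimately have "N * (1 / V z + 1 / V w) \<le> N * (K ^ (n + 1) / V z + K ^ (n + 1) / V z)"
      using N_pos by (intro mult_left_mono add_mono) auto
    then show "N * (1 / V z + 1 / V w) \<le> 2 * N * (K ^ (n + 1) / V z)" by (simp add: mult_ac)
  qed
  finally show ?thesis .
qed

text \<open>Schur's test: the kernel is integrable in each variable uniformly in the other, and
  \<open>|f| |h| \<le> |f|\<^sup>2 + |h|\<^sup>2\<close>.\<close>

lemma kernel_pair_integrable:
  assumes f: "f \<in> L2 \<mu>" and h: "h \<in> L2 \<mu>"
  shows "integrable (\<mu> \<Otimes>\<^sub>M \<mu>) (\<lambda>(z, y). p z y * f y * cnj (h z))"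
proof (rule integrableI_bounded)
  have [measurable]: "f \<in> borel_measurable \<mu>" "h \<in> borel_measurable \<mu>" using f h L2_borel by auto
  show "(\<lambda>(z, y). p z y * f y * cnj (h z)) \<in> borel_measurable (\<mu> \<Otimes>\<^sub>M \<mu>)" by measurable
  let ?F = "\<lambda>(z, y). ennreal (cmod (p z y)) * ennreal ((cmod (f y))\<^sup>2)"
  let ?H = "\<lambda>(z, y). ennreal ((cmod (h z))\<^sup>2) * ennreal (cmod (p z y))"
  have "(\<integral>\<^sup>+w. ?F w \<partial>(\<mu> \<Otimes>\<^sub>M \<mu>))
      = (\<integral>\<^sup>+y. (\<integral>\<^sup>+z. ennreal (cmod (p z y)) * ennreal ((cmod (f y))\<^sup>2) \<partial>\<mu>) \<partial>\<mu>)"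
    by (subst nn_integral_snd[symmetric]) auto
  also have "\<dots> \<le> (\<integral>\<^sup>+y. ennreal (2 * N * M) * ennreal ((cmod (f y))\<^sup>2) \<partial>\<mu>)"
  proof (rule nn_integral_mono)
    fix y
    have "(\<integral>\<^sup>+z. ennreal (cmod (p z y)) \<partial>\<mu>) \<le> ennreal (2 * N * M)"
      using kernel_bound_weight[of _ y] by (intro nn_integral_kernel) (simp add: dist_commute weight_commute)
    then show "(\<integral>\<^sup>+z. ennreal (cmod (p z y)) * ennreal ((cmod (f y))\<^sup>2) \<partial>\<mu>)
        \<le> ennreal (2 * N * M) * ennreal ((cmod (f y))\<^sup>2)"
      by (simp add: nn_integral_multc mult_right_mono)
  qed
  also have "\<dots> = ennreal (2 * N * M) * ennreal ((l2_norm \<mu> f)\<^sup>2)"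
    by (simp add: nn_integral_cmult nn_integral_cmod_square[OF f])
  finally have F: "(\<integral>\<^sup>+w. ?F w \<partial>(\<mu> \<Otimes>\<^sub>M \<mu>)) \<le> ennreal (2 * N * M) * ennreal ((l2_norm \<mu> f)\<^sup>2)" .
  have "(\<integral>\<^sup>+w. ?H w \<partial>(\<mu> \<Otimes>\<^sub>M \<mu>))
      = (\<integral>\<^sup>+z. (\<integral>\<^sup>+y. ennreal ((cmod (h z))\<^sup>2) * ennreal (cmod (p z y)) \<partial>\<mu>) \<partial>\<mu>)"
  proof -
    have "?H \<in> borel_measurable (\<mu> \<Otimes>\<^sub>M \<mu>)" by measurable
    from sigma_finite_measure.nn_integral_fst[OF sigma_finite_doubling this] show ?thesis by simp
  qed
  also have "\<dots> \<le> (\<integral>\<^sup>+z. ennreal ((cmod (h z))\<^sup>2) * ennreal (2 * N * M) \<partial>\<mu>)"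
  proof (rule nn_integral_mono)
    fix z
    have "(\<integral>\<^sup>+y. ennreal (cmod (p z y)) \<partial>\<mu>) \<le> ennreal (2 * N * M)"
      using kernel_bound_weight[of z] by (intro nn_integral_kernel)
    then show "(\<integral>\<^sup>+y. ennreal ((cmod (h z))\<^sup>2) * ennreal (cmod (p z y)) \<partial>\<mu>)
        \<le> ennreal ((cmod (h z))\<^sup>2) * ennreal (2 * N * M)"
      by (simp add: nn_integral_cmult mult_left_mono)
  qed
  also have "\<dots> = ennreal ((l2_norm \<mu> h)\<^sup>2) * ennreal (2 * N * M)"
    by (simp add: nn_integral_multc nn_integral_cmod_square[OF h])
  finally have H: "(\<integral>\<^sup>+w. ?H w \<partial>(\<mu> \<Otimes>\<^sub>M \<mu>)) \<le> ennreal ((l2_norm \<mu> h)\<^sup>2) * ennreal (2 * N * M)" .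
  have "(\<integral>\<^sup>+w. ennreal (norm (case w of (z, y) \<Rightarrow> p z y * f y * cnj (h z))) \<partial>(\<mu> \<Otimes>\<^sub>M \<mu>))
      \<le> (\<integral>\<^sup>+w. ?F w + ?H w \<partial>(\<mu> \<Otimes>\<^sub>M \<mu>))"
  proof (rule nn_integral_mono, clarify)
    fix z y
    have "cmod (f y) * cmod (h z) \<le> (cmod (f y))\<^sup>2 + (cmod (h z))\<^sup>2"
      using sum_squares_bound[of "cmod (f y)" "cmod (h z)"]
        mult_nonneg_nonneg[OF norm_ge_zero norm_ge_zero, of "f y" "h z"] by linarith
    from mult_left_mono[OF this, of "cmod (p z y)"]
    have "norm (p z y * f y * cnj (h z)) \<le> cmod (p z y) * (cmod (f y))\<^sup>2 + (cmod (h z))\<^sup>2 * cmod (p z y)"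
      by (simp add: norm_mult algebra_simps)
    then have "ennreal (norm (p z y * f y * cnj (h z)))
        \<le> ennreal (cmod (p z y) * (cmod (f y))\<^sup>2 + (cmod (h z))\<^sup>2 * cmod (p z y))" by (rule ennreal_leI)
    then show "ennreal (norm (p z y * f y * cnj (h z)))
        \<le> ennreal (cmod (p z y)) * ennreal ((cmod (f y))\<^sup>2) + ennreal ((cmod (h z))\<^sup>2) * ennreal (cmod (p z y))"
      by (simp add: ennreal_plus ennreal_mult)
  qed
  also have "\<dots> = (\<integral>\<^sup>+w. ?F w \<partial>(\<mu> \<Otimes>\<^sub>M \<mu>)) + (\<integral>\<^sup>+w. ?H w \<partial>(\<mu> \<Otimes>\<^sub>M \<mu>))"
    by (rule nn_integral_add) measurable
  also have "\<dots> \<le> ennreal (2 * N * M) * ennreal ((l2_norm \<mu> f)\<^sup>2)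
      + ennreal ((l2_norm \<mu> h)\<^sup>2) * ennreal (2 * N * M)"
    by (rule add_mono[OF F H])
  also have "\<dots> < \<infinity>" by (simp add: ennreal_mult_less_top)
  finally show "(\<integral>\<^sup>+w. ennreal (norm (case w of (z, y) \<Rightarrow> p z y * f y * cnj (h z))) \<partial>(\<mu> \<Otimes>\<^sub>M \<mu>)) < \<infinity>" .
qed

lemma A_L2: "f \<in> L2 \<mu> \<Longrightarrow> A f \<in> L2 \<mu>"
  using A_represents by (rule represents_L2)

text \<open>This is Fubini's theorem; integrating out the first variable of the kernel leaves inner products
  with its columns.\<close>

lemma inner_A_kernel:
  assumes f: "f \<in> L2 \<mu>" and h: "h \<in> L2 \<mu>"
  shows "integrable \<mu> (\<lambda>y. f y * l2_inner \<mu> (column y) h)"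
    and "l2_inner \<mu> (A f) h = (\<integral>y. f y * l2_inner \<mu> (column y) h \<partial>\<mu>)"
proof -
  have [measurable]: "f \<in> borel_measurable \<mu>" "h \<in> borel_measurable \<mu>" "A f \<in> borel_measurable \<mu>"
    using f h A_L2 L2_borel by auto
  let ?k = "\<lambda>z y. p z y * f y * cnj (h z)"
  note int = kernel_pair_integrable[OF f h]
  have inner: "(\<integral>z. ?k z y \<partial>\<mu>) = f y * l2_inner \<mu> (column y) h" for y
  proof -
    have "(\<integral>z. ?k z y \<partial>\<mu>) = (\<integral>z. f y * (p z y * cnj (h z)) \<partial>\<mu>)" by (simp add: mult_ac)
    then show ?thesis by (simp add: l2_inner_def column_def)
  qed
  show "integrable \<mu> (\<lambda>y. f y * l2_inner \<mu> (column y) h)"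
    using integrable_snd[OF int] by (simp add: inner)
  have "l2_inner \<mu> (A f) h = (\<integral>z. (\<integral>y. ?k z y \<partial>\<mu>) \<partial>\<mu>)"
    unfolding l2_inner_def
  proof (rule integral_cong_AE)
    show "AE z in \<mu>. A f z * cnj (h z) = (\<integral>y. ?k z y \<partial>\<mu>)"
      using A_kernel[OF f] by eventually_elim simp
  qed measurable
  also have "\<dots> = (\<integral>y. (\<integral>z. ?k z y \<partial>\<mu>) \<partial>\<mu>)"
    by (rule Fubini_integral[OF int, symmetric])
  finally show "l2_inner \<mu> (A f) h = (\<integral>y. f y * l2_inner \<mu> (column y) h \<partial>\<mu>)"
    by (simp add: inner)
qed

lemma A_symmetric:
  assumes "f \<in> L2 \<mu>" "g \<in> L2 \<mu>"
  shows "l2_inner \<mu> (A f) g = l2_inner \<mu> f (A g)"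
  by (rule represents_adjoint[OF A_represents _ assms]) (use A_represents in simp)

text \<open>Self-adjointness turns the kernel of \<open>A\<close> around: up to null sets, \<open>p x y\<close> may be replaced by
  \<open>cnj (p y x)\<close>. The right-hand side below is defined and well behaved for every single \<open>x\<close>.\<close>

lemma A_reproducing:
  assumes h: "h \<in> L2 \<mu>"
  shows "AE x in \<mu>. A h x = l2_inner \<mu> h (column x)"
proof -
  define w where "w y = cnj (A h y) - l2_inner \<mu> (column y) h" for y
  have [measurable]: "h \<in> borel_measurable \<mu>" "A h \<in> borel_measurable \<mu>"
    using h A_L2 L2_borel by auto
  have w [measurable]: "w \<in> borel_measurable \<mu>"
    unfolding w_def l2_inner_def column_def by measurable
  have orth: "integrable \<mu> (\<lambda>y. g y * w y) \<and> (\<integral>y. g y * w y \<partial>\<mu>) = 0" if g: "g \<in> L2 \<mu>" for g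
  proof -
    have "(\<integral>y. g y * l2_inner \<mu> (column y) h \<partial>\<mu>) = (\<integral>y. g y * cnj (A h y) \<partial>\<mu>)"
      using inner_A_kernel(2)[OF g h] A_symmetric[OF g h] by (simp add: l2_inner_def)
    then show ?thesis
      using inner_A_kernel(1)[OF g h] L2_mult_integrable[OF g A_L2[OF h]]
      by (simp add: w_def right_diff_distrib)
  qed
  obtain x0 :: 'a where True by simp
  have "AE y in \<mu>. y \<in> ball x0 (real n) \<longrightarrow> cmod (w y) \<le> real n \<longrightarrow> w y = 0" for n
  proof -
    define S where "S = ball x0 (real n) \<inter> {y. cmod (w y) \<le> real n}"
    define g where "g y = cnj (w y) * indicator S y" for y
    have [measurable]: "S \<in> sets \<mu>"
    proof -
      have "{y \<in> space \<mu>. cmod (w y) \<le> real n} \<in> sets \<mu>" by measurable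
      then show ?thesis unfolding S_def by (auto intro!: sets.Int)
    qed
    have [measurable]: "g \<in> borel_measurable \<mu>" unfolding g_def by measurable
    have "g \<in> L2 \<mu>"
    proof (rule L2_of_nn_integral(1))
      have "(\<integral>\<^sup>+y. ennreal ((cmod (g y))\<^sup>2) \<partial>\<mu>) \<le> (\<integral>\<^sup>+y. ennreal ((real n)\<^sup>2) * indicator (ball x0 (real n)) y \<partial>\<mu>)"
        by (intro nn_integral_mono) (auto simp: g_def S_def indicator_def norm_mult intro!: ennreal_leI power_mono)
      also have "\<dots> = ennreal ((real n * sqrt (measure \<mu> (ball x0 (real n))))\<^sup>2)"
        by (simp add: nn_integral_cmult_indicator emeasure_ball ennreal_mult power_mult_distrib)
      finally show "(\<integral>\<^sup>+y. ennreal ((cmod (g y))\<^sup>2) \<partial>\<mu>) \<le> ennreal ((real n * sqrt (measure \<mu> (ball x0 (real n))))\<^sup>2)" .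
    qed auto
    from orth[OF this] have int: "integrable \<mu> (\<lambda>y. g y * w y)" and 0: "(\<integral>y. g y * w y \<partial>\<mu>) = 0" by auto
    have gw: "g y * w y = complex_of_real ((cmod (w y))\<^sup>2 * indicator S y)" for y
      by (cases "y \<in> S")
        (simp_all add: g_def mult.commute[of "cnj _"] complex_norm_square[symmetric] del: of_real_power)
    have "integrable \<mu> (\<lambda>y. (cmod (w y))\<^sup>2 * indicator S y)"
      using int unfolding gw by (simp only: complex_of_real_integrable_eq)
    moreover have "(\<integral>y. (cmod (w y))\<^sup>2 * indicator S y \<partial>\<mu>) = 0"
      using 0 unfolding gw by (simp only: integral_complex_of_real of_real_eq_0_iff)
    ultimately have "AE y in \<mu>. (cmod (w y))\<^sup>2 * indicator S y = 0"
      by (subst (asm) integral_nonneg_eq_0_iff_AE) auto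
    then show ?thesis by eventually_elim (auto simp: S_def indicator_def split: if_splits)
  qed
  then have "AE y in \<mu>. \<forall>n. y \<in> ball x0 (real n) \<longrightarrow> cmod (w y) \<le> real n \<longrightarrow> w y = 0"
    by (simp add: AE_all_countable)
  then show ?thesis
  proof eventually_elim
    case (elim y)
    obtain n where n: "max (dist x0 y) (cmod (w y)) < real n" using reals_Archimedean2 by blast
    then have "w y = 0" using elim by (auto simp: mem_ball)
    then have "cnj (cnj (A h y)) = cnj (l2_inner \<mu> (column y) h)" by (simp add: w_def)
    then show ?case by (simp add: cnj_l2_inner)
  qed
qed

text \<open>The kernel of \<open>A B A\<close>. Writing it with columns on both sides gives a value at every pair of
  points, and makes it continuous, for an arbitrary bounded operator \<open>B\<close>.\<close>

definition sandwiched_kernel :: "(('a \<Rightarrow> complex) \<Rightarrow> ('a \<Rightarrow> complex)) \<Rightarrow> 'a \<Rightarrow> 'a \<Rightarrow> complex" where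
  "sandwiched_kernel B x y = l2_inner \<mu> (B (column y)) (column x)"

text \<open>\<open>A (B A f) (x) = \<langle>B A f, column x\<rangle> = \<langle>A f, B\<^sup>* column x\<rangle>\<close> for almost every \<open>x\<close>, and the last inner product
  is an integral of \<open>f\<close> against \<open>\<langle>column y, B\<^sup>* column x\<rangle>\<close>.\<close>

lemma sandwiched_kernel_integral:
  assumes B: "represents b B" and b: "bounded_symbol b" and f: "f \<in> L2 \<mu>"
  shows "AE x in \<mu>. integrable \<mu> (\<lambda>y. sandwiched_kernel B x y * f y) \<and>
    A (B (A f)) x = (\<integral>y. sandwiched_kernel B x y * f y \<partial>\<mu>)"
proof -
  obtain B' where B': "represents (\<lambda>u. cnj (b u)) B'"
    using represents_exists[OF bounded_symbol_cnj[OF b]] by blast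
  note BA = represents_L2[OF B A_L2[OF f]]
  from A_reproducing[OF BA] show ?thesis
  proof eventually_elim
    case (elim x)
    note B'column = represents_L2[OF B' column_L2, of x]
    have "l2_inner \<mu> (column y) (B' (column x)) = sandwiched_kernel B x y" for y
      using represents_adjoint[OF B B' column_L2 column_L2, of y x] by (simp add: sandwiched_kernel_def)
    moreover have "A (B (A f)) x = l2_inner \<mu> (A f) (B' (column x))"
      using elim represents_adjoint[OF B B' A_L2[OF f] column_L2, of x] by simp
    ultimately show ?case
      using inner_A_kernel[OF f B'column] by (simp add: mult.commute)
  qed
qed

lemma isCont_column_norm: "isCont (\<lambda>y. l2_norm \<mu> (\<lambda>z. column y z - column y0 z)) y0"
  using column_continuous[of y0] by (simp add: isCont_def l2_norm_def)

lemma continuous_sandwiched_kernel: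
  assumes B: "represents b B" and b: "bounded_symbol b"
  shows "continuous_on UNIV (\<lambda>(x, y). sandwiched_kernel B x y)"
  unfolding continuous_on_eq_continuous_at[OF open_UNIV]
proof (intro ballI)
  fix w0 :: "'a \<times> 'a"
  obtain x0 y0 where w0: "w0 = (x0, y0)" by (cases w0)
  let ?k = "sandwiched_kernel B" and ?d = "\<lambda>y0 y. l2_norm \<mu> (\<lambda>z. column y z - column y0 z)"
  from b obtain c where c: "\<And>u. 0 \<le> u \<Longrightarrow> cmod (b u) \<le> c" by (auto simp: bounded_symbol_def)
  note bound = represents_norm_bound[OF B b c]
  have c0: "0 \<le> c" using c[of 0] norm_ge_zero[of "b 0"] by linarith
  define G where "G w = 2 * c * ?d y0 (snd w) * (?d x0 (fst w) + l2_norm \<mu> (column x0))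
      + 2 * c * l2_norm \<mu> (column y0) * ?d x0 (fst w)" for w
  have le: "norm (?k (fst w) (snd w) - ?k x0 y0) \<le> G w" for w
  proof -
    obtain x y where w: "w = (x, y)" by (cases w)
    note D = L2_diff[OF column_L2 column_L2] and BL = represents_L2[OF B]
    have "l2_inner \<mu> (B (\<lambda>z. column y z - column y0 z)) (column x) = ?k x y - l2_inner \<mu> (B (column y0)) (column x)"
      using L2_operator_inner_lincomb[OF represents_operator[OF B] column_L2 column_L2 column_L2, of 1 y "-1" y0 x]
      by (simp add: sandwiched_kernel_def)
    moreover have "l2_inner \<mu> (B (column y0)) (\<lambda>z. column x z - column x0 z) = l2_inner \<mu> (B (column y0)) (column x) - ?k x0 y0"
      by (simp add: sandwiched_kernel_def l2_inner_diff_right column_L2 BL)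
    ultimately have "?k x y - ?k x0 y0
      = l2_inner \<mu> (B (\<lambda>z. column y z - column y0 z)) (column x) + l2_inner \<mu> (B (column y0)) (\<lambda>z. column x z - column x0 z)"
      by simp
    then have "norm (?k x y - ?k x0 y0) \<le> cmod (l2_inner \<mu> (B (\<lambda>z. column y z - column y0 z)) (column x))
       + cmod (l2_inner \<mu> (B (column y0)) (\<lambda>z. column x z - column x0 z))"
      by (simp only: norm_triangle_ineq)
    also have "\<dots> \<le> l2_norm \<mu> (B (\<lambda>z. column y z - column y0 z)) * l2_norm \<mu> (column x)
        + l2_norm \<mu> (B (column y0)) * ?d x0 x"
      by (intro add_mono l2_Cauchy_Schwarz BL D column_L2)
    also have "\<dots> \<le> (2 * c * ?d y0 y) * (?d x0 x + l2_norm \<mu> (column x0)) + (2 * c * l2_norm \<mu> (column y0)) * ?d x0 x"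
    proof (intro add_mono mult_mono bound D column_L2)
      show "l2_norm \<mu> (column x) \<le> ?d x0 x + l2_norm \<mu> (column x0)"
        using l2_norm_triangle[OF D column_L2, of x x0 x0] by simp
    qed (use c0 in auto)
    finally show ?thesis by (simp add: w G_def)
  qed
  have "isCont (\<lambda>w. ?d y0 (snd w)) w0" "isCont (\<lambda>w. ?d x0 (fst w)) w0"
    using isCont_o2[OF isCont_snd[OF continuous_ident], where g = "?d y0" and a = w0]
      isCont_o2[OF isCont_fst[OF continuous_ident], where g = "?d x0" and a = w0] isCont_column_norm
    by (simp_all add: w0)
  then have "isCont G w0" unfolding G_def by (intro continuous_intros)
  moreover have "?d y y = 0" for y by (simp add: l2_norm_def)
  then have "G w0 = 0" by (simp add: G_def w0)
  ultimately have "(G \<longlongrightarrow> 0) (at w0)" unfolding isCont_def by (simp only:)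
  then have "((\<lambda>w. ?k (fst w) (snd w) - ?k x0 y0) \<longlongrightarrow> 0) (at w0)"
    by (rule Lim_null_comparison[OF always_eventually, rotated]) (use le in blast)
  then show "isCont (\<lambda>(x, y). ?k x y) w0"
    unfolding isCont_def w0 case_prod_beta by (simp add: LIM_zero_iff)
qed

end

section \<open>Chebyshev polynomials on the unit interval\<close>

text \<open>The Chebyshev polynomials \<open>T\<^sub>k (2 s - 1)\<close>, transplanted from \<open>[-1, 1]\<close> to \<open>[0, 1]\<close>.\<close>

fun chebyshev :: "nat \<Rightarrow> real \<Rightarrow> real" where
  "chebyshev 0 s = 1"
| "chebyshev (Suc 0) s = 2 * s - 1"
| "chebyshev (Suc (Suc k)) s = 2 * (2 * s - 1) * chebyshev (Suc k) s - chebyshev k s"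

lemma chebyshev_cos: "chebyshev k ((1 + cos \<theta>) / 2) = cos (real k * \<theta>)"
proof (induction k "\<theta>" rule: chebyshev.induct)
  case (3 k \<theta>)
  have "cos (real (Suc (Suc k)) * \<theta>) = cos (real (Suc k) * \<theta> + \<theta>)"
    by (simp add: algebra_simps)
  moreover have "cos (real k * \<theta>) = cos (real (Suc k) * \<theta> - \<theta>)"
    by (simp add: algebra_simps)
  moreover have "2 * ((1 + cos \<theta>) / 2) - 1 = cos \<theta>" by (simp add: field_simps)
  ultimately show ?case unfolding chebyshev.simps 3 by (simp only: cos_add cos_diff) simp
qed (simp_all add: field_simps)

lemma unit_interval_cos:
  assumes "0 \<le> s" "s \<le> (1::real)"
  shows "s = (1 + cos (arccos (2 * s - 1))) / 2"
  using assms by (subst cos_arccos) auto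

lemma abs_chebyshev_le_1: "0 \<le> s \<Longrightarrow> s \<le> 1 \<Longrightarrow> \<bar>chebyshev k s\<bar> \<le> 1"
  by (subst unit_interval_cos) (simp_all only: chebyshev_cos abs_cos_le_one)

lemma chebyshev_borel: "a \<in> borel_measurable M \<Longrightarrow> (\<lambda>u. chebyshev k (a u)) \<in> borel_measurable M"
  by (induction k "0::real" rule: chebyshev.induct) simp_all

lemma exp_times_power_bounded:
  fixes \<eta> :: real
  assumes "0 < \<eta>"
  shows "\<exists>C>0. \<forall>R\<ge>0. exp (- \<eta> * R) * (1 + R) ^ n \<le> C"
proof -
  define C where "C = fact n * exp \<eta> / \<eta> ^ n"
  have "exp (- \<eta> * R) * (1 + R) ^ n \<le> C" if "R \<ge> 0" for R
  proof -
    have "(\<eta> * (1 + R)) ^ n / fact n \<le> exp (\<eta> * (1 + R))"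
    proof -
      have "(\<lambda>k. (\<eta> * (1 + R)) ^ k /\<^sub>R fact k) sums exp (\<eta> * (1 + R))" by (rule exp_converges)
      moreover have "sum (\<lambda>k. (\<eta> * (1 + R)) ^ k /\<^sub>R fact k) {n} \<le> (\<Sum>k. (\<eta> * (1 + R)) ^ k /\<^sub>R fact k)"
        using assms that by (intro sum_le_suminf sums_summable[OF calculation]) auto
      ultimately have "sum (\<lambda>k. (\<eta> * (1 + R)) ^ k /\<^sub>R fact k) {n} \<le> exp (\<eta> * (1 + R))"
        by (simp only: sums_unique[symmetric])
      then show ?thesis by (simp add: divide_inverse mult.commute)
    qed
    also have "\<dots> = exp \<eta> * exp (\<eta> * R)" by (simp add: distrib_left exp_add)
    finally have "\<eta> ^ n * (1 + R) ^ n \<le> fact n * (exp \<eta> * exp (\<eta> * R))"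
      by (simp only: power_mult_distrib) (simp add: divide_le_eq mult.commute)
    then show ?thesis
      using assms by (simp add: C_def field_simps exp_minus)
  qed
  moreover have "C > 0" using assms by (simp add: C_def)
  ultimately show ?thesis by blast
qed

text \<open>If \<open>R\<close> is at most a fixed multiple of \<open>k\<close>, the trivial bound \<open>1\<close> is good enough;
  otherwise half of the exponential decay in \<open>R\<close> beats the exponential growth in \<open>k\<close>.\<close>

lemma min_exp_growth_decay:
  fixes Q \<eta> :: real
  assumes Q: "1 \<le> Q" and \<eta>: "0 < \<eta>"
  shows "\<exists>C>0. \<forall>k R. 0 \<le> R \<longrightarrow> min 1 (Q ^ k * exp (- \<eta> * R)) * (1 + R) ^ n \<le> C * (1 + real k) ^ n"
proof -
  obtain C where C: "C > 0" "\<And>R. R \<ge> 0 \<Longrightarrow> exp (- (\<eta> / 2) * R) * (1 + R) ^ n \<le> C"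
    using exp_times_power_bounded[of "\<eta> / 2" n] \<eta> by auto
  \<comment> \<open>The threshold ratio \<open>R/k\<close> below which \<open>Q ^ k * exp (- \<eta> R / 2)\<close> may exceed \<open>1\<close>, plus \<open>1\<close>.\<close>
  define l where "l = 1 + 2 * ln Q / \<eta>"
  have l: "l \<ge> 1" using Q \<eta> by (simp add: l_def)
  have "min 1 (Q ^ k * exp (- \<eta> * R)) * (1 + R) ^ n \<le> (C + l ^ n) * (1 + real k) ^ n" if R: "0 \<le> R" for k R
  proof (cases "real k * ln Q \<le> \<eta> / 2 * R")
    case True
    have "Q ^ k = exp (real k * ln Q)" using Q by (simp add: exp_of_nat_mult)
    also have "\<dots> \<le> exp (\<eta> / 2 * R)" using True by simp
    finally have "Q ^ k * exp (- \<eta> * R) \<le> exp (\<eta> / 2 * R) * exp (- \<eta> * R)" by (intro mult_right_mono) auto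
    also have "\<dots> = exp (- (\<eta> / 2) * R)" by (simp flip: exp_add add: field_simps)
    finally have "min 1 (Q ^ k * exp (- \<eta> * R)) * (1 + R) ^ n \<le> exp (- (\<eta> / 2) * R) * (1 + R) ^ n"
      using R by (intro mult_right_mono) auto
    also have "\<dots> \<le> C * 1" using C(2)[OF R] by simp
    also have "\<dots> \<le> (C + l ^ n) * (1 + real k) ^ n"
      using C l by (intro mult_mono one_le_power) auto
    finally show ?thesis .
  next
    case False
    then have "R \<le> 2 * ln Q / \<eta> * real k" using \<eta> by (simp add: field_simps)
    moreover have "0 \<le> 2 * ln Q / \<eta>" using Q \<eta> by simp
    ultimately have "1 + R \<le> 1 + 2 * ln Q / \<eta> * real k + (real k + 2 * ln Q / \<eta>)" by simp
    also have "\<dots> = l * (1 + real k)" by (simp add: l_def ring_distribs)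
    finally have "1 + R \<le> l * (1 + real k)" .
    then have "(1 + R) ^ n \<le> l ^ n * (1 + real k) ^ n"
      using R by (simp flip: power_mult_distrib add: power_mono)
    moreover have "min 1 (Q ^ k * exp (- \<eta> * R)) * (1 + R) ^ n \<le> 1 * (1 + R) ^ n"
      using R by (intro mult_right_mono) auto
    moreover have "l ^ n * (1 + real k) ^ n \<le> (C + l ^ n) * (1 + real k) ^ n"
      using C by (intro mult_right_mono) auto
    ultimately show ?thesis by linarith
  qed
  moreover have "C + l ^ n > 0" using C l by (simp add: add_pos_nonneg)
  ultimately show ?thesis by blast
qed

lemma norm_integral_le_of_nn_integral:
  fixes f :: "'a \<Rightarrow> complex"
  assumes "(\<integral>\<^sup>+x. ennreal (norm (f x)) \<partial>M) \<le> ennreal c" "0 \<le> c"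
  shows "norm (\<integral>x. f x \<partial>M) \<le> c"
proof (cases "integrable M f")
  case True
  then have "ennreal (norm (\<integral>x. f x \<partial>M)) \<le> ennreal c"
    using integral_norm_bound_ennreal[OF True] assms(1) by order
  then show ?thesis using assms(2) by (simp add: ennreal_le_iff)
qed (use assms in \<open>simp add: not_integrable_integral_eq\<close>)

section \<open>Kernels of Chebyshev expansions\<close>

context localized_kernel begin

abbreviation a_chebyshev :: "nat \<Rightarrow> real \<Rightarrow> complex" where
  "a_chebyshev k u \<equiv> of_real (chebyshev k (a u))"

lemma bounded_symbol_a: "bounded_symbol (\<lambda>u. of_real (a u))"
  unfolding bounded_symbol_def using a_borel a_range by (intro conjI exI[of _ 1]) auto

lemma bounded_symbol_chebyshev: "bounded_symbol (a_chebyshev k)"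
proof -
  have [measurable]: "(\<lambda>u. chebyshev k (a u)) \<in> borel_measurable half_line"
    using a_borel by (rule chebyshev_borel)
  show ?thesis
    unfolding bounded_symbol_def using a_range abs_chebyshev_le_1
    by (intro conjI exI[of _ 1]) auto
qed

definition cheb_op :: "nat \<Rightarrow> ('a \<Rightarrow> complex) \<Rightarrow> ('a \<Rightarrow> complex)" where
  "cheb_op k = spectral_integral \<mu> E (a_chebyshev k)"

lemma cheb_op_represents: "represents (a_chebyshev k) (cheb_op k)"
  unfolding cheb_op_def by (rule represents_spectral_integral[OF bounded_symbol_chebyshev])

lemma cheb_op_0: "f \<in> L2 \<mu> \<Longrightarrow> AE x in \<mu>. cheb_op 0 f x = f x"
  by (rule represents_unique[OF cheb_op_represents represents_one]) auto

lemma cheb_op_1: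
  assumes f: "f \<in> L2 \<mu>"
  shows "AE x in \<mu>. cheb_op (Suc 0) f x = 2 * A f x + (- 1) * f x"
  by (rule represents_unique[OF cheb_op_represents
        represents_lincomb[OF A_represents represents_one bounded_symbol_a bounded_symbol_const] _ f]) simp

lemma cheb_op_Suc_Suc:
  assumes f: "f \<in> L2 \<mu>"
  shows "AE x in \<mu>. cheb_op (Suc (Suc k)) f x = 1 * (4 * A (cheb_op (Suc k) f) x + (- 2) * cheb_op (Suc k) f x) + (- 1) * cheb_op k f x"
  by (rule represents_unique[OF cheb_op_represents
        represents_lincomb[OF
          represents_lincomb[OF represents_mult[OF A_represents cheb_op_represents bounded_symbol_a bounded_symbol_chebyshev]
            cheb_op_represents bounded_symbol_mult[OF bounded_symbol_a bounded_symbol_chebyshev] bounded_symbol_chebyshev]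
          cheb_op_represents
          bounded_symbol_lincomb[OF bounded_symbol_mult[OF bounded_symbol_a bounded_symbol_chebyshev] bounded_symbol_chebyshev]
          bounded_symbol_chebyshev] _ f])
    (simp add: algebra_simps)

text \<open>A version of the kernel of \<open>chebyshev k (A) A\<close> that is defined at every pair of points and
  jointly measurable; it follows the recursion of the polynomials, since multiplication by
  \<open>2 (2 s - 1)\<close> turns into \<open>4 A - 2\<close>.\<close>

fun cheb_kernel :: "nat \<Rightarrow> 'a \<Rightarrow> 'a \<Rightarrow> complex" where
  "cheb_kernel 0 z y = p z y"
| "cheb_kernel (Suc 0) z y = 2 * (\<integral>w. p z w * p w y \<partial>\<mu>) - p z y"
| "cheb_kernel (Suc (Suc k)) z y = 4 * (\<integral>w. p z w * cheb_kernel (Suc k) w y \<partial>\<mu>) - 2 * cheb_kernel (Suc k) z y - cheb_kernel k z y"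

lemma kernel_product_measurable:
  assumes [measurable]: "(\<lambda>(z, y). k z y) \<in> borel_measurable (\<mu> \<Otimes>\<^sub>M \<mu>)"
  shows "(\<lambda>(z, y). \<integral>w. p z w * k w y \<partial>\<mu>) \<in> borel_measurable (\<mu> \<Otimes>\<^sub>M \<mu>)"
proof -
  have "(\<lambda>v. k (snd v) (snd (fst v))) \<in> borel_measurable ((\<mu> \<Otimes>\<^sub>M \<mu>) \<Otimes>\<^sub>M \<mu>)"
    using measurable_compose[OF measurable_Pair[OF measurable_snd measurable_compose[OF measurable_fst measurable_snd]] assms]
    by simp
  then have [measurable]: "(\<lambda>v. p (fst (fst v)) (snd v) * k (snd v) (snd (fst v)))
      \<in> borel_measurable ((\<mu> \<Otimes>\<^sub>M \<mu>) \<Otimes>\<^sub>M \<mu>)" by measurable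
  have "(\<lambda>u. \<integral>w. p (fst u) w * k w (snd u) \<partial>\<mu>) \<in> borel_measurable (\<mu> \<Otimes>\<^sub>M \<mu>)"
    by (rule sigma_finite_measure.borel_measurable_lebesgue_integral[OF sigma_finite_doubling]) (simp add: case_prod_beta')
  then show ?thesis by (simp add: case_prod_beta')
qed

lemma cheb_kernel_measurable: "(\<lambda>(z, y). cheb_kernel k z y) \<in> borel_measurable (\<mu> \<Otimes>\<^sub>M \<mu>)"
proof (induction k rule: induct_nat_012)
  case 0
  show ?case by simp
next
  case 1
  show ?case using kernel_product_measurable[OF p_measurable] by (simp add: case_prod_beta')
next
  case (ge2 k)
  note m = ge2[unfolded case_prod_beta'] kernel_product_measurable[OF ge2(2), unfolded case_prod_beta']
  show ?case
    unfolding cheb_kernel.simps case_prod_beta'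
    by (intro borel_measurable_diff borel_measurable_times borel_measurable_const m)
qed

lemma cheb_kernel_section_measurable: "(\<lambda>z. cheb_kernel k z y) \<in> borel_measurable \<mu>"
  using measurable_compose[OF measurable_Pair2' cheb_kernel_measurable, of y k] by simp

text \<open>One step of the recursion for \<open>cheb_kernel\<close> multiplies the bound by at most \<open>4 N M + 2 + 1\<close>,
  because composing with \<open>A\<close> costs a factor \<open>N M\<close>.\<close>

definition growth :: real where "growth = 4 * N * M + 3"

lemma growth_ge_1: "1 \<le> growth"
  using N_pos M_pos by (simp add: growth_def)

lemma exp_weight_le: "exp (- \<eta> * (dist x y / r)) * weight x y \<le> weight x y"
  using \<eta>_pos r_pos weight_nonneg by (intro mult_left_le_one_le) auto

lemma norm_kernel_product:
  assumes "\<And>w. cmod (k w) \<le> c * weight w y" "0 \<le> c"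
  shows "cmod (\<integral>w. p z w * k w \<partial>\<mu>) \<le> N * M * c * weight z y"
proof (rule norm_integral_le_of_nn_integral)
  show "(\<integral>\<^sup>+w. ennreal (cmod (p z w * k w)) \<partial>\<mu>) \<le> ennreal (N * M * c * weight z y)"
    unfolding norm_mult by (rule nn_integral_kernel_weight[OF assms kernel_bound_weight])
  show "0 \<le> N * M * c * weight z y"
    using N_pos M_pos weight_nonneg assms by simp
qed

lemma cheb_kernel_bound: "cmod (cheb_kernel k z y) \<le> (growth ^ k * N) * weight z y"
proof (induction k arbitrary: z rule: induct_nat_012)
  case 0
  have "N * (exp (- \<eta> * (dist z y / r)) * weight z y) \<le> N * weight z y"
    using N_pos by (intro mult_left_mono exp_weight_le) auto
  then show ?case using kernel_bound_weight[of z y] by simp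
next
  case 1
  have p: "cmod (p w y) \<le> N * weight w y" for w
  proof -
    have "N * (exp (- \<eta> * (dist w y / r)) * weight w y) \<le> N * weight w y"
      using N_pos by (intro mult_left_mono exp_weight_le) auto
    then show ?thesis using kernel_bound_weight[of w y] by simp
  qed
  have "cmod (cheb_kernel 1 z y) \<le> cmod (2 * (\<integral>w. p z w * p w y \<partial>\<mu>)) + cmod (p z y)"
    using norm_triangle_ineq4[of "2 * (\<integral>w. p z w * p w y \<partial>\<mu>)" "p z y"] by simp
  also have "\<dots> \<le> 2 * (N * M * N * weight z y) + N * weight z y"
    unfolding norm_mult using p norm_kernel_product[OF p, of z] N_pos by (intro add_mono) auto
  also have "\<dots> = (2 * N * M + 1) * (N * weight z y)" by (simp add: algebra_simps)
  also have "\<dots> \<le> growth * (N * weight z y)"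
    using N_pos M_pos weight_nonneg by (intro mult_right_mono) (auto simp: growth_def)
  finally show ?case by simp
next
  case (ge2 k)
  let ?w = "N * weight z y"
  have w: "0 \<le> ?w" using N_pos weight_nonneg by simp
  have "cmod (cheb_kernel (Suc (Suc k)) z y) \<le> cmod (4 * (\<integral>w. p z w * cheb_kernel (Suc k) w y \<partial>\<mu>))
      + cmod (2 * cheb_kernel (Suc k) z y) + cmod (cheb_kernel k z y)"
    using norm_triangle_ineq4[of "4 * (\<integral>w. p z w * cheb_kernel (Suc k) w y \<partial>\<mu>) - 2 * cheb_kernel (Suc k) z y" "cheb_kernel k z y"]
      norm_triangle_ineq4[of "4 * (\<integral>w. p z w * cheb_kernel (Suc k) w y \<partial>\<mu>)" "2 * cheb_kernel (Suc k) z y"] by simp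
  also have "\<dots> \<le> 4 * (N * M * (growth ^ Suc k * N) * weight z y) + 2 * (growth ^ Suc k * N * weight z y) + growth ^ k * N * weight z y"
    unfolding norm_mult using norm_kernel_product[OF ge2(2), of z] ge2(1)[of z] ge2(2)[of z] N_pos growth_ge_1
    by (intro add_mono) auto
  also have "\<dots> = (4 * N * M + 2) * growth ^ Suc k * ?w + growth ^ k * ?w" by (simp add: algebra_simps)
  also have "growth ^ k * ?w \<le> growth ^ Suc k * ?w"
    using growth_ge_1 w by (intro mult_right_mono power_increasing) auto
  also have "(4 * N * M + 2) * growth ^ Suc k * ?w + growth ^ Suc k * ?w = growth ^ Suc (Suc k) * ?w"
    by (simp add: growth_def algebra_simps)
  finally show ?case by simp
qed

lemma column_apply: "column y z = p z y"
  by (simp add: column_def)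

lemma cheb_op_column_eq_kernel: "AE z in \<mu>. cheb_op k (column y) z = cheb_kernel k z y"
proof (induction k rule: induct_nat_012)
  case 0
  show ?case using cheb_op_0[OF column_L2, of y] by eventually_elim (metis column_apply cheb_kernel.simps(1))
next
  case 1
  show ?case using cheb_op_1[OF column_L2, of y] A_kernel[OF column_L2, of y]
  proof eventually_elim
    case (elim z)
    have "A (column y) z = (\<integral>w. p z w * p w y \<partial>\<mu>)" using elim by (simp add: column_apply)
    with elim(1) column_apply[of y z] show ?case by (simp only: cheb_kernel.simps mult_minus_left mult_1_left add_uminus_conv_diff)
  qed
next
  case (ge2 k)
  have TL: "cheb_op (Suc k) (column y) \<in> L2 \<mu>" by (rule represents_L2[OF cheb_op_represents column_L2])
  have qL: "(\<lambda>z. cheb_kernel (Suc k) z y) \<in> L2 \<mu>"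
  proof (rule L2_bound[OF TL cheb_kernel_section_measurable])
    show "AE z in \<mu>. cmod (cheb_kernel (Suc k) z y) \<le> cmod (cheb_op (Suc k) (column y) z)"
      using ge2(2) by eventually_elim simp
  qed
  have "AE z in \<mu>. A (cheb_op (Suc k) (column y)) z = A (\<lambda>z. cheb_kernel (Suc k) z y) z"
    by (rule L2_operator_cong[OF represents_operator[OF A_represents] TL qL ge2(2)])
  with cheb_op_Suc_Suc[OF column_L2, of k y] A_kernel[OF qL] ge2 show ?case
    by eventually_elim simp
qed

lemma cheb_kernel_L2: "(\<lambda>z. cheb_kernel k z y) \<in> L2 \<mu>"
proof (rule L2_bound[OF represents_L2[OF cheb_op_represents column_L2] cheb_kernel_section_measurable])
  show "AE z in \<mu>. cmod (cheb_kernel k z y) \<le> cmod (cheb_op k (column y) z)"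
    using cheb_op_column_eq_kernel[of k y] by eventually_elim simp
qed

lemma cheb_op_inner_eq: "l2_inner \<mu> (cheb_op k (column y)) (column x) = (\<integral>z. cheb_kernel k z y * cnj (p z x) \<partial>\<mu>)"
proof -
  have "l2_inner \<mu> (cheb_op k (column y)) (column x) = l2_inner \<mu> (\<lambda>z. cheb_kernel k z y) (column x)"
    by (intro l2_inner_cong cheb_op_column_eq_kernel AE_I2 represents_L2[OF cheb_op_represents] column_L2 cheb_kernel_L2) simp
  then show ?thesis by (simp add: l2_inner_def column_def)
qed

lemma cheb_op_inner_measurable:
  "(\<lambda>(x, y). l2_inner \<mu> (cheb_op k (column y)) (column x)) \<in> borel_measurable (\<mu> \<Otimes>\<^sub>M \<mu>)"
proof -
  have "(\<lambda>v. cheb_kernel k (snd v) (snd (fst v))) \<in> borel_measurable ((\<mu> \<Otimes>\<^sub>M \<mu>) \<Otimes>\<^sub>M \<mu>)"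
    using measurable_compose[OF measurable_Pair[OF measurable_snd measurable_compose[OF measurable_fst measurable_snd]] cheb_kernel_measurable]
    by simp
  then have [measurable]: "(\<lambda>v. cheb_kernel k (snd v) (snd (fst v)) * cnj (p (snd v) (fst (fst v))))
      \<in> borel_measurable ((\<mu> \<Otimes>\<^sub>M \<mu>) \<Otimes>\<^sub>M \<mu>)" by measurable
  have "(\<lambda>u. \<integral>z. cheb_kernel k z (snd u) * cnj (p z (fst u)) \<partial>\<mu>) \<in> borel_measurable (\<mu> \<Otimes>\<^sub>M \<mu>)"
    by (rule sigma_finite_measure.borel_measurable_lebesgue_integral[OF sigma_finite_doubling]) (simp add: case_prod_beta')
  then show ?thesis by (simp add: case_prod_beta' cheb_op_inner_eq)
qed

text \<open>Two competing estimates. Cauchy--Schwarz and \<open>|chebyshev k| \<le> 1\<close> on \<open>[0, 1]\<close> give a bound that is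
  independent of \<open>k\<close> but ignores the distance; the pointwise kernel bound decays exponentially in the
  distance but grows exponentially in \<open>k\<close>.\<close>

lemma cheb_op_inner_bound:
  "cmod (l2_inner \<mu> (cheb_op k (column y)) (column x))
    \<le> 2 * N\<^sup>2 * M / sqrt (V x * V y) * min 1 (growth ^ k * exp (- \<eta> * (dist x y / r)))"
proof -
  let ?t = "cmod (l2_inner \<mu> (cheb_op k (column y)) (column x))"
  have "?t \<le> l2_norm \<mu> (cheb_op k (column y)) * l2_norm \<mu> (column x)"
    by (rule l2_Cauchy_Schwarz[OF represents_L2[OF cheb_op_represents column_L2] column_L2])
  also have "\<dots> \<le> (2 * 1 * l2_norm \<mu> (column y)) * l2_norm \<mu> (column x)"
    using a_range abs_chebyshev_le_1
    by (intro mult_right_mono represents_norm_bound[OF cheb_op_represents bounded_symbol_chebyshev _ column_L2]) auto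
  also have "\<dots> \<le> (2 * 1 * (N * sqrt (M / V y))) * (N * sqrt (M / V x))"
    using N_pos M_pos V_pos[of x] V_pos[of y] by (intro mult_mono column_norm) auto
  also have "\<dots> = 2 * N\<^sup>2 * M / sqrt (V x * V y)"
  proof -
    have "sqrt M * sqrt M = M" using M_pos by simp
    then show ?thesis by (simp add: real_sqrt_mult real_sqrt_divide power2_eq_square mult_ac)
  qed
  finally have 1: "?t \<le> 2 * N\<^sup>2 * M / sqrt (V x * V y)" .
  have "?t \<le> N * M * (growth ^ k * N) * weight x y"
    unfolding cheb_op_inner_eq
  proof (rule norm_integral_le_of_nn_integral)
    have "(\<integral>\<^sup>+z. ennreal (cmod (p z x) * cmod (cheb_kernel k z y)) \<partial>\<mu>) \<le> ennreal (N * M * (growth ^ k * N) * weight x y)"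
      using kernel_bound_weight[of _ x] growth_ge_1 N_pos
      by (intro nn_integral_kernel_weight cheb_kernel_bound) (auto simp: dist_commute weight_commute)
    then show "(\<integral>\<^sup>+z. ennreal (cmod (cheb_kernel k z y * cnj (p z x))) \<partial>\<mu>) \<le> ennreal (N * M * (growth ^ k * N) * weight x y)"
      by (simp add: norm_mult mult.commute)
    show "0 \<le> N * M * (growth ^ k * N) * weight x y" using N_pos M_pos weight_nonneg growth_ge_1 by simp
  qed
  also have "\<dots> = N\<^sup>2 * M / sqrt (V x * V y) * (growth ^ k * exp (- \<eta> * (dist x y / r)))"
    by (simp add: weight_def power2_eq_square)
  also have "\<dots> \<le> 2 * N\<^sup>2 * M / sqrt (V x * V y) * (growth ^ k * exp (- \<eta> * (dist x y / r)))"
    using N_pos M_pos V_pos[of x] V_pos[of y] growth_ge_1 by (intro mult_right_mono divide_right_mono) auto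
  finally show ?thesis using 1 by (simp add: min_def)
qed

text \<open>The partial sums of the expansion converge uniformly on \<open>[0, 1]\<close>, which contains the range of
  \<open>a\<close>, so the corresponding operators converge in norm.\<close>

lemma chebyshev_expansion_inner:
  assumes B: "represents (\<lambda>u. H (a u)) B" and H: "bounded_symbol (\<lambda>u. H (a u))"
    and c: "summable (\<lambda>k. cmod (c k))"
    and sums: "\<And>s. 0 \<le> s \<Longrightarrow> s \<le> 1 \<Longrightarrow> (\<lambda>k. c k * of_real (chebyshev k s)) sums H s"
    and f: "f \<in> L2 \<mu>" and g: "g \<in> L2 \<mu>"
  shows "(\<lambda>k. c k * l2_inner \<mu> (cheb_op k f) g) sums l2_inner \<mu> (B f) g"
proof -
  define s where "s n u = H (a u) - (\<Sum>k<n. c k * a_chebyshev k u)" for n u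
  have step: "\<exists>R. bounded_symbol (s n) \<and> represents (s n) R \<and>
      l2_inner \<mu> (R f) g = l2_inner \<mu> (B f) g - (\<Sum>k<n. c k * l2_inner \<mu> (cheb_op k f) g)" for n
  proof (induction n)
    case 0
    show ?case using B H by (intro exI[of _ B]) (simp add: s_def)
  next
    case (Suc n)
    then obtain R where R: "bounded_symbol (s n)" "represents (s n) R"
      "l2_inner \<mu> (R f) g = l2_inner \<mu> (B f) g - (\<Sum>k<n. c k * l2_inner \<mu> (cheb_op k f) g)" by blast
    let ?R = "\<lambda>f x. 1 * R f x + (- c n) * cheb_op n f x"
    have eq: "s (Suc n) = (\<lambda>u. 1 * s n u + (- c n) * a_chebyshev n u)"
      by (rule ext) (simp add: s_def)
    have "l2_inner \<mu> (?R f) g = 1 * l2_inner \<mu> (R f) g + (- c n) * l2_inner \<mu> (cheb_op n f) g"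
      by (rule l2_inner_lincomb_left[OF represents_L2[OF R(2) f] represents_L2[OF cheb_op_represents f] g])
    then show ?case
      using represents_lincomb[OF R(2) cheb_op_represents R(1) bounded_symbol_chebyshev, of 1 "- c n" n]
        bounded_symbol_lincomb[OF R(1) bounded_symbol_chebyshev, of 1 "- c n" n] R(3)
      by (intro exI[of _ ?R]) (simp add: eq)
  qed
  have tail: "cmod (s n u) \<le> (\<Sum>k. cmod (c (k + n)))" if u: "0 \<le> u" for n u
  proof -
    note au = a_range[OF u]
    have "(\<lambda>k. c (k + n) * a_chebyshev (k + n) u) sums s n u"
      using sums_split_initial_segment[OF sums, of "a u" n] au by (simp add: s_def)
    moreover have le: "norm (c (k + n) * a_chebyshev (k + n) u) \<le> cmod (c (k + n))" for k
      using abs_chebyshev_le_1[of "a u" "k + n"] au by (simp add: norm_mult mult_left_le)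
    moreover have "summable (\<lambda>k. cmod (c (k + n)))" by (rule summable_ignore_initial_segment[OF c])
    ultimately show ?thesis
      using norm_suminf_le[of "\<lambda>k. c (k + n) * a_chebyshev (k + n) u" "\<lambda>k. cmod (c (k + n))"]
      by (simp only: sums_iff)
  qed
  have le: "cmod ((\<Sum>k<n. c k * l2_inner \<mu> (cheb_op k f) g) - l2_inner \<mu> (B f) g)
      \<le> 2 * (\<Sum>k. cmod (c (k + n))) * l2_norm \<mu> f * l2_norm \<mu> g" for n
  proof -
    obtain R where R: "bounded_symbol (s n)" "represents (s n) R"
      "l2_inner \<mu> (R f) g = l2_inner \<mu> (B f) g - (\<Sum>k<n. c k * l2_inner \<mu> (cheb_op k f) g)" using step by blast
    have "cmod ((\<Sum>k<n. c k * l2_inner \<mu> (cheb_op k f) g) - l2_inner \<mu> (B f) g) = cmod (l2_inner \<mu> (R f) g)"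
      by (simp add: R(3) norm_minus_commute)
    also have "\<dots> \<le> l2_norm \<mu> (R f) * l2_norm \<mu> g"
      by (rule l2_Cauchy_Schwarz[OF represents_L2[OF R(2) f] g])
    also have "\<dots> \<le> 2 * (\<Sum>k. cmod (c (k + n))) * l2_norm \<mu> f * l2_norm \<mu> g"
      by (intro mult_right_mono represents_norm_bound[OF R(2,1) tail f]) auto
    finally show ?thesis .
  qed
  have "(\<lambda>n. \<Sum>k. cmod (c (k + n))) \<longlonglongrightarrow> 0"
    using suminf_exist_split2[OF c] by simp
  then have "(\<lambda>n. 2 * (\<Sum>k. cmod (c (k + n))) * l2_norm \<mu> f * l2_norm \<mu> g) \<longlonglongrightarrow> 0"
    by (intro tendsto_mult_left_zero tendsto_mult_right_zero)
  then have "(\<lambda>n. (\<Sum>k<n. c k * l2_inner \<mu> (cheb_op k f) g) - l2_inner \<mu> (B f) g) \<longlonglongrightarrow> 0"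
    by (rule Lim_null_comparison[OF always_eventually, rotated]) (use le in auto)
  then show ?thesis unfolding sums_def by (rule LIM_zero_cancel)
qed

text \<open>Each term of the expansion decays like \<open>(1 + \<rho>/r)\<^sup>-\<^sup>n\<close> at the price of a factor \<open>(1 + k)\<^sup>n\<close>, which
  rapidly decreasing coefficients can afford. The partial sums being jointly measurable, so is the
  kernel.\<close>

lemma sandwiched_kernel_bound:
  assumes B: "represents (\<lambda>u. H (a u)) B" and H: "bounded_symbol (\<lambda>u. H (a u))"
    and sums: "\<And>s. 0 \<le> s \<Longrightarrow> s \<le> 1 \<Longrightarrow> (\<lambda>k. c k * of_real (chebyshev k s)) sums H s"
    and c: "summable (\<lambda>k. cmod (c k) * (1 + real k) ^ n)"
    and G: "\<And>k R. 0 \<le> R \<Longrightarrow> min 1 (growth ^ k * exp (- \<eta> * R)) * (1 + R) ^ n \<le> G * (1 + real k) ^ n"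
  shows "(\<lambda>(x, y). sandwiched_kernel B x y) \<in> borel_measurable (\<mu> \<Otimes>\<^sub>M \<mu>)"
    and "cmod (sandwiched_kernel B x y) \<le> 2 * N\<^sup>2 * M * G * (\<Sum>k. cmod (c k) * (1 + real k) ^ n)
      / (sqrt (V x * V y) * (1 + dist x y / r) ^ n)"
proof -
  have c': "summable (\<lambda>k. cmod (c k))"
  proof (rule summable_comparison_test'[OF c])
    fix k
    have "cmod (c k) * 1 \<le> cmod (c k) * (1 + real k) ^ n"
      by (intro mult_left_mono one_le_power) auto
    then show "norm (cmod (c k)) \<le> cmod (c k) * (1 + real k) ^ n" by simp
  qed
  note exp = chebyshev_expansion_inner[OF B H c' sums column_L2 column_L2]
  have "(\<lambda>u. \<Sum>k. c k * l2_inner \<mu> (cheb_op k (column (snd u))) (column (fst u))) \<in> borel_measurable (\<mu> \<Otimes>\<^sub>M \<mu>)"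
    using cheb_op_inner_measurable unfolding case_prod_beta' by (intro borel_measurable_suminf) auto
  moreover have "(\<Sum>k. c k * l2_inner \<mu> (cheb_op k (column y)) (column x)) = sandwiched_kernel B x y" for x y
    using exp[of y x] by (simp add: sums_iff sandwiched_kernel_def)
  ultimately show "(\<lambda>(x, y). sandwiched_kernel B x y) \<in> borel_measurable (\<mu> \<Otimes>\<^sub>M \<mu>)"
    by (simp add: case_prod_beta')
  define R where "R = dist x y / r"
  define D where "D = 2 * N\<^sup>2 * M / sqrt (V x * V y)"
  have R: "0 \<le> R" using r_pos by (simp add: R_def)
  have D: "0 \<le> D" using M_pos V_pos[of x] V_pos[of y] by (simp add: D_def)
  let ?w = "\<lambda>k. D * (G / (1 + R) ^ n) * (cmod (c k) * (1 + real k) ^ n)"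
  have le: "norm (c k * l2_inner \<mu> (cheb_op k (column y)) (column x)) \<le> ?w k" for k
  proof -
    have "cmod (l2_inner \<mu> (cheb_op k (column y)) (column x)) \<le> D * min 1 (growth ^ k * exp (- \<eta> * R))"
      using cheb_op_inner_bound[of k y x] by (simp only: D_def R_def)
    also have "\<dots> \<le> D * (G * (1 + real k) ^ n / (1 + R) ^ n)"
      using G[OF R, of k] R D by (intro mult_left_mono) (auto simp: field_simps)
    finally have "cmod (c k) * cmod (l2_inner \<mu> (cheb_op k (column y)) (column x))
        \<le> cmod (c k) * (D * (G * (1 + real k) ^ n / (1 + R) ^ n))" by (intro mult_left_mono) auto
    then show ?thesis by (simp add: norm_mult mult_ac)
  qed
  have "sandwiched_kernel B x y = (\<Sum>k. c k * l2_inner \<mu> (cheb_op k (column y)) (column x))"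
    using exp[of y x] by (simp add: sums_iff sandwiched_kernel_def)
  also have "norm \<dots> \<le> (\<Sum>k. ?w k)"
    by (rule norm_suminf_le[OF le summable_mult[OF c]])
  also have "(\<Sum>k. ?w k) = D * (G / (1 + R) ^ n) * (\<Sum>k. cmod (c k) * (1 + real k) ^ n)"
    by (rule suminf_mult[OF c])
  finally show "cmod (sandwiched_kernel B x y) \<le> 2 * N\<^sup>2 * M * G * (\<Sum>k. cmod (c k) * (1 + real k) ^ n)
      / (sqrt (V x * V y) * (1 + dist x y / r) ^ n)"
    by (simp add: D_def R_def mult_ac)
qed

end

section \<open>Continuously differentiable functions of higher order\<close>

text \<open>Derivatives are quantified existentially, so that closure under products and compositions follows
  by a plain induction from the product and chain rules. On open sets they are unique, which is what
  \<open>Ck_on_Un\<close> uses to glue.\<close>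

primrec Ck_on :: "nat \<Rightarrow> real set \<Rightarrow> (real \<Rightarrow> 'b::real_normed_vector) \<Rightarrow> bool" where
  "Ck_on 0 S f \<longleftrightarrow> continuous_on S f"
| "Ck_on (Suc n) S f \<longleftrightarrow> (\<exists>f'. (\<forall>x\<in>S. (f has_vector_derivative f' x) (at x)) \<and> Ck_on n S f')"

lemma Ck_on_SucI:
  "(\<And>x. x \<in> S \<Longrightarrow> (f has_vector_derivative f' x) (at x)) \<Longrightarrow> Ck_on n S f' \<Longrightarrow> Ck_on (Suc n) S f"
  by auto

lemma Ck_on_SucE:
  assumes "Ck_on (Suc n) S f"
  obtains f' where "\<And>x. x \<in> S \<Longrightarrow> (f has_vector_derivative f' x) (at x)" "Ck_on n S f'"
  using assms by auto

lemma Ck_on_cong: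
  assumes "open S" "\<And>x. x \<in> S \<Longrightarrow> f x = g x" "Ck_on n S f"
  shows "Ck_on n S g"
  using assms(3)
proof (cases n)
  case 0
  then show ?thesis using assms(2,3) by (simp cong: continuous_on_cong)
next
  case (Suc m)
  with assms(3) obtain f' where "\<forall>x\<in>S. (f has_vector_derivative f' x) (at x)" "Ck_on m S f'" by auto
  then show ?thesis
    unfolding Suc using assms(1,2)
    by (intro Ck_on_SucI[of S g f']) (auto intro: has_vector_derivative_transform_within_open)
qed

lemma Ck_on_Suc_imp: "Ck_on (Suc n) S f \<Longrightarrow> Ck_on n S f"
proof (induction n arbitrary: f)
  case 0
  then obtain f' where "\<forall>x\<in>S. (f has_vector_derivative f' x) (at x)" by auto
  then show ?case
    by (auto intro!: continuous_at_imp_continuous_on has_vector_derivative_continuous)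
next
  case (Suc n)
  then obtain f' where "\<forall>x\<in>S. (f has_vector_derivative f' x) (at x)" "Ck_on (Suc n) S f'"
    unfolding Ck_on.simps(2)[of "Suc n"] by blast
  with Suc.IH[of f'] show ?case by (intro Ck_on_SucI) auto
qed

lemma Ck_on_continuous: "Ck_on n S f \<Longrightarrow> continuous_on S f"
  by (induction n) (auto dest: Ck_on_Suc_imp simp del: Ck_on.simps(2))

lemma Ck_on_Un:
  assumes "open S" "open S'" "Ck_on n S f" "Ck_on n S' f"
  shows "Ck_on n (S \<union> S') f"
  using assms(3,4)
proof (induction n arbitrary: f)
  case 0
  then show ?case using continuous_on_open_Un[OF assms(1,2)] by simp
next
  case (Suc n)
  from Suc.prems(1) obtain f1 where
    f1: "\<And>x. x \<in> S \<Longrightarrow> (f has_vector_derivative f1 x) (at x)" "Ck_on n S f1" by (rule Ck_on_SucE) blast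
  from Suc.prems(2) obtain f2 where
    f2: "\<And>x. x \<in> S' \<Longrightarrow> (f has_vector_derivative f2 x) (at x)" "Ck_on n S' f2" by (rule Ck_on_SucE) blast
  define f' where "f' x = (if x \<in> S then f1 x else f2 x)" for x
  have eq: "x \<in> S' \<Longrightarrow> f' x = f2 x" for x
    using f1(1)[of x] f2(1)[of x] by (auto simp: f'_def intro: vector_derivative_unique_at)
  have "Ck_on n S f'" by (rule Ck_on_cong[OF assms(1) _ f1(2)]) (simp add: f'_def)
  moreover have "Ck_on n S' f'" by (rule Ck_on_cong[OF assms(2) _ f2(2)]) (simp add: eq)
  ultimately have "Ck_on n (S \<union> S') f'" by (rule Suc.IH)
  moreover have "(f has_vector_derivative f' x) (at x)" if "x \<in> S \<union> S'" for x
    using that f1(1)[of x] f2(1)[of x] eq[of x] by (auto simp: f'_def)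
  ultimately show ?case by (intro Ck_on_SucI)
qed

lemma Ck_on_const: "Ck_on n S (\<lambda>x. c)"
proof (induction n arbitrary: c)
  case (Suc n)
  show ?case by (rule Ck_on_SucI[where f' = "\<lambda>x. 0"]) (use Suc in auto)
qed simp

lemma Ck_on_add: "Ck_on n S f \<Longrightarrow> Ck_on n S g \<Longrightarrow> Ck_on n S (\<lambda>x. f x + g x)"
proof (induction n arbitrary: f g)
  case 0
  then show ?case by (auto intro: continuous_intros)
next
  case (Suc n)
  from Suc.prems(1) obtain f' where
    f': "\<And>x. x \<in> S \<Longrightarrow> (f has_vector_derivative f' x) (at x)" "Ck_on n S f'" by (rule Ck_on_SucE) blast
  from Suc.prems(2) obtain g' where
    g': "\<And>x. x \<in> S \<Longrightarrow> (g has_vector_derivative g' x) (at x)" "Ck_on n S g'" by (rule Ck_on_SucE) blast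
  from Suc.IH[OF f'(2) g'(2)] f'(1) g'(1) show ?case
    by (intro Ck_on_SucI[where f' = "\<lambda>x. f' x + g' x"] has_vector_derivative_add)
qed

lemma Ck_on_bounded_bilinear:
  assumes b: "bounded_bilinear b"
  shows "Ck_on n S f \<Longrightarrow> Ck_on n S g \<Longrightarrow> Ck_on n S (\<lambda>x. b (f x) (g x))"
proof (induction n arbitrary: f g)
  case 0
  then show ?case using bounded_bilinear.continuous_on[OF b] by auto
next
  case (Suc n)
  from Suc.prems(1) obtain f' where
    f': "\<And>x. x \<in> S \<Longrightarrow> (f has_vector_derivative f' x) (at x)" "Ck_on n S f'" by (rule Ck_on_SucE) blast
  from Suc.prems(2) obtain g' where
    g': "\<And>x. x \<in> S \<Longrightarrow> (g has_vector_derivative g' x) (at x)" "Ck_on n S g'" by (rule Ck_on_SucE) blast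
  have "Ck_on n S (\<lambda>x. b (f x) (g' x) + b (f' x) (g x))"
    by (intro Ck_on_add Suc.IH[OF Ck_on_Suc_imp[OF Suc.prems(1)] g'(2)]
        Suc.IH[OF f'(2) Ck_on_Suc_imp[OF Suc.prems(2)]])
  then show ?case
    by (intro Ck_on_SucI[OF bounded_bilinear.has_vector_derivative[OF b f'(1) g'(1)]])
qed

lemmas Ck_on_mult = Ck_on_bounded_bilinear[OF bounded_bilinear_mult]
lemmas Ck_on_scaleR = Ck_on_bounded_bilinear[OF bounded_bilinear_scaleR]

lemma Ck_on_bounded_linear:
  assumes l: "bounded_linear l"
  shows "Ck_on n S f \<Longrightarrow> Ck_on n S (\<lambda>x. l (f x))"
proof (induction n arbitrary: f)
  case 0
  then show ?case using bounded_linear.continuous_on[OF l] by auto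
next
  case (Suc n)
  from Suc.prems obtain f' where
    f': "\<And>x. x \<in> S \<Longrightarrow> (f has_vector_derivative f' x) (at x)" "Ck_on n S f'" by (rule Ck_on_SucE) blast
  show ?case
    by (intro Ck_on_SucI[OF bounded_linear.has_vector_derivative[OF l f'(1)]] Suc.IH[OF f'(2)])
qed

lemma Ck_on_compose:
  assumes "Ck_on n U f" "Ck_on n S g" "\<And>x. x \<in> S \<Longrightarrow> g x \<in> U"
  shows "Ck_on n S (\<lambda>x. f (g x))"
  using assms
proof (induction n arbitrary: f g)
  case 0
  then show ?case by (auto intro: continuous_on_compose2)
next
  case (Suc n)
  from Suc.prems(1) obtain f' where
    f': "\<And>x. x \<in> U \<Longrightarrow> (f has_vector_derivative f' x) (at x)" "Ck_on n U f'" by (rule Ck_on_SucE) blast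
  from Suc.prems(2) obtain g' where
    g': "\<And>x. x \<in> S \<Longrightarrow> (g has_vector_derivative g' x) (at x)" "Ck_on n S g'" by (rule Ck_on_SucE) blast
  have "Ck_on n S (\<lambda>x. f' (g x))"
    by (rule Suc.IH[OF f'(2) Ck_on_Suc_imp[OF Suc.prems(2)] Suc.prems(3)])
  then have "Ck_on n S (\<lambda>x. g' x *\<^sub>R f' (g x))" by (rule Ck_on_scaleR[OF g'(2)])
  moreover have "((\<lambda>x. f (g x)) has_vector_derivative g' x *\<^sub>R f' (g x)) (at x)" if "x \<in> S" for x
    using vector_diff_chain_at[OF g'(1)[OF that] f'(1)[OF Suc.prems(3)[OF that]]] by (simp add: o_def)
  ultimately show ?case by (intro Ck_on_SucI)
qed

lemma Ck_on_sin_cos: "Ck_on n UNIV (sin :: real \<Rightarrow> real) \<and> Ck_on n UNIV (cos :: real \<Rightarrow> real)"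
proof (induction n)
  case (Suc n)
  then have "Ck_on n UNIV (\<lambda>x::real. (- 1) * sin x)" by (intro Ck_on_mult Ck_on_const) auto
  with Suc show ?case
    by (intro conjI Ck_on_SucI[where f' = cos] Ck_on_SucI[where f' = "\<lambda>x. (- 1) * sin x"])
      (auto intro!: derivative_eq_intros simp flip: has_real_derivative_iff_has_vector_derivative)
qed (auto intro: continuous_intros)

lemma Ck_on_inverse: "Ck_on n {0<..} (inverse :: real \<Rightarrow> real)"
proof (induction n)
  case (Suc n)
  then have "Ck_on n {0<..} (\<lambda>x::real. (- 1) * (inverse x * inverse x))"
    by (intro Ck_on_mult Ck_on_const) auto
  then show ?case
    by (intro Ck_on_SucI[where f' = "\<lambda>x. (- 1) * (inverse x * inverse x)"])
      (auto intro!: derivative_eq_intros simp flip: has_real_derivative_iff_has_vector_derivative)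
qed (auto intro: continuous_intros)

lemma Ck_on_ln: "Ck_on n {0<..} (ln :: real \<Rightarrow> real)"
proof (cases n)
  case (Suc m)
  show ?thesis unfolding Suc
    by (rule Ck_on_SucI[where f' = inverse])
      (auto intro!: derivative_eq_intros Ck_on_inverse
        simp flip: has_real_derivative_iff_has_vector_derivative simp: divide_inverse)
qed (auto intro: continuous_intros)

lemma Ck_on_sqrt: "Ck_on n {0<..} sqrt"
proof (induction n)
  case (Suc n)
  have "Ck_on n {0<..} (\<lambda>x. inverse (sqrt x))"
    by (rule Ck_on_compose[OF Ck_on_inverse Suc]) simp
  then have "Ck_on n {0<..} (\<lambda>x. (1/2) * inverse (sqrt x))"
    by (intro Ck_on_mult Ck_on_const)
  moreover have "(sqrt has_vector_derivative (1/2) * inverse (sqrt x)) (at x)" if "x \<in> {0<..}" for x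
    using DERIV_real_sqrt[of x] that by (simp flip: has_real_derivative_iff_has_vector_derivative)
  ultimately show ?case by (intro Ck_on_SucI)
qed (auto intro: continuous_intros)

section \<open>Rapidly convergent Chebyshev expansions\<close>

lemma integral_period_derivative:
  fixes f f' :: "real \<Rightarrow> real"
  assumes "\<And>x. (f has_real_derivative f' x) (at x)" "f (2 * pi) = f 0"
  shows "(f' has_integral 0) {0..2*pi}"
  using fundamental_theorem_of_calculus[of 0 "2 * pi" f f'] assms
  by (auto simp flip: has_real_derivative_iff_has_vector_derivative intro: has_field_derivative_at_within)

lemma periodic_derivative:
  fixes h h' :: "real \<Rightarrow> real"
  assumes "\<And>x. (h has_vector_derivative h' x) (at x)" "\<And>x. h (x + 2 * pi) = h x"
  shows "h' (x + 2 * pi) = h' x"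
proof (rule vector_derivative_unique_at)
  show "(h has_vector_derivative h' x) (at x)" by (rule assms)
  have "((h \<circ> (\<lambda>x. x + 2 * pi)) has_vector_derivative 1 *\<^sub>R h' (x + 2 * pi)) (at x)"
    by (rule vector_diff_chain_at) (auto intro!: derivative_eq_intros assms)
  then show "(h has_vector_derivative h' (x + 2 * pi)) (at x)"
    by (simp add: o_def assms(2))
qed

text \<open>Each derivative gains a factor \<open>1/k\<close>: the derivative of a periodic function integrates to
  zero over a period, and this is applied to \<open>h \<cdot> sin (k \<theta>)\<close> and \<open>h \<cdot> cos (k \<theta>)\<close>.\<close>

lemma fourier_coefficient_decay:
  fixes h :: "real \<Rightarrow> real"
  assumes "Ck_on n UNIV h" "\<And>x. h (x + 2 * pi) = h x"
  shows "\<exists>C. \<forall>k\<ge>1. \<bar>integral {0..2*pi} (\<lambda>x. h x * cos (real k * x))\<bar> \<le> C / real k ^ n \<and>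
    \<bar>integral {0..2*pi} (\<lambda>x. h x * sin (real k * x))\<bar> \<le> C / real k ^ n"
  using assms
proof (induction n arbitrary: h)
  case 0
  then have h: "continuous_on {0..2*pi} h" by (auto intro: continuous_on_subset)
  define C where "C = integral {0..2*pi} (\<lambda>x. \<bar>h x\<bar>)"
  have bound: "\<bar>integral {0..2*pi} (\<lambda>x. h x * w x)\<bar> \<le> C"
    if w: "continuous_on {0..2*pi} w" "\<And>x. \<bar>w x\<bar> \<le> 1" for w
  proof -
    have "norm (integral {0..2*pi} (\<lambda>x. h x * w x)) \<le> C"
      unfolding C_def
    proof (rule Henstock_Kurzweil_Integration.integral_norm_bound_integral)
      show "norm (h x * w x) \<le> \<bar>h x\<bar>" for x
        using w(2)[of x] by (simp add: abs_mult mult_left_le)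
    qed (use h w in \<open>auto intro!: integrable_continuous_interval continuous_intros\<close>)
    then show ?thesis by simp
  qed
  show ?case
    by (rule exI[of _ C]) (auto intro!: bound continuous_intros)
next
  case (Suc n)
  then obtain h' where h': "\<And>x. (h has_vector_derivative h' x) (at x)" "Ck_on n UNIV h'" by auto
  have per: "h' (x + 2 * pi) = h' x" for x by (rule periodic_derivative[OF h'(1) Suc.prems(2)])
  obtain C where C: "\<And>k. k \<ge> 1 \<Longrightarrow> \<bar>integral {0..2*pi} (\<lambda>x. h' x * cos (real k * x))\<bar> \<le> C / real k ^ n \<and>
    \<bar>integral {0..2*pi} (\<lambda>x. h' x * sin (real k * x))\<bar> \<le> C / real k ^ n"
    using Suc.IH[OF h'(2) per] by blast
  have ch: "continuous_on {0..2*pi} h" "continuous_on {0..2*pi} h'"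
    using Ck_on_continuous[OF Suc.prems(1)] Ck_on_continuous[OF h'(2)] by (auto intro: continuous_on_subset)
  have dh: "(h has_real_derivative h' x) (at x)" for x
    using h'(1) by (simp add: has_real_derivative_iff_has_vector_derivative)
  have h0: "h (2 * pi) = h 0" using Suc.prems(2)[of 0] by simp
  have "\<bar>integral {0..2*pi} (\<lambda>x. h x * cos (real k * x))\<bar> \<le> C / real k ^ Suc n \<and>
      \<bar>integral {0..2*pi} (\<lambda>x. h x * sin (real k * x))\<bar> \<le> C / real k ^ Suc n" if k: "k \<ge> 1" for k
  proof -
    let ?c = "\<lambda>x. cos (real k * x)" and ?s = "\<lambda>x. sin (real k * x)"
    have trig: "sin (real k * (2 * pi)) = 0" "cos (real k * (2 * pi)) = 1"
      using sin_npi[of "2 * k"] cos_2npi[of k] by (simp_all add: mult_ac)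
    have int: "(\<lambda>x. h x * ?c x) integrable_on {0..2*pi}" "(\<lambda>x. h' x * ?s x) integrable_on {0..2*pi}"
      "(\<lambda>x. h x * ?s x) integrable_on {0..2*pi}" "(\<lambda>x. h' x * ?c x) integrable_on {0..2*pi}"
      using ch by (auto intro!: integrable_continuous_interval continuous_intros)
    have "((\<lambda>x. h' x * ?s x + real k * (h x * ?c x)) has_integral 0) {0..2*pi}"
      by (rule integral_period_derivative[where f = "\<lambda>x. h x * ?s x"])
        (use h0 trig in \<open>auto intro!: derivative_eq_intros dh simp: algebra_simps\<close>)
    moreover have "((\<lambda>x. h' x * ?s x + real k * (h x * ?c x)) has_integral
        (integral {0..2*pi} (\<lambda>x. h' x * ?s x) + real k * integral {0..2*pi} (\<lambda>x. h x * ?c x))) {0..2*pi}"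
      by (intro has_integral_add has_integral_mult_right integrable_integral int)
    ultimately have "integral {0..2*pi} (\<lambda>x. h' x * ?s x) + real k * integral {0..2*pi} (\<lambda>x. h x * ?c x) = 0"
      by (rule has_integral_unique[symmetric])
    then have c: "real k * integral {0..2*pi} (\<lambda>x. h x * ?c x) = - integral {0..2*pi} (\<lambda>x. h' x * ?s x)"
      by linarith
    have "((\<lambda>x. h' x * ?c x - real k * (h x * ?s x)) has_integral 0) {0..2*pi}"
      by (rule integral_period_derivative[where f = "\<lambda>x. h x * ?c x"])
        (use h0 trig in \<open>auto intro!: derivative_eq_intros dh simp: algebra_simps\<close>)
    moreover have "((\<lambda>x. h' x * ?c x - real k * (h x * ?s x)) has_integral
        (integral {0..2*pi} (\<lambda>x. h' x * ?c x) - real k * integral {0..2*pi} (\<lambda>x. h x * ?s x))) {0..2*pi}"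
      by (intro has_integral_diff has_integral_mult_right integrable_integral int)
    ultimately have "integral {0..2*pi} (\<lambda>x. h' x * ?c x) - real k * integral {0..2*pi} (\<lambda>x. h x * ?s x) = 0"
      by (rule has_integral_unique[symmetric])
    then have s: "real k * integral {0..2*pi} (\<lambda>x. h x * ?s x) = integral {0..2*pi} (\<lambda>x. h' x * ?c x)"
      by linarith
    have div: "\<bar>I\<bar> \<le> C / real k ^ Suc n" if "\<bar>real k * I\<bar> \<le> C / real k ^ n" for I
      using that k by (simp add: abs_mult field_simps)
    show ?thesis using C[OF k] by (intro conjI div) (simp_all add: c s)
  qed
  then show ?case by blast
qed

text \<open>By the product formula for cosines, orthogonality to all \<open>cos (m \<theta>)\<close> implies orthogonality to
  all polynomials in \<open>cos \<theta>\<close>, in particular to the Bernstein polynomials that approximate \<open>g\<close>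
  itself.\<close>

lemma zero_of_orthogonal_cos:
  fixes g :: "real \<Rightarrow> real"
  assumes g: "continuous_on {0..1} g"
    and orth: "\<And>m. integral {0..2*pi} (\<lambda>\<theta>. g ((1 + cos \<theta>) / 2) * cos (real m * \<theta>)) = 0"
    and s: "0 \<le> s" "s \<le> 1"
  shows "g s = 0"
proof -
  let ?I = "{0..2*pi}"
  define \<sigma> where "\<sigma> \<theta> = (1 + cos \<theta>) / 2" for \<theta> :: real
  have \<sigma>: "\<sigma> \<theta> \<in> {0..1}" for \<theta>
  proof -
    have "0 \<le> 1 + cos \<theta>" "1 + cos \<theta> \<le> 2"
      using cos_ge_minus_one[of \<theta>] cos_le_one[of \<theta>] by linarith+
    then show ?thesis by (simp add: \<sigma>_def)
  qed
  have \<sigma>_cont [continuous_intros]: "continuous_on A \<sigma>" for A unfolding \<sigma>_def by (intro continuous_intros) simp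
  have F_cont [continuous_intros]: "continuous_on A (\<lambda>\<theta>. g (\<sigma> \<theta>))" for A
    by (rule continuous_on_compose2[OF g \<sigma>_cont]) (use \<sigma> in auto)
  define V where "V = {w. continuous_on ?I w \<and> (\<forall>m. integral ?I (\<lambda>\<theta>. g (\<sigma> \<theta>) * w \<theta> * cos (real m * \<theta>)) = 0)}"
  have int: "(\<lambda>\<theta>. g (\<sigma> \<theta>) * w \<theta> * cos (real m * \<theta>)) integrable_on ?I" if "continuous_on ?I w" for w m
    using that by (auto intro!: integrable_continuous_interval continuous_intros)
  have V_lin: "(\<lambda>\<theta>. a * w \<theta> + b * v \<theta>) \<in> V" if "w \<in> V" "v \<in> V" for w v a b
  proof -
    have "integral ?I (\<lambda>\<theta>. g (\<sigma> \<theta>) * (a * w \<theta> + b * v \<theta>) * cos (real m * \<theta>)) = 0" for m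
    proof -
      have "integral ?I (\<lambda>\<theta>. g (\<sigma> \<theta>) * (a * w \<theta> + b * v \<theta>) * cos (real m * \<theta>))
        = integral ?I (\<lambda>\<theta>. a * (g (\<sigma> \<theta>) * w \<theta> * cos (real m * \<theta>)) + b * (g (\<sigma> \<theta>) * v \<theta> * cos (real m * \<theta>)))"
        by (intro Henstock_Kurzweil_Integration.integral_cong) (simp add: algebra_simps)
      also have "\<dots> = 0"
        using that int[of w m] int[of v m]
        by (subst Henstock_Kurzweil_Integration.integral_add) (auto simp: V_def integrable_on_mult_right)
      finally show ?thesis .
    qed
    then show ?thesis using that by (auto simp: V_def intro!: continuous_intros)
  qed
  have V_one: "(\<lambda>\<theta>. 1) \<in> V" using orth by (simp add: V_def \<sigma>_def)
  have V_cos: "(\<lambda>\<theta>. cos \<theta> * w \<theta>) \<in> V" if w: "w \<in> V" for w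
  proof -
    have "integral ?I (\<lambda>\<theta>. g (\<sigma> \<theta>) * (cos \<theta> * w \<theta>) * cos (real m * \<theta>)) = 0" for m
    proof (cases m)
      case 0
      have "integral ?I (\<lambda>\<theta>. g (\<sigma> \<theta>) * w \<theta> * cos (real 1 * \<theta>)) = 0" using w unfolding V_def by blast
      then show ?thesis using 0 by (simp add: mult_ac)
    next
      case (Suc l)
      have prod: "cos \<theta> * cos (real m * \<theta>) = (1/2) * cos (real (Suc m) * \<theta>) + (1/2) * cos (real l * \<theta>)" for \<theta>
      proof -
        have "cos (real (Suc m) * \<theta>) = cos (real m * \<theta> + \<theta>)" "cos (real l * \<theta>) = cos (real m * \<theta> - \<theta>)"
          using Suc by (simp_all add: algebra_simps)
        then show ?thesis by (simp add: cos_add cos_diff add_divide_distrib diff_divide_distrib)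
      qed
      have "integral ?I (\<lambda>\<theta>. g (\<sigma> \<theta>) * (cos \<theta> * w \<theta>) * cos (real m * \<theta>))
        = integral ?I (\<lambda>\<theta>. (1/2) * (g (\<sigma> \<theta>) * w \<theta> * cos (real (Suc m) * \<theta>))
            + (1/2) * (g (\<sigma> \<theta>) * w \<theta> * cos (real l * \<theta>)))"
      proof (intro Henstock_Kurzweil_Integration.integral_cong)
        fix \<theta>
        have "g (\<sigma> \<theta>) * (cos \<theta> * w \<theta>) * cos (real m * \<theta>) = g (\<sigma> \<theta>) * w \<theta> * (cos \<theta> * cos (real m * \<theta>))"
          by simp
        then show "g (\<sigma> \<theta>) * (cos \<theta> * w \<theta>) * cos (real m * \<theta>) =
          (1/2) * (g (\<sigma> \<theta>) * w \<theta> * cos (real (Suc m) * \<theta>)) + (1/2) * (g (\<sigma> \<theta>) * w \<theta> * cos (real l * \<theta>))"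
          unfolding prod by (simp only: distrib_left mult_ac)
      qed
      also have "\<dots> = (1/2) * integral ?I (\<lambda>\<theta>. g (\<sigma> \<theta>) * w \<theta> * cos (real (Suc m) * \<theta>))
          + (1/2) * integral ?I (\<lambda>\<theta>. g (\<sigma> \<theta>) * w \<theta> * cos (real l * \<theta>))"
        using w int[of w "Suc m"] int[of w l]
        by (subst Henstock_Kurzweil_Integration.integral_add)
          (simp_all only: V_def mem_Collect_eq integrable_on_mult_right integral_mult_right)
      also have "\<dots> = 0" using w by (simp only: V_def mem_Collect_eq mult_zero_right add_0)
      finally show ?thesis .
    qed
    moreover have "continuous_on ?I (\<lambda>\<theta>. cos \<theta> * w \<theta>)" using w by (auto simp: V_def intro!: continuous_intros)
    ultimately show ?thesis by (simp add: V_def)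
  qed
  have V_\<sigma>: "(\<lambda>\<theta>. \<sigma> \<theta> * w \<theta>) \<in> V" "(\<lambda>\<theta>. (1 - \<sigma> \<theta>) * w \<theta>) \<in> V" if w: "w \<in> V" for w
    using V_lin[OF w V_cos[OF w], of "1/2" "1/2"] V_lin[OF w V_cos[OF w], of "1/2" "-1/2"]
    by (simp_all add: \<sigma>_def field_simps)
  have V_pow: "(\<lambda>\<theta>. \<sigma> \<theta> ^ i * (1 - \<sigma> \<theta>) ^ j) \<in> V" for i j
  proof (induction i)
    case 0
    show ?case
    proof (induction j)
      case (Suc j)
      then show ?case using V_\<sigma>(2)[OF Suc] by simp
    qed (use V_one in simp)
  next
    case (Suc i)
    then show ?case using V_\<sigma>(1)[OF Suc] by (simp add: mult.assoc)
  qed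
  have V_sum: "(\<lambda>\<theta>. \<Sum>k\<le>(l::nat). c k * w k \<theta>) \<in> V" if "\<And>k. w k \<in> V" for l c w
  proof (induction l)
    case 0
    show ?case using V_lin[OF that[of 0] that[of 0], of "c 0" 0] by simp
  next
    case (Suc l)
    show ?case using V_lin[OF Suc that[of "Suc l"], of 1 "c (Suc l)"] by simp
  qed
  obtain B where B: "\<forall>s\<in>{0..1}. \<bar>g s\<bar> \<le> B"
    using compact_imp_bounded[OF compact_continuous_image[OF g compact_Icc]]
    by (auto simp: bounded_iff)
  have "\<bar>integral ?I (\<lambda>\<theta>. (g (\<sigma> \<theta>))\<^sup>2)\<bar> \<le> 0"
  proof (rule field_le_epsilon)
    fix e :: real assume e: "0 < e"
    have Bpos: "0 < \<bar>B\<bar> + 1" by simp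
    define d where "d = e / (2 * pi * (\<bar>B\<bar> + 1))"
    have d: "d > 0" using e by (simp add: d_def)
    then obtain N where N: "\<And>x. x \<in> {0..1} \<Longrightarrow> \<bar>g x - (\<Sum>k\<le>N. g (k / N) * Bernstein N k x)\<bar> < d"
      using Bernstein_Weierstrass[OF g d] by blast
    define w where "w \<theta> = (\<Sum>k\<le>N. (g (k / N) * real (N choose k)) * (\<sigma> \<theta> ^ k * (1 - \<sigma> \<theta>) ^ (N - k)))" for \<theta>
    have w: "w \<in> V" unfolding w_def by (rule V_sum[OF V_pow])
    have "integral ?I (\<lambda>\<theta>. g (\<sigma> \<theta>) * w \<theta> * cos (real 0 * \<theta>)) = 0" using w unfolding V_def by blast
    then have w0: "integral ?I (\<lambda>\<theta>. g (\<sigma> \<theta>) * w \<theta>) = 0" by simp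
    have wc: "continuous_on ?I w" using w by (simp add: V_def)
    have "integral ?I (\<lambda>\<theta>. (g (\<sigma> \<theta>))\<^sup>2) = integral ?I (\<lambda>\<theta>. (g (\<sigma> \<theta>))\<^sup>2 - g (\<sigma> \<theta>) * w \<theta>)"
      using wc by (subst Henstock_Kurzweil_Integration.integral_diff)
        (auto intro!: integrable_continuous_interval continuous_intros simp: w0)
    also have "norm \<dots> \<le> integral ?I (\<lambda>\<theta>. (\<bar>B\<bar> + 1) * d)"
    proof (rule Henstock_Kurzweil_Integration.integral_norm_bound_integral)
      fix \<theta> :: real
      have "g (\<sigma> \<theta>) - w \<theta> = g (\<sigma> \<theta>) - (\<Sum>k\<le>N. g (k / N) * Bernstein N k (\<sigma> \<theta>))"
        by (simp add: w_def Bernstein_def mult.assoc)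
      then have "\<bar>g (\<sigma> \<theta>) - w \<theta>\<bar> \<le> d" using N[OF \<sigma>[of \<theta>]] by simp
      moreover have "\<bar>g (\<sigma> \<theta>)\<bar> \<le> \<bar>B\<bar> + 1" using bspec[OF B \<sigma>[of \<theta>]] by linarith
      ultimately have "\<bar>g (\<sigma> \<theta>)\<bar> * \<bar>g (\<sigma> \<theta>) - w \<theta>\<bar> \<le> (\<bar>B\<bar> + 1) * d" by (intro mult_mono) auto
      then show "norm ((g (\<sigma> \<theta>))\<^sup>2 - g (\<sigma> \<theta>) * w \<theta>) \<le> (\<bar>B\<bar> + 1) * d"
        by (simp add: power2_eq_square flip: right_diff_distrib abs_mult)
    qed (use wc in \<open>auto intro!: integrable_continuous_interval continuous_intros\<close>)
    also have "\<dots> = e" using Bpos by (simp add: d_def)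
    finally show "\<bar>integral ?I (\<lambda>\<theta>. (g (\<sigma> \<theta>))\<^sup>2)\<bar> \<le> 0 + e" by simp
  qed
  then have "integral ?I (\<lambda>\<theta>. (g (\<sigma> \<theta>))\<^sup>2) = 0" by simp
  moreover have "continuous_on ?I (\<lambda>\<theta>. (g (\<sigma> \<theta>))\<^sup>2)" by (intro continuous_intros)
  ultimately have zero: "\<forall>\<theta>\<in>?I. (g (\<sigma> \<theta>))\<^sup>2 = 0" by (subst (asm) integral_eq_0_iff) auto
  have "arccos (2 * s - 1) \<in> ?I"
    using s arccos_lbound[of "2 * s - 1"] arccos_ubound[of "2 * s - 1"] by auto
  then have "g (\<sigma> (arccos (2 * s - 1))) = 0" using zero by simp
  then show ?thesis unfolding \<sigma>_def unit_interval_cos[OF s, symmetric] .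
qed

lemma integral_cos_cos:
  fixes k m :: nat
  shows "integral {0..2*pi} (\<lambda>\<theta>. cos (real k * \<theta>) * cos (real m * \<theta>))
    = (if k = m then if m = 0 then 2 * pi else pi else 0)"
proof -
  have zero: "integral {0..2*pi} (\<lambda>\<theta>. cos (real_of_int z * \<theta>)) = 0" if "z \<noteq> 0" for z
  proof -
    have "((\<lambda>\<theta>. cos (real_of_int z * \<theta>)) has_integral 0) {0..2*pi}"
    proof (rule integral_period_derivative[where f = "\<lambda>\<theta>. sin (real_of_int z * \<theta>) / of_int z"])
      show "sin (real_of_int z * (2 * pi)) / real_of_int z = sin (real_of_int z * 0) / real_of_int z"
        using sin_zero_iff_int2[of "real_of_int z * (2 * pi)"]
        by (auto intro!: exI[of _ "2 * z"])
    qed (use that in \<open>auto intro!: derivative_eq_intros\<close>)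
    then show ?thesis by (simp add: has_integral_iff)
  qed
  have const: "integral {0..2*pi} (\<lambda>\<theta>. cos (real_of_int z * \<theta>)) = (if z = 0 then 2 * pi else 0)" for z
    using zero[of z] by simp
  have "integral {0..2*pi} (\<lambda>\<theta>. cos (real k * \<theta>) * cos (real m * \<theta>))
    = integral {0..2*pi} (\<lambda>\<theta>. (1/2) * cos (real_of_int (int k - int m) * \<theta>) + (1/2) * cos (real_of_int (int k + int m) * \<theta>))"
    by (intro Henstock_Kurzweil_Integration.integral_cong)
      (simp add: left_diff_distrib distrib_right cos_add cos_diff add_divide_distrib diff_divide_distrib)
  also have "\<dots> = (1/2) * integral {0..2*pi} (\<lambda>\<theta>. cos (real_of_int (int k - int m) * \<theta>))
      + (1/2) * integral {0..2*pi} (\<lambda>\<theta>. cos (real_of_int (int k + int m) * \<theta>))"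
    by (subst Henstock_Kurzweil_Integration.integral_add)
      (auto intro!: integrable_continuous_interval continuous_intros simp del: of_int_diff of_int_add)
  also have "\<dots> = (if k = m then if m = 0 then 2 * pi else pi else 0)"
    unfolding const by auto
  finally show ?thesis .
qed

text \<open>Substituting \<open>s = (1 + cos \<theta>) / 2\<close> turns the expansion into the cosine series of a smooth
  periodic function. Its coefficients decay faster than any power; the difference of the function
  and the sum of the series has vanishing cosine coefficients and is therefore zero.\<close>

lemma chebyshev_expansion_real:
  fixes H :: "real \<Rightarrow> real"
  assumes H: "\<And>n. Ck_on n UNIV H"
  shows "\<exists>c. (\<forall>n. summable (\<lambda>k. \<bar>c k\<bar> * (1 + real k) ^ n)) \<and>
    (\<forall>s\<in>{0..1}. (\<lambda>k. c k * chebyshev k s) sums H s)"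
proof -
  let ?I = "{0..2*pi}"
  define h where "h \<theta> = H ((1 + cos \<theta>) / 2)" for \<theta>
  define i where "i k = integral ?I (\<lambda>\<theta>. h \<theta> * cos (real k * \<theta>))" for k :: nat
  define c where "c k = i k / (if k = 0 then 2 * pi else pi)" for k
  have "Ck_on n UNIV (\<lambda>\<theta>. (1 + cos \<theta>) / 2)" for n
    using Ck_on_mult[OF Ck_on_const[of n UNIV "1/2"] Ck_on_add[OF Ck_on_const[of n UNIV 1] conjunct2[OF Ck_on_sin_cos[of n]]]]
    by (simp add: field_simps)
  then have h: "Ck_on n UNIV h" for n
    unfolding h_def by (rule Ck_on_compose[OF H]) auto
  have h_per: "h (x + 2 * pi) = h x" for x by (simp add: h_def)
  have h_cont [continuous_intros]: "continuous_on A h" for A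
    using Ck_on_continuous[OF h[of 0]] by (rule continuous_on_subset) simp
  have sum: "summable (\<lambda>k. \<bar>c k\<bar> * (1 + real k) ^ n)" for n
  proof -
    obtain C where C: "\<And>k. k \<ge> 1 \<Longrightarrow> \<bar>i k\<bar> \<le> C / real k ^ (n + 2)"
      using fourier_coefficient_decay[OF h h_per, of "n + 2"] unfolding i_def by blast
    show ?thesis
    proof (rule summable_comparison_test'[of "\<lambda>k. C * 2 ^ n * inverse (real k ^ 2)" 1])
      show "summable (\<lambda>k. C * 2 ^ n * inverse (real k ^ 2))"
        by (intro summable_mult inverse_power_summable) simp
      fix k :: nat assume k: "1 \<le> k"
      have "\<bar>c k\<bar> \<le> \<bar>i k\<bar>"
        using k pi_gt3 mult_left_mono[of 1 pi "\<bar>i k\<bar>"] by (simp add: c_def divide_le_eq)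
      also have "\<dots> \<le> C / real k ^ (n + 2)" by (rule C[OF k])
      finally have "\<bar>c k\<bar> * (1 + real k) ^ n \<le> C / real k ^ (n + 2) * (2 * real k) ^ n"
        using k by (intro mult_mono power_mono) auto
      also have "\<dots> = C * 2 ^ n * inverse (real k ^ 2)"
        using k by (simp add: power_add power_mult_distrib power2_eq_square field_simps)
      finally show "norm (\<bar>c k\<bar> * (1 + real k) ^ n) \<le> C * 2 ^ n * inverse (real k ^ 2)" by simp
    qed
  qed
  have sum0: "summable (\<lambda>k. \<bar>c k\<bar>)" using sum[of 0] by simp
  have conv: "uniform_limit {0..1} (\<lambda>n s. \<Sum>k<n. c k * chebyshev k s) (\<lambda>s. \<Sum>k. c k * chebyshev k s) sequentially"
    by (rule Weierstrass_m_test[OF _ sum0]) (auto simp: abs_mult abs_chebyshev_le_1 mult_left_le)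
  have cheb_cont: "continuous_on A (chebyshev k)" for A k
    by (induction k "0::real" rule: chebyshev.induct) (auto intro!: continuous_intros simp: fun_eq_iff cong: continuous_on_cong)
  define g where "g s = H s - (\<Sum>k. c k * chebyshev k s)" for s
  have "continuous_on {0..1} (\<lambda>s. \<Sum>k. c k * chebyshev k s)"
    by (rule uniform_limit_theorem[OF always_eventually conv]) (auto intro!: continuous_intros cheb_cont)
  moreover have "continuous_on {0..1} H"
    using Ck_on_continuous[OF H[of 0]] by (rule continuous_on_subset) simp
  ultimately have g: "continuous_on {0..1} g" unfolding g_def by (intro continuous_intros)
  have "integral ?I (\<lambda>\<theta>. g ((1 + cos \<theta>) / 2) * cos (real m * \<theta>)) = 0" for m
  proof -
    have conv': "uniform_limit ?I (\<lambda>n \<theta>. \<Sum>k<n. c k * cos (real k * \<theta>) * cos (real m * \<theta>))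
        (\<lambda>\<theta>. \<Sum>k. c k * cos (real k * \<theta>) * cos (real m * \<theta>)) sequentially"
      by (rule Weierstrass_m_test[OF _ sum0])
        (auto simp: abs_mult mult.assoc intro!: mult_left_le mult_le_one)
    obtain I J where I: "\<And>n. ((\<lambda>\<theta>. \<Sum>k<n. c k * cos (real k * \<theta>) * cos (real m * \<theta>)) has_integral I n) ?I"
      and J: "((\<lambda>\<theta>. \<Sum>k. c k * cos (real k * \<theta>) * cos (real m * \<theta>)) has_integral J) ?I" and lim: "I \<longlonglongrightarrow> J"
      by (rule uniform_limit_integral[OF conv']) (auto intro!: continuous_intros)
    have In: "I n = (\<Sum>k<n. if k = m then i m else 0)" for n
    proof -
      have "I n = (\<Sum>k<n. integral ?I (\<lambda>\<theta>. c k * cos (real k * \<theta>) * cos (real m * \<theta>)))"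
        using I[of n] by (subst Henstock_Kurzweil_Integration.integral_sum[symmetric])
          (auto intro!: integrable_continuous_interval continuous_intros simp: has_integral_iff)
      also have "\<dots> = (\<Sum>k<n. if k = m then i m else 0)"
        by (intro sum.cong) (auto simp: mult.assoc integral_cos_cos c_def)
      finally show ?thesis .
    qed
    have "eventually (\<lambda>n. I n = i m) sequentially"
      by (rule eventually_sequentiallyI[of "Suc m"]) (simp add: In)
    then have "I \<longlonglongrightarrow> i m" by (rule tendsto_eventually)
    with lim have "J = i m" by (rule LIMSEQ_unique)
    have hint: "((\<lambda>\<theta>. h \<theta> * cos (real m * \<theta>)) has_integral i m) ?I"
      unfolding i_def by (intro integrable_integral integrable_continuous_interval continuous_intros)
    have "((\<lambda>\<theta>. h \<theta> * cos (real m * \<theta>) - (\<Sum>k. c k * cos (real k * \<theta>) * cos (real m * \<theta>))) has_integral (i m - J)) ?I"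
      by (rule has_integral_diff[OF hint J])
    moreover have "g ((1 + cos \<theta>) / 2) * cos (real m * \<theta>)
        = h \<theta> * cos (real m * \<theta>) - (\<Sum>k. c k * cos (real k * \<theta>) * cos (real m * \<theta>))" for \<theta>
    proof -
      have "summable (\<lambda>k. c k * cos (real k * \<theta>))"
        by (rule summable_comparison_test'[OF sum0]) (auto simp: abs_mult mult_left_le)
      then show ?thesis
        by (simp add: g_def h_def chebyshev_cos left_diff_distrib suminf_mult2)
    qed
    ultimately show ?thesis using \<open>J = i m\<close> by (simp add: has_integral_iff)
  qed
  then have "g s = 0" if "s \<in> {0..1}" for s
    using zero_of_orthogonal_cos[OF g] that by auto
  moreover have "summable (\<lambda>k. c k * chebyshev k s)" if "s \<in> {0..1}" for s
    using that by (intro summable_comparison_test'[OF sum0]) (auto simp: abs_mult mult_left_le abs_chebyshev_le_1)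
  ultimately have "(\<lambda>k. c k * chebyshev k s) sums H s" if "s \<in> {0..1}" for s
    using that by (auto simp: g_def sums_iff)
  with sum show ?thesis by blast
qed

lemma chebyshev_expansion:
  fixes H :: "real \<Rightarrow> complex"
  assumes H: "\<And>n. Ck_on n UNIV H"
  shows "\<exists>c. (\<forall>n. summable (\<lambda>k. cmod (c k) * (1 + real k) ^ n)) \<and>
    (\<forall>s\<in>{0..1}. (\<lambda>k. c k * of_real (chebyshev k s)) sums H s)"
proof -
  obtain c where c: "\<And>n. summable (\<lambda>k. \<bar>c k\<bar> * (1 + real k) ^ n)"
    "\<And>s. s \<in> {0..1} \<Longrightarrow> (\<lambda>k. c k * chebyshev k s) sums Re (H s)"
    using chebyshev_expansion_real[OF Ck_on_bounded_linear[OF bounded_linear_Re H]] by blast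
  obtain d where d: "\<And>n. summable (\<lambda>k. \<bar>d k\<bar> * (1 + real k) ^ n)"
    "\<And>s. s \<in> {0..1} \<Longrightarrow> (\<lambda>k. d k * chebyshev k s) sums Im (H s)"
    using chebyshev_expansion_real[OF Ck_on_bounded_linear[OF bounded_linear_Im H]] by blast
  show ?thesis
  proof (intro exI[of _ "\<lambda>k. Complex (c k) (d k)"] conjI allI ballI)
    show "summable (\<lambda>k. cmod (Complex (c k) (d k)) * (1 + real k) ^ n)" for n
    proof (rule summable_comparison_test')
      show "summable (\<lambda>k. \<bar>c k\<bar> * (1 + real k) ^ n + \<bar>d k\<bar> * (1 + real k) ^ n)"
        by (rule summable_add[OF c(1) d(1)])
      show "norm (cmod (Complex (c k) (d k)) * (1 + real k) ^ n) \<le> \<bar>c k\<bar> * (1 + real k) ^ n + \<bar>d k\<bar> * (1 + real k) ^ n" for k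
      proof -
        have "cmod (Complex (c k) (d k)) * (1 + real k) ^ n \<le> (\<bar>c k\<bar> + \<bar>d k\<bar>) * (1 + real k) ^ n"
          using cmod_le[of "Complex (c k) (d k)"] by (intro mult_right_mono) auto
        then show ?thesis by (simp add: distrib_right abs_mult)
      qed
    qed
    show "(\<lambda>k. Complex (c k) (d k) * of_real (chebyshev k s)) sums H s" if "s \<in> {0..1}" for s
      using c(2)[OF that] d(2)[OF that] by (intro iffD2[OF sums_complex_iff] conjI) simp_all
  qed
qed

section \<open>Smooth functions on the half-line with compact support away from the origin\<close>

definition zero_extension :: "(real \<Rightarrow> complex) \<Rightarrow> real \<Rightarrow> complex" where
  "zero_extension f x = (if 0 \<le> x then f x else 0)"

lemma half_supp_zero: "half_supp f \<subseteq> A \<Longrightarrow> 0 \<le> x \<Longrightarrow> x \<notin> A \<Longrightarrow> f x = 0"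
  using closure_subset[of "{x. x \<ge> 0 \<and> f x \<noteq> 0}"] by (auto simp: half_supp_def)

lemma half_deriv_Suc: "half_deriv (Suc n) f x = vector_derivative (half_deriv n f) (at x within {0..})"
  by (simp add: half_deriv_def)

lemma at_within_half_line: "0 < x \<Longrightarrow> at x within {0..} = at (x::real)"
  by (rule at_within_interior) (simp add: interior_real_atLeast)

lemma has_vector_derivative_half_deriv:
  assumes "half_smooth f" "0 < x"
  shows "(half_deriv n f has_vector_derivative half_deriv (Suc n) f x) (at x)"
proof -
  have "half_deriv n f differentiable (at x within {0..})"
    using assms by (auto simp: half_smooth_def)
  then show ?thesis
    using assms(2) by (simp add: half_deriv_Suc at_within_half_line vector_derivative_works[symmetric])
qed

text \<open>All one-sided derivatives vanish on \<open>(0, \<alpha>)\<close>, so that cutting them off at \<open>\<alpha>/2\<close> yields a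
  sequence of functions on the whole line, each of which is the derivative of its predecessor.\<close>

lemma Ck_on_zero_extension:
  assumes f: "half_smooth f" and supp: "half_supp f \<subseteq> {\<alpha>..}" and \<alpha>: "0 < \<alpha>"
  shows "Ck_on n UNIV (zero_extension f)"
proof -
  define F where "F n x = (if \<alpha> / 2 < x then half_deriv n f x else 0)" for n x
  have zero: "half_deriv n f x = 0" if "0 < x" "x < \<alpha>" for n x
    using that
  proof (induction n arbitrary: x)
    case 0
    then show ?case using half_supp_zero[OF supp, of x] by (simp add: half_deriv_def)
  next
    case (Suc n)
    have "(half_deriv n f has_vector_derivative 0) (at x)"
      by (rule has_vector_derivative_transform_within_open[of "\<lambda>x. 0" 0 x "{0<..<\<alpha>}"]) (use Suc in auto)
    then show ?case
      using has_vector_derivative_half_deriv[OF f, of x n] Suc.prems vector_derivative_unique_at by blast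
  qed
  have deriv: "(F n has_vector_derivative F (Suc n) x) (at x)" for n x
  proof (cases "\<alpha> / 2 < x")
    case True
    then have "(half_deriv n f has_vector_derivative F (Suc n) x) (at x)"
      using has_vector_derivative_half_deriv[OF f, of x n] \<alpha> by (simp add: F_def)
    then show ?thesis
      by (rule has_vector_derivative_transform_within_open[of _ _ _ "{\<alpha>/2<..}"]) (use True in \<open>auto simp: F_def\<close>)
  next
    case False
    have "(F n has_vector_derivative 0) (at x)"
    proof (rule has_vector_derivative_transform_within_open[of "\<lambda>x. 0" 0 x "{..<\<alpha>}"])
      show "0 = F n y" if "y \<in> {..<\<alpha>}" for y
        using zero[of y n] that \<alpha> by (auto simp: F_def)
    qed (use False \<alpha> in auto)
    then show ?thesis using False by (simp add: F_def)
  qed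
  have "Ck_on n UNIV (F m)" for m
  proof (induction n arbitrary: m)
    case 0
    show ?case using deriv
      by (auto intro!: continuous_at_imp_continuous_on has_vector_derivative_continuous)
  next
    case (Suc n)
    show ?case by (rule Ck_on_SucI[OF deriv Suc])
  qed
  moreover have "F 0 = zero_extension f"
    using half_supp_zero[OF supp] \<alpha> by (auto simp: F_def zero_extension_def half_deriv_def fun_eq_iff)
  ultimately show ?thesis by metis
qed

lemma zero_extension_outside:
  assumes f: "half_smooth f" and supp: "half_supp f \<subseteq> {\<alpha>..\<beta>}" and \<alpha>: "0 < \<alpha>" and x: "\<beta> \<le> x"
  shows "zero_extension f x = 0"
proof (cases "x = \<beta>")
  case False
  then have "x \<notin> {\<alpha>..\<beta>}" using x by auto
  then show ?thesis using half_supp_zero[OF supp, of x] by (simp add: zero_extension_def)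
next
  case True
  \<comment> \<open>At the right end point of the support the value is a limit of zeros from the right.\<close>
  have "Ck_on 0 UNIV (zero_extension f)"
    by (rule Ck_on_zero_extension[OF f _ \<alpha>]) (use supp in auto)
  then have "isCont (zero_extension f) \<beta>" by (simp add: continuous_on_eq_continuous_at)
  then have "(zero_extension f \<longlongrightarrow> zero_extension f \<beta>) (at_right \<beta>)"
    unfolding isCont_def by (rule tendsto_within_subset) simp
  moreover have "(zero_extension f \<longlongrightarrow> 0) (at_right \<beta>)"
  proof (rule tendsto_eventually, unfold eventually_at_right_field, intro exI[of _ "\<beta> + 1"] conjI allI impI)
    fix y assume "\<beta> < y" "y < \<beta> + 1"
    then have "y \<notin> {\<alpha>..\<beta>}" by auto
    then show "zero_extension f y = 0" using half_supp_zero[OF supp, of y] by (simp add: zero_extension_def)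
  qed simp
  ultimately have "zero_extension f \<beta> = 0" by (intro tendsto_unique[of "at_right \<beta>"]) auto
  then show ?thesis using True by simp
qed

lemma zero_extension_left:
  assumes "half_supp f \<subseteq> {\<alpha>..\<beta>}" "x < \<alpha>"
  shows "zero_extension f x = 0"
  using half_supp_zero[OF assms(1), of x] assms(2) by (auto simp: zero_extension_def)

text \<open>The square root is smooth away from \<open>0\<close>, and near \<open>0\<close> the factor \<open>\<phi>\<close> vanishes.\<close>

lemma Ck_on_sqrt_product:
  assumes \<phi>: "\<And>n. Ck_on n UNIV \<phi>" and \<psi>: "\<And>n. Ck_on n UNIV \<psi>"
    and zero: "\<And>x. x < \<alpha> \<Longrightarrow> \<phi> x = 0" and \<alpha>: "0 < \<alpha>" and a: "0 < a"
  shows "Ck_on n UNIV (\<lambda>u. \<phi> (a * sqrt u) * \<psi> (b * sqrt u) :: complex)"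
proof -
  have sq: "Ck_on n {0<..} (\<lambda>u. d * sqrt u)" for d
    by (rule Ck_on_mult[OF Ck_on_const Ck_on_sqrt])
  have "Ck_on n {0<..} (\<lambda>u. \<phi> (a * sqrt u) * \<psi> (b * sqrt u))"
    by (intro Ck_on_mult Ck_on_compose[OF \<phi> sq] Ck_on_compose[OF \<psi> sq]) auto
  moreover have "Ck_on n {..<(\<alpha> / a)\<^sup>2} (\<lambda>u. \<phi> (a * sqrt u) * \<psi> (b * sqrt u))"
  proof (rule Ck_on_cong[OF _ _ Ck_on_const[of n _ 0]])
    fix u assume "u \<in> {..<(\<alpha> / a)\<^sup>2}"
    then have "sqrt u < sqrt ((\<alpha> / a)\<^sup>2)" by (intro real_sqrt_less_mono) simp
    also have "\<dots> = \<alpha> / a" using \<alpha> a by simp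
    finally have "sqrt u < \<alpha> / a" .
    then have "a * sqrt u < \<alpha>" using a by (simp add: field_simps)
    then show "0 = \<phi> (a * sqrt u) * \<psi> (b * sqrt u)" by (simp add: zero)
  qed simp
  ultimately have "Ck_on n ({0<..} \<union> {..<(\<alpha> / a)\<^sup>2}) (\<lambda>u. \<phi> (a * sqrt u) * \<psi> (b * sqrt u))"
    by (intro Ck_on_Un) auto
  moreover have "{0<..} \<union> {..<e} = UNIV" if "0 < e" for e :: real
    using that by auto
  then have "{0<..} \<union> {..<(\<alpha> / a)\<^sup>2} = UNIV" using \<alpha> a by simp
  ultimately show ?thesis by simp
qed

text \<open>In the variable \<open>s = e\<^sup>-\<^sup>u\<close> a function \<open>G\<close> of bounded support becomes smooth on the whole line,
  even after division by \<open>s\<^sup>2\<close>.\<close>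

lemma Ck_on_exponential_variable:
  fixes G :: "real \<Rightarrow> complex"
  assumes G: "\<And>n. Ck_on n UNIV G" and zero: "\<And>u. b \<le> u \<Longrightarrow> G u = 0"
  shows "Ck_on n UNIV (\<lambda>s. if 0 < s then (inverse s * inverse s) *\<^sub>R G (- ln s) else 0)"
    (is "Ck_on n UNIV ?H")
proof -
  have "Ck_on n {0<..} (\<lambda>s. (inverse s * inverse s) *\<^sub>R G ((- 1) * ln s))"
    by (intro Ck_on_scaleR Ck_on_mult Ck_on_inverse Ck_on_compose[OF G] Ck_on_const Ck_on_ln) auto
  then have "Ck_on n {0<..} ?H" by (rule Ck_on_cong[rotated 2]) auto
  moreover have "Ck_on n {..<exp (- b)} ?H"
  proof (rule Ck_on_cong[OF _ _ Ck_on_const[of n _ 0]])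
    fix s assume s: "s \<in> {..<exp (- b)}"
    have "G (- ln s) = 0" if "0 < s"
    proof (rule zero)
      have "ln s \<le> ln (exp (- b))" using s that by (subst ln_le_cancel_iff) auto
      then show "b \<le> - ln s" by simp
    qed
    then show "0 = ?H s" by simp
  qed simp
  ultimately have "Ck_on n ({0<..} \<union> {..<exp (- b)}) ?H"
    by (intro Ck_on_Un) auto
  moreover have "{0<..} \<union> {..<exp (- b)} = UNIV" by auto (metis exp_gt_zero less_le_trans linorder_not_less)
  ultimately show ?thesis by simp
qed

section \<open>Smooth spectral multipliers of the heat operator\<close>

context heat_setting begin

lemma K_gt_1: "1 < K"
  using dim_pos K_pos by (simp add: zero_less_log_cancel_iff)

lemma emeasure_doubling_power:
  "0 < s \<Longrightarrow> emeasure \<mu> (ball x (2 ^ n * s)) \<le> ennreal K ^ n * emeasure \<mu> (ball x s)"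
proof (induction n)
  case (Suc n)
  have "emeasure \<mu> (ball x (2 ^ Suc n * s)) \<le> ennreal K * emeasure \<mu> (ball x (2 ^ n * s))"
    using doubling[of "2 ^ n * s" x] Suc.prems by (simp add: mult.assoc)
  also have "\<dots> \<le> ennreal K * (ennreal K ^ n * emeasure \<mu> (ball x s))"
    using Suc by (intro mult_left_mono) auto
  finally show ?case by (simp add: mult.assoc)
qed simp

lemma sets_borel: "sets \<mu> = sets borel"
  using regular by (simp add: regular_borel_measure_def)

text \<open>Some ball around each point lies in a compact set and has finite measure, and every ball of
  radius one has positive measure; doubling spreads both properties to all radii.\<close>

lemma doubling_measure: "doubling_measure \<mu> K"
proof
  show "sets \<mu> = sets borel" by (rule sets_borel)
  show "1 \<le> K" using K_gt_1 by simp
  have fin: "emeasure \<mu> (ball x r) < \<infinity>" for x r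
  proof -
    obtain U C where U: "open U" "compact C" "x \<in> U" "U \<subseteq> C"
      using locally_compact[unfolded locally_def, rule_format, of UNIV x]
      by (auto simp: open_openin[symmetric])
    obtain s where s: "0 < s" "ball x s \<subseteq> U" using U(1,3) open_contains_ball by blast
    have "C \<in> sets \<mu>" using U(2) by (simp add: sets_borel borel_compact)
    then have "emeasure \<mu> (ball x s) \<le> emeasure \<mu> C" using U s by (intro emeasure_mono) auto
    also have "\<dots> < \<infinity>" using regular U(2) by (simp add: regular_borel_measure_def)
    finally have 1: "emeasure \<mu> (ball x s) < \<infinity>" .
    obtain n where n: "r / s < 2 ^ n" using real_arch_pow[of 2 "r / s"] by auto
    then have "ball x r \<subseteq> ball x (2 ^ n * s)" using s by (intro subset_ball) (simp add: field_simps)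
    then have "emeasure \<mu> (ball x r) \<le> emeasure \<mu> (ball x (2 ^ n * s))"
      by (intro emeasure_mono) (simp_all add: sets_borel)
    also have "\<dots> \<le> ennreal K ^ n * emeasure \<mu> (ball x s)" by (rule emeasure_doubling_power[OF s(1)])
    also have "\<dots> < \<infinity>" using 1 by (simp add: ennreal_mult_less_top ennreal_power K_pos less_imp_le)
    finally show ?thesis .
  qed
  then show "emeasure \<mu> (ball x r) < \<infinity>" for x r .
  have em: "emeasure \<mu> (ball x r) = ennreal (measure \<mu> (ball x r))" for x r
    using fin[of x r] by (simp add: emeasure_eq_ennreal_measure less_top)
  show "0 < measure \<mu> (ball x r)" if r: "0 < r" for x r
  proof (rule ccontr)
    assume "\<not> 0 < measure \<mu> (ball x r)"
    then have "measure \<mu> (ball x r) = 0" using measure_nonneg[of \<mu> "ball x r"] by linarith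
    then have 0: "emeasure \<mu> (ball x r) = 0" by (simp add: em)
    obtain n where n: "1 / r < 2 ^ n" using real_arch_pow[of 2 "1 / r"] by auto
    then have "ball x 1 \<subseteq> ball x (2 ^ n * r)" using r by (intro subset_ball) (simp add: field_simps)
    then have "emeasure \<mu> (ball x 1) \<le> emeasure \<mu> (ball x (2 ^ n * r))"
      by (intro emeasure_mono) (simp_all add: sets_borel)
    also have "\<dots> \<le> ennreal K ^ n * emeasure \<mu> (ball x r)" by (rule emeasure_doubling_power[OF r])
    finally have "emeasure \<mu> (ball x 1) = 0" using 0 by simp
    moreover have "ennreal c\<^sub>0 \<le> emeasure \<mu> (ball x 1)"
      using non_collapsing by (rule order_trans) (rule INF_lower, simp)
    ultimately show False using c\<^sub>0_pos by simp
  qed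
  show "measure \<mu> (ball x (2 * r)) \<le> K * measure \<mu> (ball x r)" if "0 < r" for x r
    using doubling[OF that, of x] K_pos
    by (simp add: em ennreal_le_iff flip: ennreal_mult')
qed

sublocale spectral_family \<mu> E
  using spectral_measure by unfold_locales (simp add: spectral_measure_of_def)

text \<open>The exponent \<open>\<beta>\<^sub>0 / (\<beta>\<^sub>0 - 1)\<close> exceeds \<open>1\<close>, and so \<open>s powr (\<beta>\<^sub>0 / (\<beta>\<^sub>0 - 1)) \<ge> s - 1\<close>.\<close>

lemma heat_bound_le:
  assumes r: "0 < r"
  shows "heat_bound \<mu> c \<beta>\<^sub>0 (r powr \<beta>\<^sub>0) x y
    \<le> exp c * exp (- 2 * (c / 2) * (dist x y / r)) / sqrt (measure \<mu> (ball x r) * measure \<mu> (ball y r))"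
proof -
  have rr: "(r powr \<beta>\<^sub>0) powr (1 / \<beta>\<^sub>0) = r" using r \<beta>\<^sub>0_ge_2 by (simp add: powr_powr)
  define s where "s = dist x y / r"
  have s: "0 \<le> s" using r by (simp add: s_def)
  have "s - 1 \<le> s powr (\<beta>\<^sub>0 / (\<beta>\<^sub>0 - 1))"
  proof (cases "1 \<le> s")
    case True
    have "s powr 1 \<le> s powr (\<beta>\<^sub>0 / (\<beta>\<^sub>0 - 1))"
      using True \<beta>\<^sub>0_ge_2 by (intro powr_mono) (auto simp: field_simps)
    then show ?thesis using True by simp
  next
    case False
    have "0 \<le> s powr (\<beta>\<^sub>0 / (\<beta>\<^sub>0 - 1))" by simp
    then show ?thesis using False by linarith
  qed
  from mult_left_mono[OF this, of c] have "- c * s powr (\<beta>\<^sub>0 / (\<beta>\<^sub>0 - 1)) \<le> c + (- 2 * (c / 2) * s)"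
    using c_pos by (simp add: algebra_simps)
  then have "exp (- c * s powr (\<beta>\<^sub>0 / (\<beta>\<^sub>0 - 1))) \<le> exp c * exp (- 2 * (c / 2) * s)"
    by (simp flip: exp_add)
  then show ?thesis
    unfolding heat_bound_def rr s_def[symmetric] by (intro divide_right_mono) auto
qed

lemma localized_heat_kernel:
  assumes r: "0 < r" "r \<le> 1"
  shows "localized_kernel \<mu> K E (\<lambda>u. exp (- (r powr \<beta>\<^sub>0) * u))
    (spectral_integral \<mu> E (\<lambda>u. complex_of_real (exp (- (r powr \<beta>\<^sub>0) * u)))) (p (r powr \<beta>\<^sub>0)) r (c / 2) (C * exp c) \<alpha>\<^sub>0"
proof -
  interpret doubling_measure \<mu> K by (rule doubling_measure)
  define t where "t = r powr \<beta>\<^sub>0"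
  have t: "0 < t" "t \<le> 1" using r \<beta>\<^sub>0_ge_2 by (simp_all add: t_def powr_le1)
  have tr: "t powr (1 / \<beta>\<^sub>0) = r" using r \<beta>\<^sub>0_ge_2 by (simp add: t_def powr_powr)
  have symb: "bounded_symbol (\<lambda>u. complex_of_real (exp (- t * u)))"
    unfolding bounded_symbol_def
  proof (intro conjI exI[of _ 1] allI impI)
    show "(\<lambda>u. complex_of_real (exp (- t * u))) \<in> borel_measurable half_line"
      by (intro measurable_restrict_space1) simp
    show "cmod (complex_of_real (exp (- t * u))) \<le> 1" if "0 \<le> u" for u using that t by simp
  qed
  have bound: "C * heat_bound \<mu> c \<beta>\<^sub>0 t x y
      \<le> C * exp c * exp (- 2 * (c / 2) * (dist x y / r)) / sqrt (measure \<mu> (ball x r) * measure \<mu> (ball y r))" for x y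
    using mult_left_mono[OF heat_bound_le[OF r(1), of x y], of C] C_pos by (simp add: t_def mult.assoc)
  show ?thesis
    unfolding t_def[symmetric]
  proof unfold_locales
    show "0 < r" "0 < c / 2" "0 < C * exp c" "0 < \<alpha>\<^sub>0" using r c_pos C_pos \<alpha>\<^sub>0_pos by simp_all
    show "(\<lambda>u. exp (- t * u)) \<in> borel_measurable half_line"
      by (intro measurable_restrict_space1) simp
    show "0 \<le> exp (- t * u) \<and> exp (- t * u) \<le> 1" if "0 \<le> u" for u using that t by simp
    show "represents (\<lambda>u. complex_of_real (exp (- t * u))) (spectral_integral \<mu> E (\<lambda>u. complex_of_real (exp (- t * u))))"
      by (rule represents_spectral_integral[OF symb])
    show "has_kernel \<mu> (spectral_integral \<mu> E (\<lambda>u. complex_of_real (exp (- t * u)))) (p t)"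
      by (rule heat_kernel[OF t(1)])
    show "cmod (p t x y) \<le> C * exp c * exp (- 2 * (c / 2) * (dist x y / r)) / sqrt (measure \<mu> (ball x r) * measure \<mu> (ball y r))" for x y
      using UE[OF t, of x y] bound[of x y] by linarith
    show "cmod (p t x y - p t x y') \<le> (dist y y' / r) powr \<alpha>\<^sub>0 *
        (C * exp c * exp (- 2 * (c / 2) * (dist x y / r)) / sqrt (measure \<mu> (ball x r) * measure \<mu> (ball y r)))"
      if "dist y y' \<le> r" for x y y'
    proof -
      have "cmod (p t x y - p t x y') \<le> C * (dist y y' / r) powr \<alpha>\<^sub>0 * heat_bound \<mu> c \<beta>\<^sub>0 t x y"
        using HE[OF t, of y y' x] that by (simp add: tr)
      also have "\<dots> = (dist y y' / r) powr \<alpha>\<^sub>0 * (C * heat_bound \<mu> c \<beta>\<^sub>0 t x y)" by simp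
      also have "\<dots> \<le> (dist y y' / r) powr \<alpha>\<^sub>0 *
        (C * exp c * exp (- 2 * (c / 2) * (dist x y / r)) / sqrt (measure \<mu> (ball x r) * measure \<mu> (ball y r)))"
        by (intro mult_left_mono bound) simp
      finally show ?thesis .
    qed
  qed
qed

text \<open>Factor \<open>G(r powr \<beta>\<^sub>0 * u) = a u * H (a u) * a u\<close> with \<open>a u = exp (- r powr \<beta>\<^sub>0 * u)\<close> and
  \<open>H s = G (- ln s) / s\<^sup>2\<close>. The function \<open>H\<close> does not depend on \<open>r\<close>, hence neither do its Chebyshev
  coefficients nor the constant.\<close>

lemma smooth_multiplier_kernel:
  fixes G :: "real \<Rightarrow> complex" and n :: nat
  assumes G: "\<And>n. Ck_on n UNIV G" and zero: "\<And>u. b \<le> u \<Longrightarrow> G u = 0"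
  shows "\<exists>B\<ge>0. \<forall>r S. 0 < r \<longrightarrow> r \<le> 1 \<longrightarrow> represents (\<lambda>u. G (r powr \<beta>\<^sub>0 * u)) S \<longrightarrow>
    (\<exists>\<kappa>. has_kernel \<mu> S \<kappa> \<and> continuous_on UNIV (\<lambda>(x, y). \<kappa> x y) \<and>
      (\<forall>x y. cmod (\<kappa> x y) \<le> B / (sqrt (measure \<mu> (ball x r) * measure \<mu> (ball y r)) * (1 + dist x y / r) ^ n)))"
proof -
  define H where "H s = (if 0 < s then (inverse s * inverse s) *\<^sub>R G (- ln s) else 0)" for s
  have H: "Ck_on n UNIV H" for n
    unfolding H_def by (rule Ck_on_exponential_variable[OF G zero])
  obtain w where w: "\<And>n. summable (\<lambda>k. cmod (w k) * (1 + real k) ^ n)"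
    "\<And>s. s \<in> {0..1} \<Longrightarrow> (\<lambda>k. w k * of_real (chebyshev k s)) sums H s"
    using chebyshev_expansion[OF H] by blast
  define N where "N = C * exp c"
  define M where "M = dyadic_exp_sum K (c / 2)"
  have pos: "0 < N" "0 < M" "0 < c / 2"
    using C_pos c_pos K_gt_1 by (simp_all add: N_def M_def dyadic_exp_sum_pos)
  obtain Z where Z: "0 < Z" "\<And>k R. 0 \<le> R \<Longrightarrow>
      min 1 ((4 * N * M + 3) ^ k * exp (- (c / 2) * R)) * (1 + R) ^ n \<le> Z * (1 + real k) ^ n"
    using min_exp_growth_decay[of "4 * N * M + 3" "c / 2" n] pos by auto
  define B where "B = 2 * N\<^sup>2 * M * Z * (\<Sum>k. cmod (w k) * (1 + real k) ^ n)"
  have "0 \<le> B" unfolding B_def using pos Z(1) w(1) by (intro mult_nonneg_nonneg suminf_nonneg) auto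
  moreover have "\<exists>\<kappa>. has_kernel \<mu> S \<kappa> \<and> continuous_on UNIV (\<lambda>(x, y). \<kappa> x y) \<and>
      (\<forall>x y. cmod (\<kappa> x y) \<le> B / (sqrt (measure \<mu> (ball x r) * measure \<mu> (ball y r)) * (1 + dist x y / r) ^ n))"
    if r: "0 < r" "r \<le> 1" and S: "represents (\<lambda>u. G (r powr \<beta>\<^sub>0 * u)) S" for r S
  proof -
    define a where "a u = exp (- (r powr \<beta>\<^sub>0) * u)" for u
    define A where "A = spectral_integral \<mu> E (\<lambda>u. complex_of_real (a u))"
    interpret k: localized_kernel \<mu> K E a A "p (r powr \<beta>\<^sub>0)" r "c / 2" N \<alpha>\<^sub>0
      using localized_heat_kernel[OF r] by (simp add: a_def[abs_def] A_def N_def)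
    have Hc: "continuous_on UNIV H" by (rule Ck_on_continuous[OF H])
    have symb: "bounded_symbol (\<lambda>u. H (a u))"
    proof -
      have "bounded (H ` {0..1})"
        using compact_imp_bounded[OF compact_continuous_image[OF continuous_on_subset[OF Hc] compact_Icc]] by simp
      then obtain e where "\<forall>s\<in>{0..1}. cmod (H s) \<le> e" by (auto simp: bounded_iff)
      then have "\<forall>u\<ge>0. cmod (H (a u)) \<le> e" using k.a_range by auto
      moreover have "(\<lambda>u. H (a u)) \<in> borel_measurable half_line"
        by (rule borel_measurable_continuous_on[OF Hc k.a_borel])
      ultimately show ?thesis by (auto simp: bounded_symbol_def)
    qed
    define T where "T = spectral_integral \<mu> E (\<lambda>u. H (a u))"
    have T: "represents (\<lambda>u. H (a u)) T" unfolding T_def by (rule represents_spectral_integral[OF symb])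
    have ATA: "represents (\<lambda>u. of_real (a u) * (H (a u) * of_real (a u))) (\<lambda>f. A (T (A f)))"
      by (intro represents_mult[OF k.A_represents represents_mult[OF T k.A_represents symb k.bounded_symbol_a]
            k.bounded_symbol_a bounded_symbol_mult[OF symb k.bounded_symbol_a]])
    have eq: "G (r powr \<beta>\<^sub>0 * u) = of_real (a u) * (H (a u) * of_real (a u))" for u
      by (simp add: H_def a_def scaleR_conv_of_real)
    have bound: "cmod (k.sandwiched_kernel T x y)
        \<le> B / (sqrt (measure \<mu> (ball x r) * measure \<mu> (ball y r)) * (1 + dist x y / r) ^ n)" for x y
      unfolding B_def M_def
      by (rule k.sandwiched_kernel_bound(2)[OF T symb _ w(1)]) (use w(2) Z(2) in \<open>auto simp: k.growth_def M_def\<close>)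
    have meas: "(\<lambda>(x, y). k.sandwiched_kernel T x y) \<in> borel_measurable (\<mu> \<Otimes>\<^sub>M \<mu>)"
      by (rule k.sandwiched_kernel_bound(1)[OF T symb _ w(1)]) (use w(2) Z(2) in \<open>auto simp: k.growth_def M_def\<close>)
    have "has_kernel \<mu> S (k.sandwiched_kernel T)"
      unfolding has_kernel_def
    proof (intro conjI ballI meas)
      fix f assume f: "f \<in> L2 \<mu>"
      have "AE x in \<mu>. S f x = A (T (A f)) x" by (rule represents_unique[OF S ATA eq f])
      with k.sandwiched_kernel_integral[OF T symb f]
      show "AE x in \<mu>. integrable \<mu> (\<lambda>y. k.sandwiched_kernel T x y * f y) \<and>
          S f x = (\<integral>y. k.sandwiched_kernel T x y * f y \<partial>\<mu>)"
        by eventually_elim simp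
    qed
    with k.continuous_sandwiched_kernel[OF T symb] bound show ?thesis by blast
  qed
  ultimately show ?thesis by blast
qed

lemma bounded_symbol_dilate:
  assumes f: "half_smooth f" and supp: "half_supp f \<subseteq> {\<alpha>..\<beta>}" and \<alpha>: "0 < \<alpha>" and \<delta>: "0 < \<delta>"
  shows "bounded_symbol (\<lambda>u. dilate \<beta>\<^sub>0 \<delta> f j (sqrt u))"
proof -
  let ?f = "zero_extension f"
  have c: "continuous_on UNIV ?f"
    by (rule Ck_on_continuous[OF Ck_on_zero_extension[OF f _ \<alpha>]]) (use supp in auto)
  have eq: "dilate \<beta>\<^sub>0 \<delta> f j (sqrt u) = ?f (\<delta> powr (real j * \<beta>\<^sub>0 / 2) * sqrt u)" if "0 \<le> u" for u
    using that by (simp add: dilate_def zero_extension_def)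
  have "bounded (?f ` {\<alpha>..\<beta>})"
    using compact_imp_bounded[OF compact_continuous_image[OF continuous_on_subset[OF c] compact_Icc]] by simp
  then obtain e where e: "\<forall>x\<in>{\<alpha>..\<beta>}. cmod (?f x) \<le> e" by (auto simp: bounded_iff)
  have "cmod (?f x) \<le> \<bar>e\<bar>" for x
  proof (cases "x \<in> {\<alpha>..\<beta>}")
    case True
    then show ?thesis using bspec[OF e True] by linarith
  next
    case False
    then show ?thesis
      using zero_extension_left[OF supp, of x] zero_extension_outside[OF f supp \<alpha>, of x] by auto
  qed
  moreover have "(\<lambda>u. ?f (\<delta> powr (real j * \<beta>\<^sub>0 / 2) * sqrt u)) \<in> borel_measurable half_line"
    by (rule borel_measurable_continuous_on[OF c]) (intro measurable_restrict_space1, simp)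
  then have "(\<lambda>u. dilate \<beta>\<^sub>0 \<delta> f j (sqrt u)) \<in> borel_measurable half_line"
    by (rule measurable_cong[THEN iffD1, rotated]) (simp add: eq space_restrict_space)
  ultimately show ?thesis unfolding bounded_symbol_def using eq by auto
qed

end

text \<open>The supports of the two dilates meet in at most one point when the scales differ by two or more,
  and there the functions vanish.\<close>

lemma dilate_product_zero:
  assumes f: "half_smooth f" "half_supp f \<subseteq> {\<delta> powr (\<beta> / 2)..\<delta> powr (- \<beta> / 2)}"
    and g: "half_smooth g" "half_supp g \<subseteq> {\<delta> powr (\<beta> / 2)..\<delta> powr (- \<beta> / 2)}"
    and \<delta>: "0 < \<delta>" "\<delta> < 1" and \<beta>: "0 < \<beta>" and jk: "j + 2 \<le> k" and x: "0 \<le> x"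
  shows "dilate \<beta> \<delta> f j x * dilate \<beta> \<delta> g k x = 0"
proof (cases "\<delta> powr (- \<beta> / 2) \<le> \<delta> powr (real j * \<beta> / 2) * x")
  case True
  have "0 \<le> \<delta> powr (real j * \<beta> / 2) * x" using x by simp
  then have "f (\<delta> powr (real j * \<beta> / 2) * x) = zero_extension f (\<delta> powr (real j * \<beta> / 2) * x)"
    by (simp add: zero_extension_def)
  then show ?thesis
    using zero_extension_outside[OF f _ True] \<delta> by (simp add: dilate_def)
next
  case False
  have "\<delta> powr (real k * \<beta> / 2) * x = \<delta> powr (real (k - j) * \<beta> / 2) * (\<delta> powr (real j * \<beta> / 2) * x)"
    using jk by (simp add: of_nat_diff field_simps flip: powr_add)
  also have "\<dots> < \<delta> powr (real (k - j) * \<beta> / 2) * \<delta> powr (- \<beta> / 2)"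
    using False \<delta> by (intro mult_strict_left_mono) auto
  also have "\<dots> = \<delta> powr ((real (k - j) - 1) * \<beta> / 2)"
    by (simp add: field_simps flip: powr_add)
  also have "\<dots> \<le> \<delta> powr (\<beta> / 2)"
    using \<delta> \<beta> jk by (intro powr_mono') (auto simp: of_nat_diff)
  finally have "g (\<delta> powr (real k * \<beta> / 2) * x) = 0"
    using half_supp_zero[OF g(2), of "\<delta> powr (real k * \<beta> / 2) * x"] x by auto
  then show ?thesis by (simp add: dilate_def)
qed

lemma has_kernel_zero:
  assumes "\<And>f. f \<in> L2 \<mu> \<Longrightarrow> AE x in \<mu>. S f x = 0"
  shows "has_kernel \<mu> S (\<lambda>x y. 0)"
  using assms unfolding has_kernel_def by auto

theorem proposition2p14:
  fixes \<mu> :: "'a::complete_space measure"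
    and K K\<^sub>s c\<^sub>0 :: real
    and D :: "('a \<Rightarrow> complex) set"
    and L :: "('a \<Rightarrow> complex) \<Rightarrow> ('a \<Rightarrow> complex)"
    and E :: "real set \<Rightarrow> ('a \<Rightarrow> complex) \<Rightarrow> ('a \<Rightarrow> complex)"
    and p :: "real \<Rightarrow> 'a \<Rightarrow> 'a \<Rightarrow> complex"
    and C c \<alpha>\<^sub>0 \<beta>\<^sub>0 \<delta> :: real
    and \<Phi>\<^sub>0 \<Phi> \<Psi>\<^sub>0 \<Psi> :: "real \<Rightarrow> complex"
    and m :: nat and \<sigma> :: real
  assumes "heat_setting \<mu> K K\<^sub>s c\<^sub>0 D L E p C c \<alpha>\<^sub>0 \<beta>\<^sub>0"
    and "0 < \<delta>" and "\<delta> < 1"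
    and "admissible \<beta>\<^sub>0 \<delta> \<Phi>\<^sub>0 \<Phi>"
    and "admissible \<beta>\<^sub>0 \<delta> \<Psi>\<^sub>0 \<Psi>"
    and "\<sigma> > log 2 K"
  shows "\<exists>C\<^sub>\<sigma>\<^sub>m>1. \<forall>j\<ge>1. \<forall>k\<ge>1.
    \<exists>\<kappa>. has_kernel \<mu>
           (fun_of_sqrt \<mu> E (dilate \<beta>\<^sub>0 \<delta> \<Phi> j) \<circ> fun_of_sqrt \<mu> E (dilate \<beta>\<^sub>0 \<delta> \<Psi> k)) \<kappa> \<and>
         continuous_on UNIV (\<lambda>(x, y). \<kappa> x y) \<and>
         (\<forall>x y. cmod (\<kappa> x y) \<le>
            C\<^sub>\<sigma>\<^sub>m * \<delta> powr (\<bar>real k - real j\<bar> * (real m * \<beta>\<^sub>0 - log 2 K)) *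
            D_kernel \<mu> (\<delta> ^ min k j) \<sigma> x y)"
proof -
  interpret heat_setting \<mu> K K\<^sub>s c\<^sub>0 D L E p C c \<alpha>\<^sub>0 \<beta>\<^sub>0 by fact
  note \<delta> = assms(2,3)
  have \<beta>: "0 < \<beta>\<^sub>0" using \<beta>\<^sub>0_ge_2 by simp
  let ?lo = "\<delta> powr (\<beta>\<^sub>0 / 2)" and ?hi = "\<delta> powr (- \<beta>\<^sub>0 / 2)"
  have lo: "0 < ?lo" using \<delta> by simp
  have \<Phi>: "half_smooth \<Phi>" "half_supp \<Phi> \<subseteq> {?lo..?hi}" and \<Psi>: "half_smooth \<Psi>" "half_supp \<Psi> \<subseteq> {?lo..?hi}"
    using assms(4,5) by (auto simp: admissible_def)
  define n where "n = nat \<lceil>\<sigma>\<rceil>"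
  have n: "\<sigma> \<le> real n" unfolding n_def by linarith
  define pw where "pw i = \<delta> powr (real i * \<beta>\<^sub>0 / 2)" for i :: nat
  define G where "G a b u = zero_extension \<Phi> (pw a * sqrt u) * zero_extension \<Psi> (pw b * sqrt u)" for a b u
  have pw: "0 < pw i" for i using \<delta> by (simp add: pw_def)
  have G_smooth: "Ck_on l UNIV (G a b)" for l a b
    unfolding G_def
    by (rule Ck_on_sqrt_product[OF Ck_on_zero_extension[OF \<Phi>(1) _ lo] Ck_on_zero_extension[OF \<Psi>(1) _ lo]
          zero_extension_left[OF \<Phi>(2)] lo pw]) (use \<Phi>(2) \<Psi>(2) in auto)
  have G_zero: "G a b u = 0" if "(?hi / pw a)\<^sup>2 \<le> u" for a b u
  proof -
    have "?hi / pw a \<le> sqrt u" using real_le_rsqrt[OF that] .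
    then have "?hi \<le> pw a * sqrt u" using pw[of a] by (simp add: divide_le_eq mult.commute)
    then show ?thesis using zero_extension_outside[OF \<Phi> lo] by (simp add: G_def)
  qed
  have "\<exists>B\<ge>0. \<forall>r S. 0 < r \<longrightarrow> r \<le> 1 \<longrightarrow> represents (\<lambda>u. G a b (r powr \<beta>\<^sub>0 * u)) S \<longrightarrow>
    (\<exists>\<kappa>. has_kernel \<mu> S \<kappa> \<and> continuous_on UNIV (\<lambda>(x, y). \<kappa> x y) \<and>
      (\<forall>x y. cmod (\<kappa> x y) \<le> B / (sqrt (measure \<mu> (ball x r) * measure \<mu> (ball y r)) * (1 + dist x y / r) ^ n)))" for a b
    by (rule smooth_multiplier_kernel[OF G_smooth G_zero])
  then obtain B where B: "\<And>a b. 0 \<le> B a b" and kernel: "\<And>a b r S. 0 < r \<Longrightarrow> r \<le> 1 \<Longrightarrow>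
    represents (\<lambda>u. G a b (r powr \<beta>\<^sub>0 * u)) S \<Longrightarrow>
    (\<exists>\<kappa>. has_kernel \<mu> S \<kappa> \<and> continuous_on UNIV (\<lambda>(x, y). \<kappa> x y) \<and>
      (\<forall>x y. cmod (\<kappa> x y) \<le> B a b / (sqrt (measure \<mu> (ball x r) * measure \<mu> (ball y r)) * (1 + dist x y / r) ^ n)))"
    by metis
  \<comment> \<open>When the two scales differ by at most one, only these three functions \<open>G a b\<close> occur, with
    \<open>a\<close> and \<open>b\<close> the excess of \<open>j\<close> and \<open>k\<close> over their minimum.\<close>
  define B0 where "B0 = B 0 0 + B 0 1 + B 1 0"
  \<comment> \<open>A lower bound for the power of \<open>\<delta>\<close> in the claim in that case.\<close>
  define w where "w = min 1 (\<delta> powr (real m * \<beta>\<^sub>0 - log 2 K))"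
  have w: "0 < w" using \<delta> by (simp add: w_def)
  define Z where "Z = 2 + B0 / w"
  have B0: "0 \<le> B0" using B by (simp add: B0_def)
  have "1 < Z" using B0 w by (simp add: Z_def add_pos_nonneg)
  moreover have "\<exists>\<kappa>. has_kernel \<mu>
           (fun_of_sqrt \<mu> E (dilate \<beta>\<^sub>0 \<delta> \<Phi> j) \<circ> fun_of_sqrt \<mu> E (dilate \<beta>\<^sub>0 \<delta> \<Psi> k)) \<kappa> \<and>
         continuous_on UNIV (\<lambda>(x, y). \<kappa> x y) \<and>
         (\<forall>x y. cmod (\<kappa> x y) \<le>
            Z * \<delta> powr (\<bar>real k - real j\<bar> * (real m * \<beta>\<^sub>0 - log 2 K)) *
            D_kernel \<mu> (\<delta> ^ min k j) \<sigma> x y)" for j k :: nat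
  proof -
    let ?S = "fun_of_sqrt \<mu> E (dilate \<beta>\<^sub>0 \<delta> \<Phi> j) \<circ> fun_of_sqrt \<mu> E (dilate \<beta>\<^sub>0 \<delta> \<Psi> k)"
    let ?\<phi> = "\<lambda>u. dilate \<beta>\<^sub>0 \<delta> \<Phi> j (sqrt u) * dilate \<beta>\<^sub>0 \<delta> \<Psi> k (sqrt u)"
    let ?e = "\<delta> powr (\<bar>real k - real j\<bar> * (real m * \<beta>\<^sub>0 - log 2 K))"
    have symb: "bounded_symbol (\<lambda>u. dilate \<beta>\<^sub>0 \<delta> \<Phi> j (sqrt u))" "bounded_symbol (\<lambda>u. dilate \<beta>\<^sub>0 \<delta> \<Psi> k (sqrt u))"
      using bounded_symbol_dilate[OF \<Phi> lo \<delta>(1)] bounded_symbol_dilate[OF \<Psi> lo \<delta>(1)] by auto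
    have S: "represents ?\<phi> ?S"
      unfolding o_def fun_of_sqrt_def
      by (rule represents_mult[OF represents_spectral_integral[OF symb(1)] represents_spectral_integral[OF symb(2)] symb])
    define i where "i = min k j"
    define r where "r = \<delta> ^ i"
    have r: "0 < r" "r \<le> 1" using \<delta> by (simp_all add: r_def power_le_one)
    interpret doubling_measure \<mu> K by (rule doubling_measure)
    have Dpos: "0 \<le> D_kernel \<mu> r \<sigma> x y" for x y
      by (simp add: D_kernel_def)
    show ?thesis
    proof (cases "j + 2 \<le> k \<or> k + 2 \<le> j")
      case True
      have "?\<phi> u = 0" if "0 \<le> u" for u
        using True dilate_product_zero[OF \<Phi> \<Psi> \<delta> \<beta>, of j k "sqrt u"]
          dilate_product_zero[OF \<Psi> \<Phi> \<delta> \<beta>, of k j "sqrt u"] that by (auto simp: mult.commute)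
      then have "AE x in \<mu>. ?S f x = 0" if "f \<in> L2 \<mu>" for f
        using represents_unique[OF S represents_zero _ that] by simp
      then have "has_kernel \<mu> ?S (\<lambda>x y. 0)" by (rule has_kernel_zero)
      moreover have "cmod 0 \<le> Z * ?e * D_kernel \<mu> (\<delta> ^ min k j) \<sigma> x y" for x y
        using \<open>1 < Z\<close> Dpos[of x y] by (simp add: r_def i_def)
      ultimately show ?thesis by (intro exI[of _ "\<lambda>x y. 0"]) auto
    next
      case False
      define a b where "a = j - i" and "b = k - i"
      have ab: "j = a + i" "k = b + i" "(a, b) \<in> {(0, 0), (0, 1), (1, 0)}"
        using False by (auto simp: a_def b_def i_def)
      have "r powr \<beta>\<^sub>0 = (\<delta> powr real i) powr \<beta>\<^sub>0"
        using \<delta> by (simp add: r_def powr_realpow)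
      then have rp: "sqrt (r powr \<beta>\<^sub>0) = pw i"
        using \<delta> by (simp add: powr_powr pw_def powr_half_sqrt[symmetric])
      have "?\<phi> u = G a b (r powr \<beta>\<^sub>0 * u)" if "0 \<le> u" for u
      proof -
        have "pw (l + i) * sqrt u = pw l * sqrt (r powr \<beta>\<^sub>0 * u)" for l
          by (simp add: real_sqrt_mult rp) (simp add: pw_def field_simps flip: powr_add)
        moreover have "0 \<le> pw l * sqrt (r powr \<beta>\<^sub>0 * u)" for l
          using pw[of l] that by (simp add: less_imp_le)
        moreover have "?\<phi> u = \<Phi> (pw j * sqrt u) * \<Psi> (pw k * sqrt u)"
          by (simp only: dilate_def pw_def)
        ultimately show ?thesis
          unfolding G_def zero_extension_def by (simp only: ab(1,2) if_True)
      qed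
      from kernel[OF r represents_cong[OF S this]] obtain \<kappa> where \<kappa>: "has_kernel \<mu> ?S \<kappa>"
        "continuous_on UNIV (\<lambda>(x, y). \<kappa> x y)"
        "\<And>x y. cmod (\<kappa> x y) \<le> B a b / (sqrt (measure \<mu> (ball x r) * measure \<mu> (ball y r)) * (1 + dist x y / r) ^ n)"
        by blast
      have "cmod (\<kappa> x y) \<le> Z * ?e * D_kernel \<mu> (\<delta> ^ min k j) \<sigma> x y" for x y
      proof -
        let ?R = "1 + dist x y / r"
        have R: "1 \<le> ?R" using r by simp
        have "?R powr \<sigma> \<le> ?R powr real n" using R n by (intro powr_mono) auto
        then have Rn: "?R powr \<sigma> \<le> ?R ^ n" using R by (simp add: powr_realpow)
        let ?v = "sqrt (measure \<mu> (ball x r) * measure \<mu> (ball y r))"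
        have v: "0 < ?v" using ball_pos[OF r(1)] by simp
        have "cmod (\<kappa> x y) \<le> B a b / (?v * ?R ^ n)" by (rule \<kappa>(3))
        also have "\<dots> \<le> B a b / (?v * ?R powr \<sigma>)"
          using Rn v R B[of a b] by (intro divide_left_mono mult_left_mono mult_pos_pos) auto
        also have "\<dots> = B a b * D_kernel \<mu> r \<sigma> x y" by (simp add: D_kernel_def)
        also have "\<dots> \<le> (Z * ?e) * D_kernel \<mu> r \<sigma> x y"
        proof (intro mult_right_mono Dpos)
          have "B a b \<le> B0" using ab(3) B[of 0 0] B[of 0 1] B[of 1 0] by (auto simp: B0_def)
          also have "\<dots> = B0 / w * w" using w by simp
          also have "\<dots> \<le> Z * ?e"
          proof (rule mult_mono)
            show "w \<le> ?e" using ab by (auto simp: w_def)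
          qed (use B0 w \<open>1 < Z\<close> in \<open>auto simp: Z_def\<close>)
          finally show "B a b \<le> Z * ?e" .
        qed
        finally show ?thesis by (simp add: r_def i_def)
      qed
      with \<kappa>(1,2) show ?thesis by blast
    qed
  qed
  ultimately show ?thesis by blast
qed

end
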